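(* Let $x\in\{l,u\}$. The functor $\mathcal P_x\mathcal V:\mathbf{Dom}\to\mathbf{Dom}$ is strong: for all domains $X,Y$ there is a tensorial strength $\mathrm{str}_{X,Y}: X\times\mathcal P_x\mathcal V(Y)\to\mathcal P_x\mathcal V(X\times Y)$ (continuous, natural in $X,Y$, and satisfying the usual strength axioms) which is determined on basic elements by $$(a,\,x(F))\mapsto x\big(\{\delta_a\otimes\mu\mid \mu\in F\}\big),\qquad\text{where } \delta_a\otimes \textstyle\sum_i p_i\cdot y_i=\sum_i p_i\cdot (a,y_i)$$ for every finite set $F$ of finite linear combinations of point masses. The same holds for $x=b$, with $\mathcal P_b\mathcal V:\mathbf{CohDom}\to\mathbf{CohDom}$ in place of $\mathbf{Dom}$.
   Context: $\mathbf{Dom}$ is the category of domains (continuous directed-complete posets) and Scott-continuous maps; $\mathbf{CohDom}$ its full subcategory of coherent domains (domains in which the intersection of two compact saturated sets is compact). For a domain $X$, $\mathcal V(X)$ is the set of continuous valuations on $X$ (maps $\mu$ from Scott-opens to $[0,\infty]$ that are strict, monotone, modular and preserve directed unions), ordered pointwise; it is a continuous d-cone (a real cone which is a continuous dcpo with Scott-continuous addition and scalar multiplication) with basis the finite combinations $\sum_i r_i\cdot x_i:=\sum_i r_i\delta_{x_i}$ of point masses $\delta_x$; $\mathcal V(f)(\sum_i r_i\cdot x_i)=\sum_i r_i\cdot f(x_i)$. For a continuous d-cone $C$: $\mathcal P_l(C)$ is the set of nonempty Scott-closed convex subsets ordered by $A\le_l B$ iff ${\downarrow}A\subseteq{\downarrow}B$;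 $\mathcal P_u(C)$ the nonempty compact saturated convex subsets ordered by $A\le_u B$ iff ${\uparrow}B\subseteq{\uparrow}A$; for Lawson-compact $C$, $\mathcal P_b(C)$ the nonempty convex, Lawson-compact, order-convex subsets ordered by the conjunction of both conditions. For finite $F\subseteq C$, $l(F)=\overline{\mathrm{conv}\,F}$ (Scott closure of the convex hull), $u(F)={\uparrow}\mathrm{conv}\,F$, $b(F)=l(F)\cap{\uparrow}\mathrm{conv}\,F$; the sets $x(F)$ form a basis of $\mathcal P_x(C)$. The composite $\mathcal P_x\mathcal V$ is a monad (on $\mathbf{Dom}$ for $x\in\{l,u\}$, on $\mathbf{CohDom}$ for $x=b$) with unit $a\mapsto x(\{\delta_a\})$. *)

theory Defs
  imports "HOL-Analysis.Analysis"
begin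

type_synonym 'a po = "'a set \<times> ('a \<Rightarrow> 'a \<Rightarrow> bool)"

definition car :: "'a po \<Rightarrow> 'a set" where "car P = fst P"
definition leq :: "'a po \<Rightarrow> 'a \<Rightarrow> 'a \<Rightarrow> bool" where "leq P = snd P"

definition poset :: "'a po \<Rightarrow> bool" where
  "poset P \<longleftrightarrow> (\<forall>x\<in>car P. leq P x x)
     \<and> (\<forall>x\<in>car P. \<forall>y\<in>car P. leq P x y \<and> leq P y x \<longrightarrow> x = y)
     \<and> (\<forall>x\<in>car P. \<forall>y\<in>car P. \<forall>z\<in>car P. leq P x y \<and> leq P y z \<longrightarrow> leq P x z)"

definition directed :: "'a po \<Rightarrow> 'a set \<Rightarrow> bool" where
  "directed P D \<longleftrightarrow> D \<subseteq> car P \<and> D \<noteq> {}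
     \<and> (\<forall>x\<in>D. \<forall>y\<in>D. \<exists>z\<in>D. leq P x z \<and> leq P y z)"

definition is_lub :: "'a po \<Rightarrow> 'a set \<Rightarrow> 'a \<Rightarrow> bool" where
  "is_lub P D s \<longleftrightarrow> s \<in> car P \<and> (\<forall>d\<in>D. leq P d s)
     \<and> (\<forall>u\<in>car P. (\<forall>d\<in>D. leq P d u) \<longrightarrow> leq P s u)"

definition dcpo :: "'a po \<Rightarrow> bool" where
  "dcpo P \<longleftrightarrow> poset P \<and> (\<forall>D. directed P D \<longrightarrow> (\<exists>s. is_lub P D s))"

definition way_below :: "'a po \<Rightarrow> 'a \<Rightarrow> 'a \<Rightarrow> bool" where
  "way_below P x y \<longleftrightarrow> x \<in> car P \<and> y \<in> car P \<and>
     (\<forall>D s. directed P D \<longrightarrow> is_lub P D s \<longrightarrow> leq P y s \<longrightarrow> (\<exists>d\<in>D. leq P x d))"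

definition domain :: "'a po \<Rightarrow> bool" where
  "domain P \<longleftrightarrow> dcpo P \<and>
     (\<forall>y\<in>car P. directed P {x. way_below P x y} \<and> is_lub P {x. way_below P x y} y)"

definition upper :: "'a po \<Rightarrow> 'a set \<Rightarrow> 'a set" where
  "upper P A = {y\<in>car P. \<exists>x\<in>A. leq P x y}"

definition lower :: "'a po \<Rightarrow> 'a set \<Rightarrow> 'a set" where
  "lower P A = {y\<in>car P. \<exists>x\<in>A. leq P y x}"

definition scott_open :: "'a po \<Rightarrow> 'a set \<Rightarrow> bool" where
  "scott_open P U \<longleftrightarrow> U \<subseteq> car P \<and> upper P U \<subseteq> U \<and>
     (\<forall>D s. directed P D \<longrightarrow> is_lub P D s \<longrightarrow> s \<in> U \<longrightarrow> D \<inter> U \<noteq> {})"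

definition scott_closed :: "'a po \<Rightarrow> 'a set \<Rightarrow> bool" where
  "scott_closed P C \<longleftrightarrow> C \<subseteq> car P \<and> scott_open P (car P - C)"

definition scott_closure :: "'a po \<Rightarrow> 'a set \<Rightarrow> 'a set" where
  "scott_closure P A = \<Inter>{C. scott_closed P C \<and> A \<subseteq> C}"

definition scott_compact :: "'a po \<Rightarrow> 'a set \<Rightarrow> bool" where
  "scott_compact P K \<longleftrightarrow> K \<subseteq> car P \<and>
     (\<forall>\<U>. (\<forall>U\<in>\<U>. scott_open P U) \<longrightarrow> K \<subseteq> \<Union>\<U> \<longrightarrow>
        (\<exists>\<V>\<subseteq>\<U>. finite \<V> \<and> K \<subseteq> \<Union>\<V>))"

definition saturated :: "'a po \<Rightarrow> 'a set \<Rightarrow> bool" where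
  "saturated P K \<longleftrightarrow> K \<subseteq> car P \<and> upper P K = K"

definition coherent :: "'a po \<Rightarrow> bool" where
  "coherent P \<longleftrightarrow> (\<forall>K1 K2. scott_compact P K1 \<and> saturated P K1 \<and>
       scott_compact P K2 \<and> saturated P K2 \<longrightarrow> scott_compact P (K1 \<inter> K2))"

definition lawson_topology :: "'a po \<Rightarrow> 'a topology" where
  "lawson_topology P = topology_generated_by
     ({U. scott_open P U} \<union> {car P - upper P {x} | x. x \<in> car P})"

definition lawson_compact :: "'a po \<Rightarrow> 'a set \<Rightarrow> bool" where
  "lawson_compact P K \<longleftrightarrow> K \<subseteq> car P \<and> compactin (lawson_topology P) K"

definition order_convex :: "'a po \<Rightarrow> 'a set \<Rightarrow> bool" where
  "order_convex P A \<longleftrightarrow> (\<forall>x\<in>A. \<forall>z\<in>A. \<forall>y\<in>car P. leq P x y \<and> leq P y z \<longrightarrow> y \<in> A)"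

definition scott_continuous :: "'a po \<Rightarrow> 'b po \<Rightarrow> ('a \<Rightarrow> 'b) \<Rightarrow> bool" where
  "scott_continuous P Q f \<longleftrightarrow> (\<forall>x\<in>car P. f x \<in> car Q)
     \<and> (\<forall>x\<in>car P. \<forall>y\<in>car P. leq P x y \<longrightarrow> leq Q (f x) (f y))
     \<and> (\<forall>D s. directed P D \<longrightarrow> is_lub P D s \<longrightarrow> is_lub Q (f ` D) (f s))"

definition prod_po :: "'a po \<Rightarrow> 'b po \<Rightarrow> ('a \<times> 'b) po" where
  "prod_po P Q = (car P \<times> car Q, \<lambda>(a, b) (c, d). leq P a c \<and> leq Q b d)"

definition unit_po :: "unit po" where
  "unit_po = (UNIV, (=))"

text \<open>A valuation is a map on subsets; by convention it is 0 on non-Scott-open sets,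
  so that valuations are determined by their values on Scott-open sets.\<close>
type_synonym 'a val = "'a set \<Rightarrow> ennreal"

definition is_valuation :: "'a po \<Rightarrow> 'a val \<Rightarrow> bool" where
  "is_valuation P \<mu> \<longleftrightarrow>
     (\<forall>U. \<not> scott_open P U \<longrightarrow> \<mu> U = 0)
     \<and> \<mu> {} = 0
     \<and> (\<forall>U V. scott_open P U \<and> scott_open P V \<and> U \<subseteq> V \<longrightarrow> \<mu> U \<le> \<mu> V)
     \<and> (\<forall>U V. scott_open P U \<and> scott_open P V \<longrightarrow> \<mu> U + \<mu> V = \<mu> (U \<union> V) + \<mu> (U \<inter> V))
     \<and> (\<forall>\<D>. \<D> \<noteq> {} \<and> (\<forall>U\<in>\<D>. scott_open P U) \<and> (\<forall>U\<in>\<D>. \<forall>V\<in>\<D>. \<exists>W\<in>\<D>. U \<union> V \<subseteq> W)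
          \<longrightarrow> \<mu> (\<Union>\<D>) = (SUP U\<in>\<D>. \<mu> U))"

definition Vpo :: "'a po \<Rightarrow> 'a val po" where
  "Vpo P = ({\<mu>. is_valuation P \<mu>}, \<lambda>\<mu> \<nu>. \<forall>U. scott_open P U \<longrightarrow> \<mu> U \<le> \<nu> U)"

definition dirac :: "'a po \<Rightarrow> 'a \<Rightarrow> 'a val" where
  "dirac P x = (\<lambda>U. if scott_open P U \<and> x \<in> U then 1 else 0)"

definition vscale :: "real \<Rightarrow> 'a val \<Rightarrow> 'a val" where
  "vscale t \<mu> = (\<lambda>U. ennreal t * \<mu> U)"

definition vsum :: "'i set \<Rightarrow> ('i \<Rightarrow> 'a val) \<Rightarrow> 'a val" where
  "vsum I f = (\<lambda>U. \<Sum>i\<in>I. f i U)"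

definition conv_hull :: "'a val set \<Rightarrow> 'a val set" where
  "conv_hull A = {vsum I (\<lambda>i. vscale (t i) (m i)) | (I::nat set) t m.
      finite I \<and> I \<noteq> {} \<and> (\<forall>i\<in>I. t i \<ge> 0 \<and> m i \<in> A) \<and> (\<Sum>i\<in>I. t i) = 1}"

definition vconvex :: "'a val set \<Rightarrow> bool" where
  "vconvex A \<longleftrightarrow> (\<forall>\<mu>\<in>A. \<forall>\<nu>\<in>A. \<forall>t::real. 0 \<le> t \<and> t \<le> 1 \<longrightarrow>
       (\<lambda>U. vscale t \<mu> U + vscale (1 - t) \<nu> U) \<in> A)"

definition Vmap :: "'a po \<Rightarrow> 'b po \<Rightarrow> ('a \<Rightarrow> 'b) \<Rightarrow> 'a val \<Rightarrow> 'b val" where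
  "Vmap X Y f \<mu> = (\<lambda>U. if scott_open Y U then \<mu> {a\<in>car X. f a \<in> U} else 0)"

datatype pkind = PL | PU | PB

definition PV_car :: "pkind \<Rightarrow> 'a po \<Rightarrow> 'a val set set" where
  "PV_car x X = (case x of
      PL \<Rightarrow> {A. A \<noteq> {} \<and> scott_closed (Vpo X) A \<and> vconvex A}
    | PU \<Rightarrow> {A. A \<noteq> {} \<and> scott_compact (Vpo X) A \<and> saturated (Vpo X) A \<and> vconvex A}
    | PB \<Rightarrow> {A. A \<noteq> {} \<and> vconvex A \<and> lawson_compact (Vpo X) A \<and> order_convex (Vpo X) A})"

definition PV_le :: "pkind \<Rightarrow> 'a po \<Rightarrow> 'a val set \<Rightarrow> 'a val set \<Rightarrow> bool" where
  "PV_le x X A B = (case x of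
      PL \<Rightarrow> lower (Vpo X) A \<subseteq> lower (Vpo X) B
    | PU \<Rightarrow> upper (Vpo X) B \<subseteq> upper (Vpo X) A
    | PB \<Rightarrow> lower (Vpo X) A \<subseteq> lower (Vpo X) B \<and> upper (Vpo X) B \<subseteq> upper (Vpo X) A)"

definition PV :: "pkind \<Rightarrow> 'a po \<Rightarrow> 'a val set po" where
  "PV x X = (PV_car x X, PV_le x X)"

definition xgen :: "pkind \<Rightarrow> 'a po \<Rightarrow> 'a val set \<Rightarrow> 'a val set" where
  "xgen x X F = (case x of
      PL \<Rightarrow> scott_closure (Vpo X) (conv_hull F)
    | PU \<Rightarrow> upper (Vpo X) (conv_hull F)
    | PB \<Rightarrow> scott_closure (Vpo X) (conv_hull F) \<inter> upper (Vpo X) (conv_hull F))"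

definition PVmap :: "pkind \<Rightarrow> 'a po \<Rightarrow> 'b po \<Rightarrow> ('a \<Rightarrow> 'b) \<Rightarrow> 'a val set \<Rightarrow> 'b val set" where
  "PVmap x X Y f A = (case x of
      PL \<Rightarrow> scott_closure (Vpo Y) (Vmap X Y f ` A)
    | PU \<Rightarrow> upper (Vpo Y) (Vmap X Y f ` A)
    | PB \<Rightarrow> scott_closure (Vpo Y) (Vmap X Y f ` A) \<inter> upper (Vpo Y) (Vmap X Y f ` A))"

definition PVstr :: "pkind \<Rightarrow> 'a po \<Rightarrow> 'b po \<Rightarrow> 'a \<times> 'b val set \<Rightarrow> ('a \<times> 'b) val set" where
  "PVstr x X Y p = PVmap x Y (prod_po X Y) (\<lambda>y. (fst p, y)) (snd p)"

definition admissible :: "pkind \<Rightarrow> 'a po \<Rightarrow> bool" where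
  "admissible x P \<longleftrightarrow> domain P \<and> (x = PB \<longrightarrow> coherent P)"

end

theory Submission
  imports Defs
begin

text \<open>
  The strength is \<open>PVmap\<close> of the slice \<open>y \<mapsto> (a, y)\<close>, and \<open>PVmap\<close> is a closure operator after an image, so
  functoriality yields the values on basic elements, naturality and the strength axioms.

  Continuity for \<open>PL\<close> only uses that \<open>\<V>\<close> of the slice is Scott-continuous in \<open>a\<close> and in the valuation.
  For \<open>PU\<close> directed suprema are filtered intersections of compact saturated sets, which an open set
  eventually contains because \<open>\<V>(Y)\<close> is a continuous domain, hence well-filtered.
  For \<open>PB\<close> one also needs \<open>\<V>(Y)\<close> to be Lawson-compact, so that suprema of lenses are nonempty and a
  closed set intersected with a compact saturated one is Lawson-compact.

  Continuity of \<open>\<V>(X)\<close>: every weak neighbourhood of \<open>\<mu>\<close> contains a simple valuation \<open>\<sigma>\<close> such that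
  \<open>\<up>\<sigma>\<close> is itself a weak neighbourhood of \<open>\<mu>\<close>. The masses of \<open>\<sigma>\<close> are the increments of \<open>\<mu>\<close> along an
  increasing union of sets \<open>{z. x \<lless> z}\<close>, where points lying in more of the given open sets come first.
  Lawson-compactness of \<open>\<V>(X)\<close>: modular monotone set functions form a compact space, and
  \<open>l \<mapsto> (U \<mapsto> sup of l over open V inside \<up>F, F finite, F \<subseteq> U)\<close> retracts it continuously onto \<open>\<V>(X)\<close>.
\<close>

section \<open>Scott topology\<close>


text \<open>Suprema in the powerdomains are never computed. Continuity starts from some least upper
  bound \<open>A\<close> of the second components of a directed family, and \<open>A\<close> is
  compared with one explicit member of the powerdomain: a Scott-closed hull for \<open>PL\<close>,
  the principal filter of one valuation for \<open>PU\<close>, a lens for \<open>PB\<close>. Much of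
  the work is to show that these sets really are members, and for \<open>PB\<close> that the lens is
  nonempty and cofinal with the family in both directions. The obstacle is that both coordinates of
  the family move at once: a valuation taken from \<open>snd p\<close> has to be paired with the
  point \<open>fst q\<close> of another index. Directedness resolves this by passing to an index
  above both. Coherence enters through \<open>meet_compact\<close>, its instance for two principal
  filters, because this form passes to products and lets finitely generated upper sets be
  intersected up to interpolation by a finite set. Valuations may take the value infinity, whereas
  increments need subtraction. Hence \<open>bounded_approx\<close> first replaces a valuation by a
  finite one below it, and only then are real numbers used.\<close>

lemma scott_openI:
  assumes "U \<subseteq> car P" and "\<And>x y. x \<in> U \<Longrightarrow> y \<in> car P \<Longrightarrow> leq P x y \<Longrightarrow> y \<in> U"
    and "\<And>D s. directed P D \<Longrightarrow> is_lub P D s \<Longrightarrow> s \<in> U \<Longrightarrow> \<exists>d\<in>D. d \<in> U"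
  shows "scott_open P U"
  unfolding scott_open_def upper_def using assms by blast

lemma scott_open_sub: "scott_open P U \<Longrightarrow> U \<subseteq> car P"
  by (simp add: scott_open_def)

lemma scott_open_up: "scott_open P U \<Longrightarrow> x \<in> U \<Longrightarrow> y \<in> car P \<Longrightarrow> leq P x y \<Longrightarrow> y \<in> U"
  unfolding scott_open_def upper_def by blast

lemma scott_open_dir:
  "scott_open P U \<Longrightarrow> directed P D \<Longrightarrow> is_lub P D s \<Longrightarrow> s \<in> U \<Longrightarrow> \<exists>d\<in>D. d \<in> U"
  unfolding scott_open_def by blast

lemma scott_open_empty [simp]: "scott_open P {}"
  by (rule scott_openI) auto

lemma scott_open_car [simp]: "scott_open P (car P)"
  by (rule scott_openI) (auto simp: directed_def)

lemma scott_open_Union: "(\<And>U. U \<in> \<U> \<Longrightarrow> scott_open P U) \<Longrightarrow> scott_open P (\<Union>\<U>)"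
  apply (rule scott_openI)
    apply (meson Sup_least scott_open_sub)
   apply (meson UnionE UnionI scott_open_up)
  by (meson UnionE UnionI scott_open_dir)

lemma scott_open_Un: "scott_open P U \<Longrightarrow> scott_open P V \<Longrightarrow> scott_open P (U \<union> V)"
  using scott_open_Union[of "{U, V}" P] by auto

lemma scott_open_Int:
  assumes "scott_open P U" "scott_open P V"
  shows "scott_open P (U \<inter> V)"
proof (rule scott_openI)
  show "U \<inter> V \<subseteq> car P" using assms scott_open_sub by blast
  show "y \<in> U \<inter> V" if "x \<in> U \<inter> V" "y \<in> car P" "leq P x y" for x y
    using that assms scott_open_up[of P] by blast
  show "\<exists>d\<in>D. d \<in> U \<inter> V" if D: "directed P D" "is_lub P D s" "s \<in> U \<inter> V" for D s
  proof -
    obtain d e where "d \<in> D" "d \<in> U" "e \<in> D" "e \<in> V"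
      using scott_open_dir[OF assms(1) D(1,2)] scott_open_dir[OF assms(2) D(1,2)] D(3) by blast
    moreover then obtain c where "c \<in> D" "leq P d c" "leq P e c" "c \<in> car P"
      using D(1) unfolding directed_def by blast
    ultimately show ?thesis using assms scott_open_up[of P] by blast
  qed
qed

lemma scott_open_local:
  assumes "\<And>x. x \<in> U \<Longrightarrow> \<exists>V. scott_open P V \<and> x \<in> V \<and> V \<subseteq> U"
  shows "scott_open P U"
proof -
  have "U = \<Union>{V. scott_open P V \<and> V \<subseteq> U}" using assms by blast
  moreover have "scott_open P (\<Union>{V. scott_open P V \<and> V \<subseteq> U})"
    by (rule scott_open_Union) auto
  ultimately show ?thesis by simp
qed

lemma scott_closedI:
  assumes "C \<subseteq> car P" and "\<And>x y. x \<in> C \<Longrightarrow> y \<in> car P \<Longrightarrow> leq P y x \<Longrightarrow> y \<in> C"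
    and "\<And>D s. directed P D \<Longrightarrow> is_lub P D s \<Longrightarrow> D \<subseteq> C \<Longrightarrow> s \<in> C"
  shows "scott_closed P C"
  unfolding scott_closed_def
proof (intro conjI scott_openI)
  show "\<exists>d\<in>D. d \<in> car P - C" if "directed P D" "is_lub P D s" "s \<in> car P - C" for D s
  proof (rule ccontr)
    assume "\<not> ?thesis"
    then have "D \<subseteq> C" using that(1) unfolding directed_def by blast
    with assms(3)[OF that(1,2)] that(3) show False by blast
  qed
qed (use assms in auto)

lemma scott_closed_sub: "scott_closed P C \<Longrightarrow> C \<subseteq> car P"
  by (simp add: scott_closed_def)

lemma scott_closed_down: "scott_closed P C \<Longrightarrow> x \<in> C \<Longrightarrow> y \<in> car P \<Longrightarrow> leq P y x \<Longrightarrow> y \<in> C"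
  unfolding scott_closed_def
  using scott_open_up by fastforce

lemma scott_closed_dir:
  "scott_closed P C \<Longrightarrow> directed P D \<Longrightarrow> is_lub P D s \<Longrightarrow> D \<subseteq> C \<Longrightarrow> s \<in> C"
  unfolding scott_closed_def
  using scott_open_dir[of P "car P - C" D s] by (auto simp: is_lub_def)

lemma scott_closed_Inter:
  "\<C> \<noteq> {} \<Longrightarrow> (\<And>C. C \<in> \<C> \<Longrightarrow> scott_closed P C) \<Longrightarrow> scott_closed P (\<Inter>\<C>)"
  unfolding scott_closed_def
  by (auto simp: Diff_Inter intro!: scott_open_Union)

lemma scott_closed_car [simp]: "scott_closed P (car P)"
  by (simp add: scott_closed_def)

lemma scott_closed_scott_closure: "A \<subseteq> car P \<Longrightarrow> scott_closed P (scott_closure P A)"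
  unfolding scott_closure_def by (rule scott_closed_Inter) (use scott_closed_car in blast)+

lemma scott_closure_extensive: "A \<subseteq> scott_closure P A"
  unfolding scott_closure_def by auto

lemma scott_closure_least: "scott_closed P C \<Longrightarrow> A \<subseteq> C \<Longrightarrow> scott_closure P A \<subseteq> C"
  unfolding scott_closure_def by auto

lemma scott_closure_closed: "scott_closed P C \<Longrightarrow> scott_closure P C = C"
  by (simp add: antisym scott_closure_extensive scott_closure_least)

lemma scott_closure_eq:
  assumes "A \<subseteq> L" "L \<subseteq> scott_closure P A" "A \<subseteq> car P"
  shows "scott_closure P L = scott_closure P A"
proof (rule antisym)
  show "scott_closure P L \<subseteq> scott_closure P A"
    by (rule scott_closure_least[OF scott_closed_scott_closure[OF assms(3)] assms(2)])
  show "scott_closure P A \<subseteq> scott_closure P L"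
    using assms(1) unfolding scott_closure_def by blast
qed

section \<open>Lower and upper sets in posets\<close>

lemma poset_refl: "poset P \<Longrightarrow> x \<in> car P \<Longrightarrow> leq P x x"
  by (simp add: poset_def)
lemma poset_antisym:
  "poset P \<Longrightarrow> x \<in> car P \<Longrightarrow> y \<in> car P \<Longrightarrow> leq P x y \<Longrightarrow> leq P y x \<Longrightarrow> x = y"
  unfolding poset_def by blast
lemma poset_trans:
  "poset P \<Longrightarrow> leq P x y \<Longrightarrow> leq P y z \<Longrightarrow> x \<in> car P \<Longrightarrow> y \<in> car P \<Longrightarrow> z \<in> car P \<Longrightarrow> leq P x z"
  unfolding poset_def by blast

lemma dcpo_poset: "dcpo P \<Longrightarrow> poset P"
  by (simp add: dcpo_def)
lemma domain_dcpo: "domain P \<Longrightarrow> dcpo P"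
  by (simp add: domain_def)
lemma domain_poset: "domain P \<Longrightarrow> poset P"
  by (simp add: domain_def dcpo_def)

lemma scott_closed_lower_singleton:
  assumes "poset P" "m \<in> car P"
  shows "scott_closed P (lower P {m})"
proof (rule scott_closedI)
  show "y \<in> lower P {m}" if "x \<in> lower P {m}" "y \<in> car P" "leq P y x" for x y
    using that assms poset_trans[of P y x m] by (auto simp: lower_def)
qed (auto simp: lower_def is_lub_def assms)

lemma lower_subset_closed: "scott_closed P C \<Longrightarrow> A \<subseteq> C \<Longrightarrow> lower P A \<subseteq> C"
  by (auto simp: lower_def dest: scott_closed_down)

lemma lower_extensive: "poset P \<Longrightarrow> A \<subseteq> car P \<Longrightarrow> A \<subseteq> lower P A"
  unfolding lower_def using poset_refl by fastforce
lemma upper_extensive: "poset P \<Longrightarrow> A \<subseteq> car P \<Longrightarrow> A \<subseteq> upper P A"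
  unfolding upper_def using poset_refl by fastforce

lemma lower_closed: "poset P \<Longrightarrow> scott_closed P C \<Longrightarrow> lower P C = C"
  by (simp add: antisym lower_extensive lower_subset_closed scott_closed_sub)

lemma upper_sub: "upper P A \<subseteq> car P" by (auto simp: upper_def)
lemma lower_sub: "lower P A \<subseteq> car P" by (auto simp: lower_def)

lemma upper_mono: "A \<subseteq> B \<Longrightarrow> upper P A \<subseteq> upper P B" by (auto simp: upper_def)
lemma lower_mono: "A \<subseteq> B \<Longrightarrow> lower P A \<subseteq> lower P B" by (auto simp: lower_def)

lemma upper_upper:
  assumes P: "poset P" "A \<subseteq> car P"
  shows "upper P (upper P A) = upper P A"
proof (rule antisym)
  show "upper P (upper P A) \<subseteq> upper P A"
  proof
    fix z assume "z \<in> upper P (upper P A)"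
    then obtain x y where "x \<in> A" "y \<in> car P" "leq P x y" "leq P y z" "z \<in> car P"
      by (auto simp: upper_def)
    with P poset_trans[OF P(1), of x y z] show "z \<in> upper P A" by (auto simp: upper_def)
  qed
  show "upper P A \<subseteq> upper P (upper P A)"
    by (rule upper_extensive[OF P(1) upper_sub])
qed

lemma lower_lower:
  assumes P: "poset P" "A \<subseteq> car P"
  shows "lower P (lower P A) = lower P A"
proof (rule antisym)
  show "lower P (lower P A) \<subseteq> lower P A"
  proof
    fix z assume "z \<in> lower P (lower P A)"
    then obtain x y where "x \<in> A" "y \<in> car P" "leq P y x" "leq P z y" "z \<in> car P"
      by (auto simp: lower_def)
    with P poset_trans[OF P(1), of z y x] show "z \<in> lower P A" by (auto simp: lower_def)
  qed
  show "lower P A \<subseteq> lower P (lower P A)"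
    by (rule lower_extensive[OF P(1) lower_sub])
qed

lemma upper_subset_iff: "poset P \<Longrightarrow> A \<subseteq> car P \<Longrightarrow> B \<subseteq> car P \<Longrightarrow>
   upper P A \<subseteq> upper P B \<longleftrightarrow> A \<subseteq> upper P B"
  using upper_extensive[of P A] upper_mono[of A "upper P B" P] upper_upper[of P B] by blast

lemma lower_subset_iff: "poset P \<Longrightarrow> A \<subseteq> car P \<Longrightarrow> B \<subseteq> car P \<Longrightarrow>
   lower P A \<subseteq> lower P B \<longleftrightarrow> A \<subseteq> lower P B"
  using lower_extensive[of P A] lower_mono[of A "lower P B" P] lower_lower[of P B] by blast

lemma upper_eq: "poset P \<Longrightarrow> A \<subseteq> car P \<Longrightarrow> A \<subseteq> L \<Longrightarrow> L \<subseteq> upper P A \<Longrightarrow> upper P L = upper P A"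
  using upper_mono[of A L P] upper_mono[of L "upper P A" P] upper_upper[of P A] by blast

lemma saturated_upper: "poset P \<Longrightarrow> A \<subseteq> car P \<Longrightarrow> saturated P (upper P A)"
  by (simp add: saturated_def upper_sub upper_upper)

section \<open>Scott compactness\<close>

lemma istopology_scott_open: "istopology (scott_open P)"
  unfolding istopology_def by (metis scott_open_Int scott_open_Union)

text \<open>Makes the Scott-open sets a \<open>topology\<close>, so that the facts about
  \<open>compactin\<close>, continuous images and product topologies apply.\<close>

definition scott_top :: "'a po \<Rightarrow> 'a topology" where "scott_top P = topology (scott_open P)"

lemma openin_scott_top [simp]: "openin (scott_top P) U \<longleftrightarrow> scott_open P U"
  by (simp add: scott_top_def istopology_scott_open topology_inverse')

lemma topspace_scott_top [simp]: "topspace (scott_top P) = car P"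
proof -
  have "topspace (scott_top P) \<subseteq> car P"
    unfolding topspace_def using scott_open_sub[of P] by fastforce
  moreover have "car P \<subseteq> topspace (scott_top P)"
    by (simp add: openin_subset)
  ultimately show ?thesis by blast
qed

lemma scott_compact_iff: "scott_compact P K \<longleftrightarrow> compactin (scott_top P) K"
  by (simp add: scott_compact_def compactin_def imp_conjL conj_left_commute)

lemma scott_compactD:
  assumes "scott_compact P K" "\<And>U. U \<in> \<U> \<Longrightarrow> scott_open P U" "K \<subseteq> \<Union>\<U>"
  shows "\<exists>\<V>\<subseteq>\<U>. finite \<V> \<and> K \<subseteq> \<Union>\<V>"
  using assms unfolding scott_compact_def by simp

lemma finite_subset_directed_Union:
  assumes "finite \<V>" "\<V> \<subseteq> \<U>" "\<U> \<noteq> {}"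
    and "\<And>U V. U \<in> \<U> \<Longrightarrow> V \<in> \<U> \<Longrightarrow> \<exists>W\<in>\<U>. U \<union> V \<subseteq> W"
  shows "\<exists>W\<in>\<U>. \<Union>\<V> \<subseteq> W"
  using assms(1,2)
proof (induction)
  case empty
  then show ?case using assms(3) by auto
next
  case (insert V \<V>)
  then obtain W where W: "W \<in> \<U>" "\<Union>\<V> \<subseteq> W" by auto
  then obtain W' where W': "W' \<in> \<U>" "V \<union> W \<subseteq> W'" using assms(4)[of V W] insert.prems by blast
  then have "\<Union>(insert V \<V>) \<subseteq> W'" using W(2) by blast
  with W' show ?case by blast
qed

lemma scott_compact_directed:
  assumes "scott_compact P K" "\<U> \<noteq> {}" "\<And>U. U \<in> \<U> \<Longrightarrow> scott_open P U" "K \<subseteq> \<Union>\<U>"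
    and "\<And>U V. U \<in> \<U> \<Longrightarrow> V \<in> \<U> \<Longrightarrow> \<exists>W\<in>\<U>. U \<union> V \<subseteq> W"
  shows "\<exists>U\<in>\<U>. K \<subseteq> U"
proof -
  obtain \<V> where \<V>: "\<V> \<subseteq> \<U>" "finite \<V>" "K \<subseteq> \<Union>\<V>"
    using scott_compactD[OF assms(1,3,4)] by blast
  have "\<exists>W\<in>\<U>. \<Union>\<V> \<subseteq> W"
    by (rule finite_subset_directed_Union[OF \<V>(2,1) assms(2,5)])
  then obtain W where "W \<in> \<U>" "\<Union>\<V> \<subseteq> W" ..
  with \<V>(3) show ?thesis by blast
qed

lemma scott_compact_upper:
  assumes "poset P" "scott_compact P A"
  shows "scott_compact P (upper P A)"
  unfolding scott_compact_def
proof (intro conjI allI impI)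
  fix \<U> assume U: "\<forall>U\<in>\<U>. scott_open P U" "upper P A \<subseteq> \<Union>\<U>"
  have A: "A \<subseteq> car P" using assms(2) by (simp add: scott_compact_def)
  then have "A \<subseteq> \<Union>\<U>" using upper_extensive[OF assms(1)] U by blast
  with scott_compactD[OF assms(2), of \<U>] U
  obtain \<V> where V: "\<V> \<subseteq> \<U>" "finite \<V>" "A \<subseteq> \<Union>\<V>" by auto
  then have "scott_open P (\<Union>\<V>)" using U by (blast intro: scott_open_Union)
  then have "upper P A \<subseteq> \<Union>\<V>" using V(3) by (auto simp: upper_def dest: scott_open_up)
  with V show "\<exists>\<V>\<subseteq>\<U>. finite \<V> \<and> upper P A \<subseteq> \<Union>\<V>" by auto
qed (rule upper_sub)

lemma scott_compact_singleton: "x \<in> car P \<Longrightarrow> scott_compact P {x}"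
  by (simp add: scott_compact_iff)

section \<open>Scott-continuous maps and hulls\<close>

lemma scott_continuous_car: "scott_continuous P Q f \<Longrightarrow> x \<in> car P \<Longrightarrow> f x \<in> car Q"
  by (simp add: scott_continuous_def)
lemma scott_continuous_mono:
  "scott_continuous P Q f \<Longrightarrow> x \<in> car P \<Longrightarrow> y \<in> car P \<Longrightarrow> leq P x y \<Longrightarrow> leq Q (f x) (f y)"
  by (simp add: scott_continuous_def)
lemma scott_continuous_lub:
  "scott_continuous P Q f \<Longrightarrow> directed P D \<Longrightarrow> is_lub P D s \<Longrightarrow> is_lub Q (f ` D) (f s)"
  by (simp add: scott_continuous_def)

lemma directed_image:
  assumes "scott_continuous P Q f" "directed P D"
  shows "directed Q (f ` D)"
  unfolding directed_def
proof (intro conjI ballI)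
  have D: "D \<subseteq> car P" "D \<noteq> {}" using assms(2) by (auto simp: directed_def)
  then show "f ` D \<subseteq> car Q" "f ` D \<noteq> {}" using assms(1) scott_continuous_car[OF assms(1)] by auto
  fix u v assume "u \<in> f ` D" "v \<in> f ` D"
  then obtain x y where "x \<in> D" "y \<in> D" "u = f x" "v = f y" by auto
  moreover then obtain z where "z \<in> D" "leq P x z" "leq P y z"
    using assms(2) unfolding directed_def by blast
  ultimately show "\<exists>w\<in>f ` D. leq Q u w \<and> leq Q v w"
    using scott_continuous_mono[OF assms(1)] D by blast
qed

lemma scott_open_preimage:
  assumes f: "scott_continuous P Q f" and U: "scott_open Q U"
  shows "scott_open P {x \<in> car P. f x \<in> U}"
proof (rule scott_openI)
  show "y \<in> {x \<in> car P. f x \<in> U}" if "x \<in> {x \<in> car P. f x \<in> U}" "y \<in> car P" "leq P x y" for x y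
    using that scott_continuous_mono[OF f] scott_continuous_car[OF f] scott_open_up[OF U] by blast
  show "\<exists>d\<in>D. d \<in> {x \<in> car P. f x \<in> U}"
    if "directed P D" "is_lub P D s" "s \<in> {x \<in> car P. f x \<in> U}" for D s
    using scott_open_dir[OF U directed_image[OF f that(1)] scott_continuous_lub[OF f that(1,2)]]
      that by (auto simp: directed_def)
qed auto

lemma scott_closed_preimage:
  assumes f: "scott_continuous P Q f" and C: "scott_closed Q C"
  shows "scott_closed P {x \<in> car P. f x \<in> C}"
proof -
  have "car P - {x \<in> car P. f x \<in> C} = {x \<in> car P. f x \<in> car Q - C}"
    using scott_continuous_car[OF f] by auto
  then show ?thesis
    using scott_open_preimage[OF f, of "car Q - C"] C by (auto simp: scott_closed_def)
qed

lemma scott_compact_image: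
  assumes f: "scott_continuous P Q f" and K: "scott_compact P K"
  shows "scott_compact Q (f ` K)"
proof -
  have "continuous_map (scott_top P) (scott_top Q) f"
    unfolding continuous_map_def
    using scott_open_preimage[OF f] scott_continuous_car[OF f] by auto
  then show ?thesis using K image_compactin by (auto simp: scott_compact_iff)
qed

lemma scott_continuous_comp:
  assumes "scott_continuous P Q f" "scott_continuous Q R g"
  shows "scott_continuous P R (\<lambda>x. g (f x))"
  unfolding scott_continuous_def
proof (intro conjI allI ballI impI)
  fix D s assume D: "directed P D" "is_lub P D s"
  have "is_lub R (g ` (f ` D)) (g (f s))"
    by (rule scott_continuous_lub[OF assms(2) directed_image[OF assms(1) D(1)] scott_continuous_lub[OF assms(1) D]])
  then show "is_lub R ((\<lambda>x. g (f x)) ` D) (g (f s))" by (simp add: image_image)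
qed (use assms in \<open>auto simp: scott_continuous_def\<close>)

text \<open>The common shape of \<open>xgen\<close> and \<open>PVmap\<close>: the same hull in
  \<open>Vpo\<close>, applied to a convex hull or to an image. Values on basic elements and
  functoriality thereby reduce to the single fact \<open>xhull_image\<close>.\<close>

definition xhull :: "pkind \<Rightarrow> 'a po \<Rightarrow> 'a set \<Rightarrow> 'a set" where
  "xhull x P B = (case x of
      PL \<Rightarrow> scott_closure P B
    | PU \<Rightarrow> upper P B
    | PB \<Rightarrow> scott_closure P B \<inter> upper P B)"

lemma xhull_extensive: "poset P \<Longrightarrow> B \<subseteq> car P \<Longrightarrow> B \<subseteq> xhull x P B"
  using scott_closure_extensive[of B P] upper_extensive[of P B] by (cases x) (simp_all add: xhull_def)

lemma closure_image:
  assumes h: "scott_continuous P Q h" and "B \<subseteq> car P"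
  shows "h ` scott_closure P B \<subseteq> scott_closure Q (h ` B)"
proof -
  have "h ` B \<subseteq> car Q" using assms scott_continuous_car by fastforce
  then have "scott_closed P {x \<in> car P. h x \<in> scott_closure Q (h ` B)}"
    by (intro scott_closed_preimage[OF h] scott_closed_scott_closure)
  moreover have "B \<subseteq> {x \<in> car P. h x \<in> scott_closure Q (h ` B)}"
    using assms(2) scott_closure_extensive[of "h ` B" Q] by blast
  ultimately have "scott_closure P B \<subseteq> {x \<in> car P. h x \<in> scott_closure Q (h ` B)}"
    by (rule scott_closure_least)
  then show ?thesis by auto
qed

lemma upper_image:
  assumes h: "scott_continuous P Q h" and "B \<subseteq> car P"
  shows "h ` upper P B \<subseteq> upper Q (h ` B)"
proof
  fix z assume "z \<in> h ` upper P B"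
  then obtain x y where "x \<in> B" "y \<in> car P" "leq P x y" "z = h y" by (auto simp: upper_def)
  with assms(2) scott_continuous_mono[OF h, of x y] scott_continuous_car[OF h, of y]
  show "z \<in> upper Q (h ` B)" by (auto simp: upper_def)
qed

text \<open>Continuity maps a closure into the closure of the image and monotonicity does the same
  for upper sets, so hulling before mapping adds nothing to the hull taken afterwards. For
  \<open>PB\<close> the inner hull lies in both the closure and the upper set, hence each half of
  the outer hull is unchanged.\<close>

lemma xhull_image:
  assumes h: "scott_continuous P Q h" and B: "B \<subseteq> car P" and P: "poset P" and Q: "poset Q"
  shows "xhull x Q (h ` xhull x P B) = xhull x Q (h ` B)"
proof -
  have hB: "h ` B \<subseteq> car Q" using B scott_continuous_car[OF h] by fastforce
  have 1: "h ` B \<subseteq> h ` xhull x P B" using xhull_extensive[OF P B] by auto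
  have l: "scott_closure Q (h ` xhull x P B) = scott_closure Q (h ` B)" if "x \<noteq> PU"
  proof (rule scott_closure_eq[OF 1 _ hB])
    have "xhull x P B \<subseteq> scott_closure P B" using that by (cases x) (auto simp: xhull_def)
    then show "h ` xhull x P B \<subseteq> scott_closure Q (h ` B)" using closure_image[OF h B] by blast
  qed
  have u: "upper Q (h ` xhull x P B) = upper Q (h ` B)" if "x \<noteq> PL"
  proof (rule upper_eq[OF Q hB 1])
    have "xhull x P B \<subseteq> upper P B" using that by (cases x) (auto simp: xhull_def)
    then show "h ` xhull x P B \<subseteq> upper Q (h ` B)" using upper_image[OF h B] by blast
  qed
  show ?thesis 
    using l u by (cases x) (simp_all add: xhull_def[of _ Q])
qed

section \<open>Valuations and functoriality\<close>


lemma car_Vpo: "car (Vpo X) = {\<mu>. is_valuation X \<mu>}"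
  by (simp add: Vpo_def car_def)
lemma leq_Vpo: "leq (Vpo X) \<mu> \<nu> \<longleftrightarrow> (\<forall>U. scott_open X U \<longrightarrow> \<mu> U \<le> \<nu> U)"
  by (simp add: Vpo_def leq_def)

lemma val_nonopen: "is_valuation X \<mu> \<Longrightarrow> \<not> scott_open X U \<Longrightarrow> \<mu> U = 0"
  by (simp add: is_valuation_def)
lemma val_empty: "is_valuation X \<mu> \<Longrightarrow> \<mu> {} = 0"
  by (simp add: is_valuation_def)
lemma val_mono: "is_valuation X \<mu> \<Longrightarrow> scott_open X U \<Longrightarrow> scott_open X V \<Longrightarrow> U \<subseteq> V \<Longrightarrow> \<mu> U \<le> \<mu> V"
  unfolding is_valuation_def by blast
lemma val_mod: "is_valuation X \<mu> \<Longrightarrow> scott_open X U \<Longrightarrow> scott_open X V \<Longrightarrow>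
   \<mu> U + \<mu> V = \<mu> (U \<union> V) + \<mu> (U \<inter> V)"
  unfolding is_valuation_def by blast
lemma val_Union:
  assumes "is_valuation X \<mu>" "\<D> \<noteq> {}" "\<And>U. U \<in> \<D> \<Longrightarrow> scott_open X U"
    "\<And>U V. U \<in> \<D> \<Longrightarrow> V \<in> \<D> \<Longrightarrow> \<exists>W\<in>\<D>. U \<union> V \<subseteq> W"
  shows "\<mu> (\<Union>\<D>) = (SUP U\<in>\<D>. \<mu> U)"
proof -
  from assms(1) have "\<forall>\<D>. \<D> \<noteq> {} \<and> (\<forall>U\<in>\<D>. scott_open X U) \<and> (\<forall>U\<in>\<D>. \<forall>V\<in>\<D>. \<exists>W\<in>\<D>. U \<union> V \<subseteq> W)
          \<longrightarrow> \<mu> (\<Union>\<D>) = (SUP U\<in>\<D>. \<mu> U)"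
    unfolding is_valuation_def by (elim conjE)
  then show ?thesis using assms(2-) by simp
qed

lemma is_valuationI:
  assumes "\<And>U. \<not> scott_open P U \<Longrightarrow> \<mu> U = 0" and "\<mu> {} = 0"
    and "\<And>U V. scott_open P U \<Longrightarrow> scott_open P V \<Longrightarrow> U \<subseteq> V \<Longrightarrow> \<mu> U \<le> \<mu> V"
    and "\<And>U V. scott_open P U \<Longrightarrow> scott_open P V \<Longrightarrow> \<mu> U + \<mu> V = \<mu> (U \<union> V) + \<mu> (U \<inter> V)"
    and "\<And>\<D>. \<D> \<noteq> {} \<Longrightarrow> (\<And>U. U \<in> \<D> \<Longrightarrow> scott_open P U) \<Longrightarrow>
        (\<And>U V. U \<in> \<D> \<Longrightarrow> V \<in> \<D> \<Longrightarrow> \<exists>W\<in>\<D>. U \<union> V \<subseteq> W) \<Longrightarrow> \<mu> (\<Union>\<D>) \<le> (SUP U\<in>\<D>. \<mu> U)"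
  shows "is_valuation P \<mu>"
  unfolding is_valuation_def
proof (intro conjI allI impI)
  fix \<D> assume D: "\<D> \<noteq> {} \<and> (\<forall>U\<in>\<D>. scott_open P U) \<and> (\<forall>U\<in>\<D>. \<forall>V\<in>\<D>. \<exists>W\<in>\<D>. U \<union> V \<subseteq> W)"
  then have "scott_open P (\<Union>\<D>)" by (auto intro: scott_open_Union)
  then have "(SUP U\<in>\<D>. \<mu> U) \<le> \<mu> (\<Union>\<D>)" using D by (intro SUP_least assms(3)) auto
  moreover have "\<mu> (\<Union>\<D>) \<le> (SUP U\<in>\<D>. \<mu> U)" by (rule assms(5)) (use D in auto)
  ultimately show "\<mu> (\<Union>\<D>) = (SUP U\<in>\<D>. \<mu> U)" by simp
qed (use assms in auto)

lemma poset_Vpo: "poset (Vpo X)"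
  unfolding poset_def car_Vpo leq_Vpo
proof (intro conjI ballI impI)
  fix \<mu> \<nu> assume *: "\<mu> \<in> {\<mu>. is_valuation X \<mu>}" "\<nu> \<in> {\<mu>. is_valuation X \<mu>}"
    "(\<forall>U. scott_open X U \<longrightarrow> \<mu> U \<le> \<nu> U) \<and> (\<forall>U. scott_open X U \<longrightarrow> \<nu> U \<le> \<mu> U)"
  show "\<mu> = \<nu>"
  proof
    fix U show "\<mu> U = \<nu> U"
      by (cases "scott_open X U") (use * in \<open>auto simp: val_nonopen intro: antisym\<close>)
  qed
qed (auto intro: order_trans)

text \<open>Modularity survives because directedness lets suprema commute with addition in
  \<open>ennreal\<close>; continuity is an exchange of two suprema.\<close>

lemma is_valuation_SUP:
  assumes D: "directed (Vpo X) D"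
  shows "is_valuation X (\<lambda>U. SUP \<mu>\<in>D. \<mu> U)"
proof (rule is_valuationI)
  have v: "is_valuation X \<mu>" if "\<mu> \<in> D" for \<mu> using D that by (auto simp: directed_def car_Vpo)
  have ne: "D \<noteq> {}" using D by (auto simp: directed_def)
  show "(SUP \<mu>\<in>D. \<mu> U) = 0" if "\<not> scott_open X U" for U
    by (rule SUP_eq_const[OF ne]) (use v that val_nonopen in blast)
  show "(SUP \<mu>\<in>D. \<mu> {}) = 0" by (rule SUP_eq_const[OF ne]) (use v val_empty in blast)
  show "(SUP \<mu>\<in>D. \<mu> U) \<le> (SUP \<mu>\<in>D. \<mu> V)" if "scott_open X U" "scott_open X V" "U \<subseteq> V" for U V
    by (rule SUP_mono) (use that v val_mono in blast)
  show "(SUP \<mu>\<in>D. \<mu> U) + (SUP \<mu>\<in>D. \<mu> V) = (SUP \<mu>\<in>D. \<mu> (U \<union> V)) + (SUP \<mu>\<in>D. \<mu> (U \<inter> V))"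
    if o: "scott_open X U" "scott_open X V" for U V
  proof -
    have dir: "\<exists>k\<in>D. i A + j B \<le> k A + k B" if "i \<in> D" "j \<in> D" "scott_open X A" "scott_open X B" for i j A B
    proof -
      obtain k where "k \<in> D" "leq (Vpo X) i k" "leq (Vpo X) j k" 
        using D \<open>i \<in> D\<close> \<open>j \<in> D\<close> unfolding directed_def by blast
      then show ?thesis using that by (auto simp: leq_Vpo intro!: bexI[of _ k] add_mono)
    qed
    have "(SUP \<mu>\<in>D. \<mu> U) + (SUP \<mu>\<in>D. \<mu> V) = (SUP \<mu>\<in>D. \<mu> U + \<mu> V)"
      by (rule SUP_add_directed_ennreal[symmetric]) (rule dir, auto simp: o)
    also have "\<dots> = (SUP \<mu>\<in>D. \<mu> (U \<union> V) + \<mu> (U \<inter> V))"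
      using val_mod[OF v o] by (simp cong: SUP_cong)
    also have "\<dots> = (SUP \<mu>\<in>D. \<mu> (U \<union> V)) + (SUP \<mu>\<in>D. \<mu> (U \<inter> V))"
      by (rule SUP_add_directed_ennreal) (rule dir, auto simp: o scott_open_Un scott_open_Int)
    finally show ?thesis .
  qed
  show "(SUP \<mu>\<in>D. \<mu> (\<Union>\<D>)) \<le> (SUP U\<in>\<D>. SUP \<mu>\<in>D. \<mu> U)"
    if "\<D> \<noteq> {}" "\<And>U. U \<in> \<D> \<Longrightarrow> scott_open X U" "\<And>U V. U \<in> \<D> \<Longrightarrow> V \<in> \<D> \<Longrightarrow> \<exists>W\<in>\<D>. U \<union> V \<subseteq> W" for \<D>
  proof (rule SUP_least)
    fix \<mu> assume m: "\<mu> \<in> D"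
    have "\<mu> (\<Union>\<D>) = (SUP U\<in>\<D>. \<mu> U)" by (rule val_Union[OF v[OF m] that])
    also have "\<dots> \<le> (SUP U\<in>\<D>. SUP \<mu>\<in>D. \<mu> U)" by (rule SUP_mono) (use m in \<open>auto intro: SUP_upper\<close>)
    finally show "\<mu> (\<Union>\<D>) \<le> (SUP U\<in>\<D>. SUP \<mu>\<in>D. \<mu> U)" .
  qed
qed

lemma is_lub_unique: "poset P \<Longrightarrow> is_lub P D s \<Longrightarrow> is_lub P D t \<Longrightarrow> s = t"
  using poset_antisym[of P s t] by (simp add: is_lub_def)

lemma is_lub_Vpo_SUP: "directed (Vpo X) D \<Longrightarrow> is_lub (Vpo X) D (\<lambda>U. SUP \<mu>\<in>D. \<mu> U)"
  unfolding is_lub_def by (auto simp: car_Vpo leq_Vpo is_valuation_SUP intro: SUP_upper SUP_least)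

lemma is_lub_Vpo_iff: "directed (Vpo X) D \<Longrightarrow> is_lub (Vpo X) D s \<longleftrightarrow> s = (\<lambda>U. SUP \<mu>\<in>D. \<mu> U)"
  using is_lub_Vpo_SUP[of X D] is_lub_unique[OF poset_Vpo] by blast

lemma dcpo_Vpo: "dcpo (Vpo X)"
  unfolding dcpo_def using poset_Vpo is_lub_Vpo_SUP by blast

lemma is_valuation_0: "is_valuation X (\<lambda>U. 0)"
  by (rule is_valuationI) auto

lemma is_valuation_add:
  assumes "is_valuation X \<mu>" "is_valuation X \<nu>"
  shows "is_valuation X (\<lambda>U. \<mu> U + \<nu> U)"
proof (rule is_valuationI)
  show "\<mu> U + \<nu> U \<le> \<mu> V + \<nu> V" if "scott_open X U" "scott_open X V" "U \<subseteq> V" for U V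
    using assms that by (intro add_mono val_mono) auto
  show "\<mu> U + \<nu> U + (\<mu> V + \<nu> V) = \<mu> (U \<union> V) + \<nu> (U \<union> V) + (\<mu> (U \<inter> V) + \<nu> (U \<inter> V))"
    if "scott_open X U" "scott_open X V" for U V
    using val_mod[OF assms(1) that] val_mod[OF assms(2) that] by (simp add: ac_simps)
  show "\<mu> (\<Union>\<D>) + \<nu> (\<Union>\<D>) \<le> (SUP U\<in>\<D>. \<mu> U + \<nu> U)"
    if D: "\<D> \<noteq> {}" "\<And>U. U \<in> \<D> \<Longrightarrow> scott_open X U" "\<And>U V. U \<in> \<D> \<Longrightarrow> V \<in> \<D> \<Longrightarrow> \<exists>W\<in>\<D>. U \<union> V \<subseteq> W" for \<D>
  proof -
    have "(SUP U\<in>\<D>. \<mu> U + \<nu> U) = (SUP U\<in>\<D>. \<mu> U) + (SUP U\<in>\<D>. \<nu> U)"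
    proof (rule SUP_add_directed_ennreal)
      fix U V assume UV: "U \<in> \<D>" "V \<in> \<D>"
      then obtain W where W: "W \<in> \<D>" "U \<union> V \<subseteq> W" using D(3) by blast
      then show "\<exists>W\<in>\<D>. \<mu> U + \<nu> V \<le> \<mu> W + \<nu> W"
        using assms UV D(2) by (intro bexI[of _ W] add_mono val_mono[of X]) auto
    qed
    then show ?thesis using val_Union[OF assms(1) D] val_Union[OF assms(2) D] by simp
  qed
qed (use assms in \<open>auto simp: val_nonopen val_empty\<close>)

lemma is_valuation_scale:
  assumes "is_valuation X \<mu>"
  shows "is_valuation X (\<lambda>U. c * \<mu> U)"
proof (rule is_valuationI)
  show "c * \<mu> U + c * \<mu> V = c * \<mu> (U \<union> V) + c * \<mu> (U \<inter> V)" if "scott_open X U" "scott_open X V" for U V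
    using val_mod[OF assms that] by (simp flip: distrib_left)
  show "c * \<mu> (\<Union>\<D>) \<le> (SUP U\<in>\<D>. c * \<mu> U)"
    if D: "\<D> \<noteq> {}" "\<And>U. U \<in> \<D> \<Longrightarrow> scott_open X U" "\<And>U V. U \<in> \<D> \<Longrightarrow> V \<in> \<D> \<Longrightarrow> \<exists>W\<in>\<D>. U \<union> V \<subseteq> W" for \<D>
    using val_Union[OF assms D] by (simp add: SUP_mult_left_ennreal)
qed (use assms in \<open>auto simp: val_nonopen val_empty intro!: mult_left_mono val_mono\<close>)

lemma is_valuation_sum:
  "(\<And>i. i \<in> I \<Longrightarrow> is_valuation X (f i)) \<Longrightarrow> is_valuation X (\<lambda>U. \<Sum>i\<in>I. f i U)"
  by (induction I rule: infinite_finite_induct) (auto intro: is_valuation_0 is_valuation_add)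

lemma is_valuation_dirac: "is_valuation X (dirac X x)"
proof (rule is_valuationI)
  show "dirac X x (\<Union>\<D>) \<le> (SUP U\<in>\<D>. dirac X x U)"
    if D: "\<D> \<noteq> {}" "\<And>U. U \<in> \<D> \<Longrightarrow> scott_open X U" for \<D>
  proof (cases "x \<in> \<Union>\<D>")
    case True
    then obtain U where "U \<in> \<D>" "x \<in> U" by auto
    then have "dirac X x U = 1" using D by (simp add: dirac_def)
    then show ?thesis using SUP_upper[OF \<open>U \<in> \<D>\<close>, of "dirac X x"] by (simp add: dirac_def)
  qed (simp add: dirac_def)
qed (auto simp: dirac_def scott_open_Un scott_open_Int)

lemma is_valuation_vscale: "is_valuation X \<mu> \<Longrightarrow> is_valuation X (vscale t \<mu>)"
  unfolding vscale_def by (rule is_valuation_scale)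
lemma is_valuation_vsum: "(\<And>i. i \<in> I \<Longrightarrow> is_valuation X (f i)) \<Longrightarrow> is_valuation X (vsum I f)"
  unfolding vsum_def by (rule is_valuation_sum)

lemma is_valuation_Vmap:
  assumes f: "scott_continuous X Y f" and m: "is_valuation X \<mu>"
  shows "is_valuation Y (Vmap X Y f \<mu>)"
proof (rule is_valuationI)
  note pre = scott_open_preimage[OF f]
  show "Vmap X Y f \<mu> U \<le> Vmap X Y f \<mu> V" if "scott_open Y U" "scott_open Y V" "U \<subseteq> V" for U V
    using that by (auto simp: Vmap_def intro!: val_mono[OF m] pre)
  show "Vmap X Y f \<mu> U + Vmap X Y f \<mu> V = Vmap X Y f \<mu> (U \<union> V) + Vmap X Y f \<mu> (U \<inter> V)"
    if o: "scott_open Y U" "scott_open Y V" for U V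
  proof -
    have "{a \<in> car X. f a \<in> U \<union> V} = {a \<in> car X. f a \<in> U} \<union> {a \<in> car X. f a \<in> V}"
      "{a \<in> car X. f a \<in> U \<inter> V} = {a \<in> car X. f a \<in> U} \<inter> {a \<in> car X. f a \<in> V}" by auto
    then show ?thesis using val_mod[OF m pre pre] o by (simp add: Vmap_def scott_open_Un scott_open_Int)
  qed
  show "Vmap X Y f \<mu> (\<Union>\<D>) \<le> (SUP U\<in>\<D>. Vmap X Y f \<mu> U)"
    if D: "\<D> \<noteq> {}" "\<And>U. U \<in> \<D> \<Longrightarrow> scott_open Y U" "\<And>U V. U \<in> \<D> \<Longrightarrow> V \<in> \<D> \<Longrightarrow> \<exists>W\<in>\<D>. U \<union> V \<subseteq> W" for \<D>
  proof -
    let ?E = "(\<lambda>U. {a \<in> car X. f a \<in> U}) ` \<D>"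
    have "{a \<in> car X. f a \<in> \<Union>\<D>} = \<Union>?E" by auto
    then have "Vmap X Y f \<mu> (\<Union>\<D>) = \<mu> (\<Union>?E)"
      using scott_open_Union[of \<D> Y] D(2) by (simp add: Vmap_def)
    also have "\<dots> = (SUP U\<in>?E. \<mu> U)"
    proof (rule val_Union[OF m])
      fix U V assume "U \<in> ?E" "V \<in> ?E"
      then obtain U' V' where U': "U' \<in> \<D>" "V' \<in> \<D>" and eq: "U = {a \<in> car X. f a \<in> U'}" "V = {a \<in> car X. f a \<in> V'}"
        by auto
      obtain W where "W \<in> \<D>" "U' \<union> V' \<subseteq> W" using D(3)[OF U'] by blast
      then show "\<exists>W\<in>?E. U \<union> V \<subseteq> W"
        by (intro bexI[of _ "{a \<in> car X. f a \<in> W}"]) (auto simp: eq)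
    qed (use D pre in auto)
    also have "\<dots> = (SUP U\<in>\<D>. Vmap X Y f \<mu> U)" using D(2) by (auto simp: Vmap_def image_image intro!: SUP_cong)
    finally show ?thesis by simp
  qed
qed (auto simp: Vmap_def val_empty[OF m])

lemma Vmap_mono: 
  assumes "scott_continuous X Y f" "leq (Vpo X) \<mu> \<nu>" shows "leq (Vpo Y) (Vmap X Y f \<mu>) (Vmap X Y f \<nu>)"
  using assms scott_open_preimage[OF assms(1)] by (simp add: leq_Vpo Vmap_def)

lemma scott_continuous_Vmap:
  assumes f: "scott_continuous X Y f"
  shows "scott_continuous (Vpo X) (Vpo Y) (Vmap X Y f)"
proof -
  have c: "\<forall>\<mu>\<in>car (Vpo X). Vmap X Y f \<mu> \<in> car (Vpo Y)"
    using is_valuation_Vmap[OF f] by (simp add: car_Vpo)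
  have "is_lub (Vpo Y) (Vmap X Y f ` D) (Vmap X Y f s)"
    if D: "directed (Vpo X) D" and s: "is_lub (Vpo X) D s" for D s
  proof -
    have s': "s = (\<lambda>U. SUP \<mu>\<in>D. \<mu> U)" using s is_lub_Vpo_iff[OF D] by simp
    have "s \<in> car (Vpo X)" using s by (simp add: is_lub_def)
    moreover have "D \<noteq> {}" using D by (simp add: directed_def)
    ultimately show ?thesis
      using c Vmap_mono[OF f] s
      unfolding is_lub_def by (auto simp: leq_Vpo Vmap_def s' intro!: SUP_least intro: SUP_upper)
  qed
  then show ?thesis using c Vmap_mono[OF f] by (simp add: scott_continuous_def)
qed

lemma Vmap_comp:
  assumes f: "scott_continuous X Y f" and g: "scott_continuous Y Z g"
  shows "Vmap Y Z g (Vmap X Y f \<mu>) = Vmap X Z (\<lambda>x. g (f x)) \<mu>"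
proof
  fix U
  have "{a \<in> car X. f a \<in> {b \<in> car Y. g b \<in> U}} = {a \<in> car X. g (f a) \<in> U}"
    using scott_continuous_car[OF f] by auto
  then show "Vmap Y Z g (Vmap X Y f \<mu>) U = Vmap X Z (\<lambda>x. g (f x)) \<mu> U"
    using scott_open_preimage[OF g, of U] by (simp add: Vmap_def)
qed

lemma Vmap_id:
  assumes "is_valuation X \<mu>" "\<And>x. x \<in> car X \<Longrightarrow> f x = x" shows "Vmap X X f \<mu> = \<mu>"
proof
  fix U
  have "{a \<in> car X. f a \<in> U} = U" if "scott_open X U" using scott_open_sub[OF that] assms(2) by auto
  then show "Vmap X X f \<mu> U = \<mu> U" using val_nonopen[OF assms(1)] by (simp add: Vmap_def)
qed

lemma Vmap_vsum: "Vmap X Y f (vsum I m) = vsum I (\<lambda>i. Vmap X Y f (m i))"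
  by (simp add: Vmap_def vsum_def fun_eq_iff)
lemma Vmap_vscale: "Vmap X Y f (vscale t m) = vscale t (Vmap X Y f m)"
  by (simp add: Vmap_def vscale_def fun_eq_iff)
lemma Vmap_dirac: "scott_continuous X Y f \<Longrightarrow> y \<in> car X \<Longrightarrow> Vmap X Y f (dirac X y) = dirac Y (f y)"
  using scott_open_preimage[of X Y f] by (simp add: Vmap_def dirac_def fun_eq_iff)

lemma Vmap_conv_hull: "Vmap X Y f ` conv_hull F = conv_hull (Vmap X Y f ` F)"
proof (intro subset_antisym subsetI)
  fix n assume "n \<in> Vmap X Y f ` conv_hull F"
  then obtain I t m where "finite (I::nat set)" "I \<noteq> {}" "\<forall>i\<in>I. t i \<ge> 0 \<and> m i \<in> F" "(\<Sum>i\<in>I. t i) = 1"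
    and n: "n = Vmap X Y f (vsum I (\<lambda>i. vscale (t i) (m i)))" unfolding conv_hull_def by auto
  then show "n \<in> conv_hull (Vmap X Y f ` F)"
    unfolding conv_hull_def n Vmap_vsum Vmap_vscale
    by (intro CollectI exI[of _ I] exI[of _ t] exI[of _ "\<lambda>i. Vmap X Y f (m i)"]) auto
next
  fix n assume "n \<in> conv_hull (Vmap X Y f ` F)"
  then obtain I t m where I: "finite (I::nat set)" "I \<noteq> {}" "\<forall>i\<in>I. t i \<ge> 0 \<and> m i \<in> Vmap X Y f ` F" "(\<Sum>i\<in>I. t i) = 1"
    and n: "n = vsum I (\<lambda>i. vscale (t i) (m i))" unfolding conv_hull_def by auto
  from I(3) have "\<forall>i\<in>I. \<exists>k. k \<in> F \<and> m i = Vmap X Y f k" by auto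
  then obtain k where k: "\<And>i. i \<in> I \<Longrightarrow> k i \<in> F \<and> m i = Vmap X Y f (k i)" by metis
  have "n = Vmap X Y f (vsum I (\<lambda>i. vscale (t i) (k i)))"
    unfolding n Vmap_vsum Vmap_vscale using k by (auto simp: vsum_def vscale_def fun_eq_iff intro!: sum.cong)
  moreover have "vsum I (\<lambda>i. vscale (t i) (k i)) \<in> conv_hull F"
    unfolding conv_hull_def using I k
    by (intro CollectI exI[of _ I] exI[of _ t] exI[of _ k]) auto
  ultimately show "n \<in> Vmap X Y f ` conv_hull F" by blast
qed

lemma conv_hull_sub: "F \<subseteq> car (Vpo X) \<Longrightarrow> conv_hull F \<subseteq> car (Vpo X)"
  unfolding conv_hull_def car_Vpo by (auto intro!: is_valuation_vsum is_valuation_vscale)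

lemma PVmap_eq: "PVmap x X Y f A = xhull x (Vpo Y) (Vmap X Y f ` A)"
  by (cases x) (simp_all add: PVmap_def xhull_def)
lemma xgen_eq: "xgen x X F = xhull x (Vpo X) (conv_hull F)"
  by (cases x) (simp_all add: xgen_def xhull_def)

text \<open>This is \<open>xhull_image\<close> for \<open>Vmap Y Z g\<close>. The set
  \<open>A\<close> is arbitrary, so the naturality and associativity diagrams can be chased without
  checking that intermediate hulls belong to a powerdomain.\<close>

lemma PVmap_comp:
  assumes f: "scott_continuous X Y f" and g: "scott_continuous Y Z g" and A: "A \<subseteq> car (Vpo X)"
  shows "PVmap x Y Z g (PVmap x X Y f A) = PVmap x X Z (\<lambda>a. g (f a)) A"
proof -
  have "Vmap X Y f ` A \<subseteq> car (Vpo Y)" using A is_valuation_Vmap[OF f] by (auto simp: car_Vpo)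
  from xhull_image[OF scott_continuous_Vmap[OF g] this poset_Vpo poset_Vpo]
  show ?thesis by (simp add: PVmap_eq image_image Vmap_comp[OF f g])
qed

text \<open>\<open>Vmap\<close> is linear and so commutes with convex hulls; the inner hull is then
  absorbed by \<open>xhull_image\<close>.\<close>

lemma PVmap_xgen:
  assumes f: "scott_continuous X Y f" and F: "F \<subseteq> car (Vpo X)"
  shows "PVmap x X Y f (xgen x X F) = xgen x Y (Vmap X Y f ` F)"
  using xhull_image[OF scott_continuous_Vmap[OF f] conv_hull_sub[OF F] poset_Vpo poset_Vpo]
  by (simp add: PVmap_eq xgen_eq Vmap_conv_hull)

lemma PV_car_sub: "A \<in> PV_car x X \<Longrightarrow> A \<subseteq> car (Vpo X)"
  by (cases x) (auto simp: PV_car_def scott_closed_def scott_compact_def lawson_compact_def)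

section \<open>Products of posets and slices\<close>

lemma car_prod: "car (prod_po P Q) = car P \<times> car Q" by (simp add: prod_po_def car_def)
lemma leq_prod: "leq (prod_po P Q) p q \<longleftrightarrow> leq P (fst p) (fst q) \<and> leq Q (snd p) (snd q)"
  by (simp add: prod_po_def leq_def split: prod.splits)

lemma directed_prod:
  assumes D: "directed (prod_po P Q) D"
  shows "directed P (fst ` D)" "directed Q (snd ` D)"
proof -
  have sub: "D \<subseteq> car P \<times> car Q" "D \<noteq> {}" using D by (auto simp: directed_def car_prod)
  have *: "\<exists>z\<in>D. leq P (fst x) (fst z) \<and> leq P (fst y) (fst z) \<and> leq Q (snd x) (snd z) \<and> leq Q (snd y) (snd z)"
    if "x \<in> D" "y \<in> D" for x y
    using D that unfolding directed_def leq_prod by blast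
  then have "\<forall>x\<in>D. \<forall>y\<in>D. \<exists>z\<in>D. leq P (fst x) (fst z) \<and> leq P (fst y) (fst z)"
    "\<forall>x\<in>D. \<forall>y\<in>D. \<exists>z\<in>D. leq Q (snd x) (snd z) \<and> leq Q (snd y) (snd z)" by blast+
  then show "directed P (fst ` D)" "directed Q (snd ` D)"
    using sub unfolding directed_def by auto
qed

lemma is_lub_prod_iff:
  "is_lub (prod_po P Q) D s \<longleftrightarrow> is_lub P (fst ` D) (fst s) \<and> is_lub Q (snd ` D) (snd s)"
proof -
  obtain a b where s: "s = (a, b)" by (cases s)
  show ?thesis
  proof
    assume l: "is_lub (prod_po P Q) D s"
    then have c: "a \<in> car P" "b \<in> car Q" by (auto simp: is_lub_def car_prod s)
    have u: "\<And>d. d \<in> D \<Longrightarrow> leq P (fst d) a \<and> leq Q (snd d) b"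
      using l by (auto simp: is_lub_def leq_prod s)
    have least: "\<And>u v. u \<in> car P \<Longrightarrow> v \<in> car Q \<Longrightarrow> (\<forall>d\<in>D. leq P (fst d) u \<and> leq Q (snd d) v) \<Longrightarrow> leq P a u \<and> leq Q b v"
      using l by (auto simp: is_lub_def leq_prod s car_prod)
    show "is_lub P (fst ` D) (fst s) \<and> is_lub Q (snd ` D) (snd s)"
      using c u least[of _ b] least[of a] by (auto simp: is_lub_def s)
  qed (auto simp: is_lub_def car_prod leq_prod mem_Times_iff)
qed

lemma scott_continuous_Pair:
  assumes "scott_continuous R P f" "scott_continuous R Q g"
  shows "scott_continuous R (prod_po P Q) (\<lambda>r. (f r, g r))"
  using assms unfolding scott_continuous_def car_prod leq_prod is_lub_prod_iff
  by (simp add: image_image)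

lemma scott_continuous_fst: "scott_continuous (prod_po P Q) P fst"
  by (auto simp: scott_continuous_def car_prod leq_prod is_lub_prod_iff)
lemma scott_continuous_snd: "scott_continuous (prod_po P Q) Q snd"
  by (auto simp: scott_continuous_def car_prod leq_prod is_lub_prod_iff)
lemma scott_continuous_id: "scott_continuous P P (\<lambda>x. x)"
  by (auto simp: scott_continuous_def)
lemma scott_continuous_const: "poset Q \<Longrightarrow> a \<in> car Q \<Longrightarrow> scott_continuous P Q (\<lambda>x. a)"
  by (auto simp: scott_continuous_def poset_refl is_lub_def directed_def)

lemma scott_continuous_slice: "poset X \<Longrightarrow> a \<in> car X \<Longrightarrow> scott_continuous Y (prod_po X Y) (\<lambda>y. (a, y))"
  by (intro scott_continuous_Pair scott_continuous_const scott_continuous_id)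

section \<open>Algebraic laws of the strength\<close>

lemma PVstr_eq: "PVstr x X Y (a, A) = PVmap x Y (prod_po X Y) (\<lambda>y. (a, y)) A"
  by (simp add: PVstr_def)

lemma PVstr_basic:
  assumes X: "poset X" and a: "a \<in> car X" and y: "\<And>j i. j \<in> J \<Longrightarrow> i \<in> I j \<Longrightarrow> y j i \<in> car Y"
  shows "PVstr x X Y (a, xgen x Y ((\<lambda>j. vsum (I j) (\<lambda>i. vscale (c j i) (dirac Y (y j i)))) ` J))
       = xgen x (prod_po X Y) ((\<lambda>j. vsum (I j) (\<lambda>i. vscale (c j i) (dirac (prod_po X Y) (a, y j i)))) ` J)"
proof -
  note s = scott_continuous_slice[OF X a, of Y]
  let ?F = "(\<lambda>j. vsum (I j) (\<lambda>i. vscale (c j i) (dirac Y (y j i)))) ` J"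
  have F: "?F \<subseteq> car (Vpo Y)"
    by (auto simp: car_Vpo intro!: is_valuation_vsum is_valuation_vscale is_valuation_dirac)
  have "Vmap Y (prod_po X Y) (\<lambda>y. (a, y)) (vsum (I j) (\<lambda>i. vscale (c j i) (dirac Y (y j i))))
      = vsum (I j) (\<lambda>i. vscale (c j i) (dirac (prod_po X Y) (a, y j i)))" if "j \<in> J" for j
    unfolding Vmap_vsum Vmap_vscale using y[OF that] Vmap_dirac[OF s]
    by (simp add: vsum_def vscale_def fun_eq_iff)
  then have "Vmap Y (prod_po X Y) (\<lambda>y. (a, y)) ` ?F
     = (\<lambda>j. vsum (I j) (\<lambda>i. vscale (c j i) (dirac (prod_po X Y) (a, y j i)))) ` J"
    unfolding image_image by (rule image_cong[OF refl])
  then show ?thesis using PVmap_xgen[OF s F] by (simp add: PVstr_eq)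
qed

text \<open>By functoriality both sides are \<open>PVmap\<close> of the map sending \<open>y\<close>
  to \<open>(f a, g y)\<close>.\<close>

lemma PVstr_natural:
  assumes X: "poset X" and X': "poset X'" and f: "scott_continuous X X' f" and g: "scott_continuous Y Y' g"
    and a: "a \<in> car X" and A: "A \<subseteq> car (Vpo Y)"
  shows "PVmap x (prod_po X Y) (prod_po X' Y') (\<lambda>(p, q). (f p, g q)) (PVstr x X Y (a, A))
             = PVstr x X' Y' (f a, PVmap x Y Y' g A)"
proof -
  have "scott_continuous (prod_po X Y) (prod_po X' Y') (\<lambda>r. (f (fst r), g (snd r)))"
    by (intro scott_continuous_Pair scott_continuous_comp[OF scott_continuous_fst f]
        scott_continuous_comp[OF scott_continuous_snd g])
  then have fg: "scott_continuous (prod_po X Y) (prod_po X' Y') (\<lambda>(p, q). (f p, g q))"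
    by (simp add: case_prod_unfold)
  show ?thesis
    using PVmap_comp[OF scott_continuous_slice[OF X a] fg A]
      PVmap_comp[OF g scott_continuous_slice[OF X' scott_continuous_car[OF f a]] A]
    by (simp add: PVstr_eq)
qed

text \<open>By functoriality both sides are \<open>PVmap\<close> of the map sending \<open>r\<close>
  to \<open>(a, (b, r))\<close>.\<close>

lemma PVstr_assoc:
  assumes X: "poset X" and Y: "poset Y" and a: "a \<in> car X" and b: "b \<in> car Y" and A: "A \<subseteq> car (Vpo Z)"
  shows "PVmap x (prod_po (prod_po X Y) Z) (prod_po X (prod_po Y Z)) (\<lambda>((p, q), r). (p, (q, r)))
            (PVstr x (prod_po X Y) Z ((a, b), A))
          = PVstr x X (prod_po Y Z) (a, PVstr x Y Z (b, A))"
proof -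
  let ?P = "prod_po (prod_po X Y) Z"
  have "scott_continuous ?P (prod_po X (prod_po Y Z)) (\<lambda>r. (fst (fst r), (snd (fst r), snd r)))"
    by (intro scott_continuous_Pair scott_continuous_comp[OF scott_continuous_fst scott_continuous_fst]
        scott_continuous_comp[OF scott_continuous_fst scott_continuous_snd] scott_continuous_snd)
  then have h: "scott_continuous ?P (prod_po X (prod_po Y Z)) (\<lambda>((p, q), r). (p, (q, r)))"
    by (simp add: case_prod_unfold)
  have XY: "scott_continuous Z ?P (\<lambda>y. ((a, b), y))"
    by (intro scott_continuous_Pair scott_continuous_const scott_continuous_id X Y a b)
  show ?thesis
    using PVmap_comp[OF XY h A] PVmap_comp[OF scott_continuous_slice[OF Y b] scott_continuous_slice[OF X a] A]
    by (simp add: PVstr_eq)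
qed

text \<open>Projecting after the slice is the identity, so what remains is the hull of
  \<open>A\<close>. That \<open>A\<close> is its own hull is kept as the hypothesis
  \<open>h\<close>, because for \<open>PB\<close> this rests on the continuity of the poset of
  valuations.\<close>

lemma PVstr_unit:
  assumes Y: "poset Y" and A: "A \<in> PV_car x Y" and h: "xhull x (Vpo Y) A = A"
  shows "PVmap x (prod_po unit_po Y) Y snd (PVstr x unit_po Y ((), A)) = A"
proof -
  have u: "poset unit_po" "() \<in> car unit_po" by (auto simp: poset_def unit_po_def car_def leq_def)
  have Av: "A \<subseteq> car (Vpo Y)" using A by (rule PV_car_sub)
  then have "Vmap Y Y (\<lambda>y. y) m = m" if "m \<in> A" for m
    using that by (intro Vmap_id) (auto simp: car_Vpo)
  then have "Vmap Y Y (\<lambda>y. y) ` A = (\<lambda>m. m) ` A" by (rule image_cong[OF refl])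
  then have A_eq: "PVmap x Y Y (\<lambda>y. y) A = A" using h by (simp add: PVmap_eq)
  have c: "scott_continuous Y (prod_po unit_po Y) (\<lambda>y. ((), y))"
    by (rule scott_continuous_slice[OF u])
  have "PVmap x (prod_po unit_po Y) Y snd (PVmap x Y (prod_po unit_po Y) (\<lambda>y. ((), y)) A)
    = PVmap x Y Y (\<lambda>y. snd ((), y)) A"
    by (rule PVmap_comp[OF c scott_continuous_snd Av])
  then show ?thesis unfolding PVstr_eq snd_conv A_eq .
qed

section \<open>Convexity and the lower powerdomain\<close>


definition vmix :: "real \<Rightarrow> 'a val \<Rightarrow> 'a val \<Rightarrow> 'a val" where
  "vmix t \<mu> \<nu> = (\<lambda>U. vscale t \<mu> U + vscale (1 - t) \<nu> U)"

lemma vconvex_vmix: "vconvex A \<longleftrightarrow> (\<forall>\<mu>\<in>A. \<forall>\<nu>\<in>A. \<forall>t. 0 \<le> t \<and> t \<le> 1 \<longrightarrow> vmix t \<mu> \<nu> \<in> A)"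
  by (simp add: vconvex_def vmix_def)

lemma vmix_swap: "vmix t \<mu> \<nu> = vmix (1 - t) \<nu> \<mu>"
  by (simp add: vmix_def add.commute)

lemma vmix_car: "\<mu> \<in> car (Vpo X) \<Longrightarrow> \<nu> \<in> car (Vpo X) \<Longrightarrow> vmix t \<mu> \<nu> \<in> car (Vpo X)"
  by (simp add: car_Vpo vmix_def is_valuation_add is_valuation_vscale)

lemma vmix_mono: "leq (Vpo X) \<mu> \<mu>' \<Longrightarrow> leq (Vpo X) \<nu> \<nu>' \<Longrightarrow> leq (Vpo X) (vmix t \<mu> \<nu>) (vmix t \<mu>' \<nu>')"
  by (simp add: leq_Vpo vmix_def vscale_def add_mono mult_left_mono)

lemma vmix_Vmap: "vmix t (Vmap X Y f \<mu>) (Vmap X Y f \<nu>) = Vmap X Y f (vmix t \<mu> \<nu>)"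
  by (simp add: vmix_def vscale_def Vmap_def fun_eq_iff)

lemma scott_continuous_vmix:
  assumes "\<nu> \<in> car (Vpo X)"
  shows "scott_continuous (Vpo X) (Vpo X) (\<lambda>\<mu>. vmix t \<mu> \<nu>)"
  unfolding scott_continuous_def
proof (intro conjI ballI allI impI)
  fix D s assume D: "directed (Vpo X) D" and "is_lub (Vpo X) D s"
  then have s: "s = (\<lambda>U. SUP \<mu>\<in>D. \<mu> U)" and sc: "s \<in> car (Vpo X)"
    using is_lub_Vpo_iff by (blast, simp add: is_lub_def)
  have ne: "D \<noteq> {}" "D \<subseteq> car (Vpo X)" using D by (auto simp: directed_def)
  have "directed (Vpo X) ((\<lambda>\<mu>. vmix t \<mu> \<nu>) ` D)"
    unfolding directed_def
  proof (intro conjI ballI)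
    fix x y assume "x \<in> (\<lambda>\<mu>. vmix t \<mu> \<nu>) ` D" "y \<in> (\<lambda>\<mu>. vmix t \<mu> \<nu>) ` D"
    then obtain m n where mn: "m \<in> D" "n \<in> D" "x = vmix t m \<nu>" "y = vmix t n \<nu>" by auto
    then obtain k where k: "k \<in> D" "leq (Vpo X) m k" "leq (Vpo X) n k"
      using D unfolding directed_def by blast
    moreover have "leq (Vpo X) \<nu> \<nu>" by (rule poset_refl[OF poset_Vpo assms])
    ultimately show "\<exists>z\<in>(\<lambda>\<mu>. vmix t \<mu> \<nu>) ` D. leq (Vpo X) x z \<and> leq (Vpo X) y z"
      using mn vmix_mono by blast
  qed (use ne assms vmix_car[of _ X] in auto)
  moreover have "vmix t s \<nu> = (\<lambda>U. SUP \<mu>\<in>(\<lambda>\<mu>. vmix t \<mu> \<nu>) ` D. \<mu> U)"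
    by (simp add: vmix_def vscale_def s image_image ennreal_SUP_add_left[OF ne(1)] SUP_mult_left_ennreal)
  ultimately show "is_lub (Vpo X) ((\<lambda>\<mu>. vmix t \<mu> \<nu>) ` D) (vmix t s \<nu>)"
    by (simp add: is_lub_Vpo_iff)
qed (use assms poset_refl[OF poset_Vpo assms] in \<open>auto intro: vmix_car vmix_mono\<close>)

text \<open>Separate continuity of mixing is enough. With one argument fixed in \<open>A\<close>,
  the closure can be reached in the other; then a point of the closure is fixed and the argument is
  repeated with the roles exchanged.\<close>

lemma vconvex_scott_closure:
  assumes A: "A \<subseteq> car (Vpo X)" "vconvex A"
  shows "vconvex (scott_closure (Vpo X) A)"
proof -
  let ?C = "scott_closure (Vpo X) A"
  note C = scott_closed_scott_closure[OF A(1)]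
  have 1: "vmix t \<mu> \<nu> \<in> ?C" if "0 \<le> t" "t \<le> 1" "\<mu> \<in> ?C" "\<nu> \<in> A" for t \<mu> \<nu>
  proof -
    have "\<nu> \<in> car (Vpo X)" using A that by blast
    note c = scott_closed_preimage[OF scott_continuous_vmix[OF this, of t] C]
    have "A \<subseteq> {\<mu> \<in> car (Vpo X). vmix t \<mu> \<nu> \<in> ?C}"
      using A that scott_closure_extensive[of A "Vpo X"] unfolding vconvex_vmix by blast
    from scott_closure_least[OF c this] that show ?thesis by blast
  qed
  have "vmix t \<mu> \<nu> \<in> ?C" if t: "0 \<le> t" "t \<le> 1" and m: "\<mu> \<in> ?C" "\<nu> \<in> ?C" for t \<mu> \<nu>
  proof -
    have "\<mu> \<in> car (Vpo X)" using m scott_closed_sub[OF C] by blast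
    note c = scott_closed_preimage[OF scott_continuous_vmix[OF this, of "1 - t"] C]
    have "A \<subseteq> {\<nu> \<in> car (Vpo X). vmix (1 - t) \<nu> \<mu> \<in> ?C}"
      using A 1[OF t m(1)] vmix_swap[of t \<mu>] by auto
    from scott_closure_least[OF c this] m show ?thesis using vmix_swap[of t \<mu>] by auto
  qed
  then show ?thesis unfolding vconvex_vmix by blast
qed

lemma vconvex_upper:
  assumes A: "A \<subseteq> car (Vpo X)" "vconvex A"
  shows "vconvex (upper (Vpo X) A)"
  unfolding vconvex_vmix
proof (intro ballI allI impI)
  fix \<mu> \<nu> t assume *: "\<mu> \<in> upper (Vpo X) A" "\<nu> \<in> upper (Vpo X) A" "0 \<le> (t::real) \<and> t \<le> 1"
  then obtain m n where "m \<in> A" "n \<in> A" "leq (Vpo X) m \<mu>" "leq (Vpo X) n \<nu>" "\<mu> \<in> car (Vpo X)" "\<nu> \<in> car (Vpo X)"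
    by (auto simp: upper_def)
  moreover then have "vmix t m n \<in> A" using A(2) *(3) unfolding vconvex_vmix by blast
  ultimately show "vmix t \<mu> \<nu> \<in> upper (Vpo X) A"
    unfolding upper_def using vmix_mono vmix_car by blast
qed

lemma vconvex_lower:
  assumes A: "A \<subseteq> car (Vpo X)" "vconvex A"
  shows "vconvex (lower (Vpo X) A)"
  unfolding vconvex_vmix
proof (intro ballI allI impI)
  fix \<mu> \<nu> t assume *: "\<mu> \<in> lower (Vpo X) A" "\<nu> \<in> lower (Vpo X) A" "0 \<le> (t::real) \<and> t \<le> 1"
  then obtain m n where "m \<in> A" "n \<in> A" "leq (Vpo X) \<mu> m" "leq (Vpo X) \<nu> n" "\<mu> \<in> car (Vpo X)" "\<nu> \<in> car (Vpo X)"
    by (auto simp: lower_def)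
  moreover then have "vmix t m n \<in> A" using A(2) *(3) unfolding vconvex_vmix by blast
  ultimately show "vmix t \<mu> \<nu> \<in> lower (Vpo X) A"
    unfolding lower_def using vmix_mono vmix_car by blast
qed

lemma vconvex_Vmap: "vconvex A \<Longrightarrow> vconvex (Vmap X Y f ` A)"
  unfolding vconvex_vmix by (auto simp: vmix_Vmap)

lemma vconvex_Int: "vconvex A \<Longrightarrow> vconvex B \<Longrightarrow> vconvex (A \<inter> B)"
  unfolding vconvex_vmix by auto

lemma vconvex_INT: "(\<And>i. i \<in> I \<Longrightarrow> vconvex (A i)) \<Longrightarrow> vconvex (\<Inter>i\<in>I. A i)"
  unfolding vconvex_vmix by auto

lemma vconvex_directed_UN:
  assumes "\<And>i. i \<in> I \<Longrightarrow> vconvex (A i)" "\<And>i j. i \<in> I \<Longrightarrow> j \<in> I \<Longrightarrow> \<exists>k\<in>I. A i \<subseteq> A k \<and> A j \<subseteq> A k"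
  shows "vconvex (\<Union>i\<in>I. A i)"
  unfolding vconvex_vmix
proof (intro ballI allI impI)
  fix \<mu> \<nu> t assume *: "\<mu> \<in> (\<Union>i\<in>I. A i)" "\<nu> \<in> (\<Union>i\<in>I. A i)" "0 \<le> (t::real) \<and> t \<le> 1"
  then obtain i j where "i \<in> I" "j \<in> I" "\<mu> \<in> A i" "\<nu> \<in> A j" by blast
  moreover then obtain k where k: "k \<in> I" "A i \<subseteq> A k" "A j \<subseteq> A k" using assms(2) by blast
  ultimately have "vmix t \<mu> \<nu> \<in> A k" using assms(1)[OF k(1)] *(3) unfolding vconvex_vmix by blast
  then show "vmix t \<mu> \<nu> \<in> (\<Union>i\<in>I. A i)" using k by blast
qed

lemma vconvex_singleton: "vconvex {\<mu>}"
proof -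
  have "ennreal t * x + ennreal (1 - t) * x = x" if "0 \<le> t" "t \<le> 1" for t and x :: ennreal
    using that by (simp flip: distrib_right ennreal_plus)
  then show ?thesis unfolding vconvex_vmix by (simp add: vmix_def vscale_def)
qed

section \<open>Members of the powerdomains and the continuity of slices\<close>

lemma car_PV: "car (PV x X) = PV_car x X" by (simp add: PV_def car_def)
lemma leq_PV: "leq (PV x X) = PV_le x X" by (simp add: PV_def leq_def)

lemma Vmap_image_sub:
  "scott_continuous X Y f \<Longrightarrow> A \<subseteq> car (Vpo X) \<Longrightarrow> Vmap X Y f ` A \<subseteq> car (Vpo Y)"
  using is_valuation_Vmap[of X Y f] by (auto simp: car_Vpo)

lemma PV_car_vconvex: "A \<in> PV_car x X \<Longrightarrow> vconvex A"
  and PV_car_ne: "A \<in> PV_car x X \<Longrightarrow> A \<noteq> {}"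
  by (cases x; simp add: PV_car_def)+

lemma PVmap_convex:
  assumes f: "scott_continuous X Y f" and A: "A \<in> PV_car x X"
  shows "vconvex (PVmap x X Y f A)" "PVmap x X Y f A \<noteq> {}"
proof -
  note s = Vmap_image_sub[OF f PV_car_sub[OF A]] and c = vconvex_Vmap[OF PV_car_vconvex[OF A], of X Y f]
  show "vconvex (PVmap x X Y f A)"
    unfolding PVmap_eq using vconvex_scott_closure[OF s c] vconvex_upper[OF s c]
    by (cases x) (simp_all add: xhull_def vconvex_Int)
  show "PVmap x X Y f A \<noteq> {}"
    using xhull_extensive[OF poset_Vpo s, of x] PV_car_ne[OF A] unfolding PVmap_eq by blast
qed

lemma PVmap_car_PL:
  assumes f: "scott_continuous X Y f" and A: "A \<in> PV_car PL X"
  shows "PVmap PL X Y f A \<in> PV_car PL Y"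
  using PVmap_convex[OF f A] scott_closed_scott_closure[OF Vmap_image_sub[OF f PV_car_sub[OF A]]]
  by (simp add: PV_car_def[of PL Y] PVmap_eq xhull_def)

lemma PVmap_car_PU:
  assumes f: "scott_continuous X Y f" and A: "A \<in> PV_car PU X"
  shows "PVmap PU X Y f A \<in> PV_car PU Y"
proof -
  have "scott_compact (Vpo X) A" using A by (simp add: PV_car_def)
  from scott_compact_upper[OF poset_Vpo scott_compact_image[OF scott_continuous_Vmap[OF f] this]]
  show ?thesis
    using PVmap_convex[OF f A] saturated_upper[OF poset_Vpo Vmap_image_sub[OF f PV_car_sub[OF A]]]
    by (simp add: PV_car_def[of PU Y] PVmap_eq xhull_def)
qed

definition slice :: "'a po \<Rightarrow> 'b po \<Rightarrow> 'a \<Rightarrow> 'b val \<Rightarrow> ('a \<times> 'b) val" where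
  "slice X Y a = Vmap Y (prod_po X Y) (\<lambda>y. (a, y))"

lemma scott_continuous_slice_Vpo:
  "poset X \<Longrightarrow> a \<in> car X \<Longrightarrow> scott_continuous (Vpo Y) (Vpo (prod_po X Y)) (slice X Y a)"
  unfolding slice_def by (intro scott_continuous_Vmap scott_continuous_slice)

lemma PVstr_slice: "PVstr x X Y (a, A) = xhull x (Vpo (prod_po X Y)) (slice X Y a ` A)"
  by (simp add: PVstr_eq PVmap_eq slice_def)

text \<open>For an open \<open>U\<close> in the product, the section of \<open>U\<close> at the
  supremum \<open>s\<close> is the directed union of its sections at the members of
  \<open>D\<close>. Continuity of the valuation turns this union into a supremum.\<close>

lemma scott_continuous_slice_param:
  assumes X: "poset X" and Y: "poset Y" and m: "\<mu> \<in> car (Vpo Y)"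
  shows "scott_continuous X (Vpo (prod_po X Y)) (\<lambda>a. slice X Y a \<mu>)"
proof -
  let ?V = "Vpo (prod_po X Y)"
  have m': "is_valuation Y \<mu>" using m by (simp add: car_Vpo)
  have car: "slice X Y a \<mu> \<in> car ?V" if "a \<in> car X" for a
    using scott_continuous_car[OF scott_continuous_slice_Vpo[OF X that] m] .
  have op: "scott_open Y {y \<in> car Y. (a, y) \<in> U}" if "scott_open (prod_po X Y) U" "a \<in> car X" for U a
    using scott_open_preimage[OF scott_continuous_slice[OF X that(2)] that(1)] .
  have sub: "{y \<in> car Y. (a, y) \<in> U} \<subseteq> {y \<in> car Y. (b, y) \<in> U}"
    if U: "scott_open (prod_po X Y) U" and ab: "b \<in> car X" "leq X a b" for U a b
    using scott_open_up[OF U] ab poset_refl[OF Y] by (auto simp: car_prod leq_prod)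
  have mono: "leq ?V (slice X Y a \<mu>) (slice X Y b \<mu>)" if "a \<in> car X" "b \<in> car X" "leq X a b" for a b
    unfolding leq_Vpo slice_def Vmap_def using that by (auto intro!: val_mono[OF m'] op dest: subsetD[OF sub])
  have "is_lub ?V ((\<lambda>a. slice X Y a \<mu>) ` D) (slice X Y s \<mu>)" if D: "directed X D" and s: "is_lub X D s" for D s
  proof -
    have Dc: "D \<subseteq> car X" "D \<noteq> {}" "s \<in> car X" using D s by (auto simp: directed_def is_lub_def)
    have "slice X Y s \<mu> U = (SUP a\<in>D. slice X Y a \<mu> U)" if U: "scott_open (prod_po X Y) U" for U
    proof -
      let ?E = "(\<lambda>a. {y \<in> car Y. (a, y) \<in> U}) ` D"
      have "{y \<in> car Y. (s, y) \<in> U} = \<Union>?E"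
      proof (intro subset_antisym subsetI)
        fix y assume y: "y \<in> {y \<in> car Y. (s, y) \<in> U}"
        then have "scott_continuous X (prod_po X Y) (\<lambda>a. (a, y))"
          by (intro scott_continuous_Pair scott_continuous_id scott_continuous_const Y) auto
        from scott_open_dir[OF scott_open_preimage[OF this U] D s] y Dc
        show "y \<in> \<Union>?E" by auto
      next
        fix y assume "y \<in> \<Union>?E"
        then obtain a where "a \<in> D" "y \<in> car Y" "(a, y) \<in> U" by auto
        moreover then have "leq X a s" using s by (auto simp: is_lub_def)
        ultimately show "y \<in> {y \<in> car Y. (s, y) \<in> U}" using sub[OF U Dc(3)] by auto
      qed
      then have "slice X Y s \<mu> U = \<mu> (\<Union>?E)" using U by (simp add: slice_def Vmap_def)
      also have "\<dots> = (SUP V\<in>?E. \<mu> V)"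
      proof (rule val_Union[OF m'])
        fix A B assume "A \<in> ?E" "B \<in> ?E"
        then obtain a b where ab: "a \<in> D" "b \<in> D" "A = {y \<in> car Y. (a, y) \<in> U}" "B = {y \<in> car Y. (b, y) \<in> U}" by auto
        then obtain c where c: "c \<in> D" "leq X a c" "leq X b c" using D unfolding directed_def by blast
        then show "\<exists>W\<in>?E. A \<union> B \<subseteq> W"
          using sub[OF U _ c(2)] sub[OF U _ c(3)] ab Dc by (intro bexI[of _ "{y \<in> car Y. (c, y) \<in> U}"]) auto
      qed (use Dc op[OF U] in auto)
      also have "\<dots> = (SUP a\<in>D. slice X Y a \<mu> U)" using U by (simp add: slice_def Vmap_def image_image)
      finally show ?thesis .
    qed
    then show ?thesis using car Dc unfolding is_lub_def by (auto simp: leq_Vpo intro!: SUP_least SUP_upper)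
  qed
  then show ?thesis using car mono by (simp add: scott_continuous_def)
qed

lemma slice_mono:
  assumes X: "poset X" and Y: "poset Y" and "a \<in> car X" "b \<in> car X" "leq X a b"
    "\<mu> \<in> car (Vpo Y)" "\<nu> \<in> car (Vpo Y)" "leq (Vpo Y) \<mu> \<nu>"
  shows "leq (Vpo (prod_po X Y)) (slice X Y a \<mu>) (slice X Y b \<nu>)"
proof -
  have "leq (Vpo (prod_po X Y)) (slice X Y a \<mu>) (slice X Y b \<mu>)"
    by (rule scott_continuous_mono[OF scott_continuous_slice_param[OF X Y]]) (use assms in auto)
  moreover have "leq (Vpo (prod_po X Y)) (slice X Y b \<mu>) (slice X Y b \<nu>)"
    by (rule scott_continuous_mono[OF scott_continuous_slice_Vpo[OF X]]) (use assms in auto)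
  ultimately show ?thesis unfolding leq_Vpo by (meson order_trans)
qed

lemma slice_image_sub: "poset X \<Longrightarrow> a \<in> car X \<Longrightarrow> A \<subseteq> car (Vpo Y) \<Longrightarrow> slice X Y a ` A \<subseteq> car (Vpo (prod_po X Y))"
  unfolding slice_def by (intro Vmap_image_sub scott_continuous_slice)

text \<open>The lower half of continuity, shared by \<open>PL\<close> and \<open>PB\<close>. For
  \<open>\<mu>\<close> in \<open>snd p\<close> the slice at \<open>a\<close> is the supremum of the
  slices at \<open>fst q\<close>, with \<open>q\<close> independent of \<open>p\<close>. An index
  \<open>r\<close> above both contains a valuation above \<open>\<mu>\<close>, so the slice of
  \<open>\<mu>\<close> at \<open>fst q\<close> lies below a point of \<open>C\<close>. The closed
  set \<open>C\<close> then absorbs first the supremum and then the closure.\<close>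

lemma slice_closure_directed_subset:
  assumes X: "poset X" and Y: "poset Y"
    and D1: "D \<noteq> {}" "\<And>p. p \<in> D \<Longrightarrow> fst p \<in> car X \<and> snd p \<subseteq> car (Vpo Y)"
    and D2: "\<And>p q. p \<in> D \<Longrightarrow> q \<in> D \<Longrightarrow> \<exists>r\<in>D. leq X (fst p) (fst r) \<and> leq X (fst q) (fst r) \<and>
        snd p \<subseteq> lower (Vpo Y) (snd r) \<and> snd q \<subseteq> lower (Vpo Y) (snd r)"
    and a: "is_lub X (fst ` D) a" and C: "scott_closed (Vpo (prod_po X Y)) C"
    and DC: "\<And>p. p \<in> D \<Longrightarrow> slice X Y (fst p) ` snd p \<subseteq> C"
  shows "slice X Y a ` scott_closure (Vpo Y) (\<Union>(snd ` D)) \<subseteq> C"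
proof -
  have ac: "a \<in> car X" using a by (simp add: is_lub_def)
  note sa = scott_continuous_slice_Vpo[OF X ac]
  have dX: "directed X (fst ` D)"
    unfolding directed_def
  proof (intro conjI ballI)
    show "fst ` D \<subseteq> car X" "fst ` D \<noteq> {}" using D1 by auto
    fix x y assume "x \<in> fst ` D" "y \<in> fst ` D"
    then obtain p q where "p \<in> D" "q \<in> D" "x = fst p" "y = fst q" by blast
    moreover then obtain r where "r \<in> D" "leq X (fst p) (fst r)" "leq X (fst q) (fst r)" using D2 by blast
    ultimately show "\<exists>z\<in>fst ` D. leq X x z \<and> leq X y z" by blast
  qed
  have "slice X Y a \<mu> \<in> C" if p: "p \<in> D" and m: "\<mu> \<in> snd p" for p \<mu>
  proof -
    have mc: "\<mu> \<in> car (Vpo Y)" using D1 p m by blast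
    note sp = scott_continuous_slice_param[OF X Y mc]
    have "slice X Y (fst q) \<mu> \<in> C" if q: "q \<in> D" for q
    proof -
      obtain r where r: "r \<in> D" "leq X (fst q) (fst r)" "snd p \<subseteq> lower (Vpo Y) (snd r)"
        using D2[OF p q] by blast
      then obtain \<nu> where n: "\<nu> \<in> snd r" "leq (Vpo Y) \<mu> \<nu>" using m unfolding lower_def by blast
      then have 1: "slice X Y (fst r) \<nu> \<in> C" using DC[OF r(1)] by blast
      have c: "fst q \<in> car X" "fst r \<in> car X" "\<nu> \<in> car (Vpo Y)"
        using D1(2)[OF q] D1(2)[OF r(1)] n by auto
      show ?thesis
        by (rule scott_closed_down[OF C 1 scott_continuous_car[OF sp c(1)] slice_mono[OF X Y c(1,2) r(2) mc c(3) n(2)]])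
    qed
    then have "(\<lambda>a. slice X Y a \<mu>) ` fst ` D \<subseteq> C" by auto
    then show ?thesis
      by (rule scott_closed_dir[OF C directed_image[OF sp dX] scott_continuous_lub[OF sp dX a]])
  qed
  then have "\<Union>(snd ` D) \<subseteq> {\<mu> \<in> car (Vpo Y). slice X Y a \<mu> \<in> C}" using D1 by blast
  from scott_closure_least[OF scott_closed_preimage[OF sa C] this] show ?thesis by blast
qed

text \<open>Isolates what depends on the kind of powerdomain. In \<open>least\<close> the set
  \<open>A\<close> is an arbitrary least upper bound, so the only access to it is comparison with
  other upper bounds.\<close>

lemma PVstr_continuousI:
  assumes car: "\<And>a A. a \<in> car X \<Longrightarrow> A \<in> PV_car x Y \<Longrightarrow> PVstr x X Y (a, A) \<in> PV_car x (prod_po X Y)"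
    and mono: "\<And>a A b B. a \<in> car X \<Longrightarrow> A \<in> PV_car x Y \<Longrightarrow> b \<in> car X \<Longrightarrow> B \<in> PV_car x Y \<Longrightarrow>
        leq X a b \<Longrightarrow> leq (PV x Y) A B \<Longrightarrow>
        leq (PV x (prod_po X Y)) (PVstr x X Y (a, A)) (PVstr x X Y (b, B))"
    and least: "\<And>D a A u. D \<noteq> {} \<Longrightarrow>
        (\<And>p. p \<in> D \<Longrightarrow> fst p \<in> car X \<and> snd p \<in> PV_car x Y) \<Longrightarrow>
        (\<And>p q. p \<in> D \<Longrightarrow> q \<in> D \<Longrightarrow> \<exists>r\<in>D. leq X (fst p) (fst r) \<and> leq X (fst q) (fst r) \<and>
            leq (PV x Y) (snd p) (snd r) \<and> leq (PV x Y) (snd q) (snd r)) \<Longrightarrow>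
        is_lub X (fst ` D) a \<Longrightarrow> is_lub (PV x Y) (snd ` D) A \<Longrightarrow>
        u \<in> PV_car x (prod_po X Y) \<Longrightarrow>
        (\<And>p. p \<in> D \<Longrightarrow> leq (PV x (prod_po X Y)) (PVstr x X Y (fst p, snd p)) u) \<Longrightarrow>
        leq (PV x (prod_po X Y)) (PVstr x X Y (a, A)) u"
  shows "scott_continuous (prod_po X (PV x Y)) (PV x (prod_po X Y)) (PVstr x X Y)"
proof -
  let ?P = "prod_po X (PV x Y)" and ?Q = "PV x (prod_po X Y)"
  have c: "PVstr x X Y p \<in> car ?Q" if "p \<in> car ?P" for p
    using that car[of "fst p" "snd p"] by (simp add: car_prod car_PV mem_Times_iff)
  have m: "leq ?Q (PVstr x X Y p) (PVstr x X Y q)" if "p \<in> car ?P" "q \<in> car ?P" "leq ?P p q" for p q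
    using that mono[of "fst p" "snd p" "fst q" "snd q"] by (simp add: car_prod car_PV leq_prod mem_Times_iff)
  have "is_lub ?Q (PVstr x X Y ` D) (PVstr x X Y s)" if D: "directed ?P D" and s: "is_lub ?P D s" for D s
    unfolding is_lub_def
  proof (intro conjI ballI impI)
    have Dc: "D \<subseteq> car ?P" and sc: "s \<in> car ?P" using D s by (simp_all add: directed_def is_lub_def)
    show "PVstr x X Y s \<in> car ?Q" by (rule c[OF sc])
    show "leq ?Q d (PVstr x X Y s)" if d: "d \<in> PVstr x X Y ` D" for d
    proof -
      obtain p where p: "p \<in> D" "d = PVstr x X Y p" using d by blast
      have "leq ?P p s" using s p(1) by (simp add: is_lub_def)
      then show ?thesis unfolding p(2) using m[of p s] p(1) Dc sc by blast
    qed
    fix u assume u: "u \<in> car ?Q" "\<forall>d\<in>PVstr x X Y ` D. leq ?Q d u"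
    have "leq ?Q (PVstr x X Y (fst s, snd s)) u"
    proof (rule least)
      show "D \<noteq> {}" using D by (simp add: directed_def)
      show "is_lub X (fst ` D) (fst s)" "is_lub (PV x Y) (snd ` D) (snd s)"
        using s by (simp_all add: is_lub_prod_iff)
      show "u \<in> PV_car x (prod_po X Y)" using u(1) by (simp add: car_PV)
      fix p assume p: "p \<in> D"
      show "fst p \<in> car X \<and> snd p \<in> PV_car x Y" using Dc p by (auto simp: car_prod car_PV)
      show "leq ?Q (PVstr x X Y (fst p, snd p)) u" using u(2) p by simp
      fix q assume q: "q \<in> D"
      from D p q obtain r where "r \<in> D" "leq ?P p r" "leq ?P q r" unfolding directed_def by blast
      then show "\<exists>r\<in>D. leq X (fst p) (fst r) \<and> leq X (fst q) (fst r) \<and>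
          leq (PV x Y) (snd p) (snd r) \<and> leq (PV x Y) (snd q) (snd r)"
        unfolding leq_prod by blast
    qed
    then show "leq ?Q (PVstr x X Y s) u" by simp
  qed
  then show ?thesis using c m by (simp add: scott_continuous_def)
qed

lemma PVstr_continuous_PL:
  assumes X: "poset X" and Y: "poset Y"
  shows "scott_continuous (prod_po X (PV PL Y)) (PV PL (prod_po X Y)) (PVstr PL X Y)"
proof -
  let ?V = "Vpo (prod_po X Y)"
  have cl: "lower (Vpo Z) A = A" if "A \<in> PV_car PL Z" for A and Z :: "'z po"
    using that lower_closed[OF poset_Vpo[of Z]] by (simp add: PV_car_def)
  have le: "leq (PV PL Z) A B \<longleftrightarrow> A \<subseteq> B" if "A \<in> PV_car PL Z" "B \<in> PV_car PL Z" for A B and Z :: "'z po"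
    using that by (simp add: leq_PV PV_le_def cl)
  have car: "PVstr PL X Y (a, A) \<in> PV_car PL (prod_po X Y)" if "a \<in> car X" "A \<in> PV_car PL Y" for a A
    unfolding PVstr_eq by (rule PVmap_car_PL[OF scott_continuous_slice[OF X that(1)] that(2)])
  have mono: "PVstr PL X Y (a, A) \<subseteq> PVstr PL X Y (b, B)"
    if ab: "a \<in> car X" "A \<in> PV_car PL Y" "b \<in> car X" "B \<in> PV_car PL Y" "leq X a b" "A \<subseteq> B" for a b A B
  proof -
    have "slice X Y a ` A \<subseteq> PVstr PL X Y (b, B)"
    proof (rule image_subsetI)
      fix \<mu> assume m: "\<mu> \<in> A"
      then have mc: "\<mu> \<in> car (Vpo Y)" using PV_car_sub ab by blast
      have "slice X Y b \<mu> \<in> PVstr PL X Y (b, B)"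
        unfolding PVstr_slice xhull_def using scott_closure_extensive[of "slice X Y b ` B" ?V] m ab by auto
      moreover have "leq ?V (slice X Y a \<mu>) (slice X Y b \<mu>)"
        using slice_mono[OF X Y] ab mc poset_refl[OF poset_Vpo mc] by blast
      moreover have "slice X Y a \<mu> \<in> car ?V" using slice_image_sub[OF X ab(1), of "{\<mu>}" Y] mc by auto
      ultimately show "slice X Y a \<mu> \<in> PVstr PL X Y (b, B)"
        using scott_closed_down[of ?V "PVstr PL X Y (b, B)"] car[OF ab(3,4)] by (simp add: PV_car_def)
    qed
    then show ?thesis
      using scott_closure_least[of ?V "PVstr PL X Y (b, B)"] car[OF ab(3,4)]
      by (simp add: PV_car_def PVstr_slice[of _ _ _ a] xhull_def)
  qed
  show ?thesis
  proof (rule PVstr_continuousI[OF car])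
    show "leq (PV PL (prod_po X Y)) (PVstr PL X Y (a, A)) (PVstr PL X Y (b, B))"
      if "a \<in> car X" "A \<in> PV_car PL Y" "b \<in> car X" "B \<in> PV_car PL Y" "leq X a b" "leq (PV PL Y) A B" for a A b B
      using mono[OF that(1-5)] le[OF that(2,4)] le[OF car[OF that(1,2)] car[OF that(3,4)]] that(6) by simp
    fix D a A u
    assume Dne: "D \<noteq> {}" and D1: "\<And>p. p \<in> D \<Longrightarrow> fst p \<in> car X \<and> snd p \<in> PV_car PL Y"
      and dir: "\<And>p q. p \<in> D \<Longrightarrow> q \<in> D \<Longrightarrow> \<exists>r\<in>D. leq X (fst p) (fst r) \<and> leq X (fst q) (fst r) \<and>
          leq (PV PL Y) (snd p) (snd r) \<and> leq (PV PL Y) (snd q) (snd r)"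
      and la: "is_lub X (fst ` D) a" and lA: "is_lub (PV PL Y) (snd ` D) A"
      and u: "u \<in> PV_car PL (prod_po X Y)"
      and ule: "\<And>p. p \<in> D \<Longrightarrow> leq (PV PL (prod_po X Y)) (PVstr PL X Y (fst p, snd p)) u"
    have ac: "a \<in> car X" "A \<in> PV_car PL Y" using la lA by (simp_all add: is_lub_def car_PV)
    have Dc: "fst p \<in> car X" "snd p \<in> PV_car PL Y" if "p \<in> D" for p using D1[OF that] by simp_all
    have D2: "\<exists>r\<in>D. leq X (fst p) (fst r) \<and> leq X (fst q) (fst r) \<and> snd p \<subseteq> snd r \<and> snd q \<subseteq> snd r"
      if pq: "p \<in> D" "q \<in> D" for p q
      using dir[OF pq] le[OF Dc(2)[OF pq(1)] Dc(2)] le[OF Dc(2)[OF pq(2)] Dc(2)] by blast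
    \<comment> \<open>This closure is convex and closed, hence an upper bound of all
      \<open>snd p\<close> within the powerdomain. Leastness yields \<open>A \<subseteq> ?W\<close>,
      which is the information about \<open>A\<close> that continuity needs.\<close>
    let ?W = "scott_closure (Vpo Y) (\<Union>(snd ` D))"
    have sub: "\<Union>(snd ` D) \<subseteq> car (Vpo Y)" using Dc PV_car_sub by blast
    obtain p where "p \<in> D" using Dne by blast
    with PV_car_ne[OF Dc(2)[OF this]] have Une: "\<Union>(snd ` D) \<noteq> {}" by blast
    have "vconvex (\<Union>(snd ` D))"
    proof (rule vconvex_directed_UN)
      show "vconvex (snd p)" if "p \<in> D" for p by (rule PV_car_vconvex[OF Dc(2)[OF that]])
      show "\<exists>r\<in>D. snd p \<subseteq> snd r \<and> snd q \<subseteq> snd r" if "p \<in> D" "q \<in> D" for p q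
        using D2[OF that] by blast
    qed
    then have W: "?W \<in> PV_car PL Y"
      using vconvex_scott_closure[OF sub] scott_closed_scott_closure[OF sub] Une
        scott_closure_extensive[of "\<Union>(snd ` D)" "Vpo Y"] by (auto simp: PV_car_def)
    have "leq (PV PL Y) A ?W"
    proof -
      have "\<forall>B\<in>snd ` D. leq (PV PL Y) B ?W"
        using le[OF Dc(2) W] scott_closure_extensive[of "\<Union>(snd ` D)" "Vpo Y"] by blast
      then show ?thesis using W lA by (simp add: is_lub_def car_PV)
    qed
    then have AW: "A \<subseteq> ?W" using le[OF ac(2) W] by simp
    have uc: "scott_closed ?V u" using u by (simp add: PV_car_def)
    have "slice X Y (fst p) ` snd p \<subseteq> u" if p: "p \<in> D" for p
    proof -
      have "PVstr PL X Y (fst p, snd p) \<subseteq> u" using ule[OF p] le[OF car[OF Dc[OF p]] u] by simp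
      then show ?thesis unfolding PVstr_slice xhull_def using scott_closure_extensive[of "slice X Y (fst p) ` snd p" ?V] by auto
    qed
    moreover note la
    moreover have "\<exists>r\<in>D. leq X (fst p) (fst r) \<and> leq X (fst q) (fst r) \<and>
      snd p \<subseteq> lower (Vpo Y) (snd r) \<and> snd q \<subseteq> lower (Vpo Y) (snd r)" if "p \<in> D" "q \<in> D" for p q
      using D2[OF that] cl[OF Dc(2)] by auto
    moreover have "fst p \<in> car X \<and> snd p \<subseteq> car (Vpo Y)" if "p \<in> D" for p
      using Dc[OF that] PV_car_sub[of "snd p" PL Y] by simp
    ultimately have "slice X Y a ` ?W \<subseteq> u"
      by (intro slice_closure_directed_subset[OF X Y Dne _ _ _ uc])
    then have "PVstr PL X Y (a, A) \<subseteq> u"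
      unfolding PVstr_slice xhull_def using AW by (simp, intro scott_closure_least[OF uc]) blast
    then show "leq (PV PL (prod_po X Y)) (PVstr PL X Y (a, A)) u" using le[OF car[OF ac] u] by simp
  qed
qed

section \<open>Continuous domains\<close>


lemma wb_car: "way_below P x y \<Longrightarrow> x \<in> car P \<and> y \<in> car P"
  by (simp add: way_below_def)

lemma wbD:
  assumes "way_below P x y" "directed P D" "is_lub P D s" "leq P y s"
  shows "\<exists>d\<in>D. leq P x d"
  using assms unfolding way_below_def by blast

lemma wb_leq: "poset P \<Longrightarrow> way_below P x y \<Longrightarrow> leq P x y"
proof -
  assume P: "poset P" "way_below P x y"
  then have y: "y \<in> car P" using wb_car[of P] by blast
  have r: "leq P y y" by (rule poset_refl[OF P(1) y])
  have "directed P {y}" "is_lub P {y} y" using y r by (auto simp: directed_def is_lub_def)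
  from wbD[OF P(2) this r] show "leq P x y" by auto
qed

lemma wb_mono:
  assumes P: "poset P" and "way_below P x y" "x' \<in> car P" "leq P x' x" "y' \<in> car P" "leq P y y'"
  shows "way_below P x' y'"
  unfolding way_below_def
proof (intro conjI allI impI)
  fix D s assume D: "directed P D" "is_lub P D s" "leq P y' s"
  have c: "x \<in> car P" "y \<in> car P" using assms(2) wb_car[of P] by blast+
  have "s \<in> car P" using D(2) by (simp add: is_lub_def)
  then have "leq P y s" using poset_trans[OF P assms(6) D(3)] c assms by blast
  from wbD[OF assms(2) D(1,2) this] obtain d where d: "d \<in> D" "leq P x d" by blast
  then have "d \<in> car P" using D(1) by (auto simp: directed_def)
  with poset_trans[OF P assms(4) d(2) assms(3) c(1)] d(1) show "\<exists>d\<in>D. leq P x' d" by blast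
qed (use assms in auto)

lemma domainD:
  assumes "domain P" "y \<in> car P"
  shows "directed P {x. way_below P x y}" "is_lub P {x. way_below P x y} y"
  using assms by (simp_all add: domain_def)

lemma wb_directed:
  assumes "domain P" "way_below P x1 y" "way_below P x2 y"
  shows "\<exists>z. way_below P z y \<and> leq P x1 z \<and> leq P x2 z"
  using domainD(1)[OF assms(1), of y] wb_car[OF assms(2)] assms(2,3) unfolding directed_def by blast

lemma wb_exists: "domain P \<Longrightarrow> y \<in> car P \<Longrightarrow> \<exists>x. way_below P x y"
  using domainD(1)[of P y] unfolding directed_def by blast

lemma wb_separates:
  assumes "domain P" "x \<in> car P" "y \<in> car P" "\<not> leq P x y"
  shows "\<exists>z. way_below P z x \<and> \<not> leq P z y"
  using domainD(2)[OF assms(1,2)] assms(3,4) unfolding is_lub_def by blast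

text \<open>The elements lying two way-below steps under \<open>y\<close> form a directed set whose
  supremum is still \<open>y\<close>. Since \<open>x\<close> is way below \<open>y\<close>, it is
  below one of them.\<close>

lemma wb_interpolate:
  assumes P: "domain P" and xy: "way_below P x y"
  shows "\<exists>z. way_below P x z \<and> way_below P z y"
proof -
  note po = domain_poset[OF P]
  let ?D = "{w. \<exists>z. way_below P w z \<and> way_below P z y}"
  have y: "y \<in> car P" using wb_car[OF xy] by blast
  have dir: "directed P ?D"
    unfolding directed_def
  proof (intro conjI ballI)
    show "?D \<subseteq> car P" using wb_car[of P] by auto
    obtain z where "way_below P z y" using wb_exists[OF P y] by blast
    moreover then obtain w where "way_below P w z" using wb_exists[OF P] wb_car[of P] by blast
    ultimately show "?D \<noteq> {}" by blast
    fix w1 w2 assume "w1 \<in> ?D" "w2 \<in> ?D"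
    then obtain z1 z2 where z: "way_below P w1 z1" "way_below P z1 y" "way_below P w2 z2" "way_below P z2 y" by blast
    obtain z where z': "way_below P z y" "leq P z1 z" "leq P z2 z" using wb_directed[OF P z(2,4)] by blast
    have c: "w1 \<in> car P" "w2 \<in> car P" "z \<in> car P" using wb_car[OF z(1)] wb_car[OF z(3)] wb_car[OF z'(1)] by auto
    have "way_below P w1 z" "way_below P w2 z"
      using wb_mono[OF po z(1) c(1) poset_refl[OF po c(1)] c(3) z'(2)]
        wb_mono[OF po z(3) c(2) poset_refl[OF po c(2)] c(3) z'(3)] .
    from wb_directed[OF P this] z'(1) show "\<exists>w\<in>?D. leq P w1 w \<and> leq P w2 w" by blast
  qed
  have lub: "is_lub P ?D y"
    unfolding is_lub_def
  proof (intro conjI ballI impI y)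
    fix w assume "w \<in> ?D"
    then obtain z where z: "way_below P w z" "way_below P z y" by blast
    show "leq P w y"
      using poset_trans[OF po wb_leq[OF po z(1)] wb_leq[OF po z(2)]] wb_car[OF z(1)] y by blast
  next
    fix u assume u: "u \<in> car P" "\<forall>d\<in>?D. leq P d u"
    have "leq P z u" if "way_below P z y" for z
      using domainD(2)[OF P, of z] wb_car[OF that] u that unfolding is_lub_def by blast
    then show "leq P y u" using domainD(2)[OF P y] u unfolding is_lub_def by blast
  qed
  obtain w where w: "w \<in> ?D" "leq P x w" using wbD[OF xy dir lub poset_refl[OF po y]] by blast
  then obtain z where z: "way_below P w z" "way_below P z y" by blast
  have xc: "x \<in> car P" "z \<in> car P" using wb_car[OF xy] wb_car[OF z(2)] by auto
  have "way_below P x z" by (rule wb_mono[OF po z(1) xc(1) w(2) xc(2) poset_refl[OF po xc(2)]])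
  with z show ?thesis by blast
qed

text \<open>For finite \<open>F\<close> these open sets serve as inner approximations of an open
  set, lying between it and finitely generated upper sets.\<close>

definition wup :: "'a po \<Rightarrow> 'a set \<Rightarrow> 'a set" where
  "wup P F = {z. \<exists>x\<in>F. way_below P x z}"

lemma wup_Un: "wup P (F \<union> G) = wup P F \<union> wup P G" by (auto simp: wup_def)
lemma wup_mono: "F \<subseteq> G \<Longrightarrow> wup P F \<subseteq> wup P G" by (auto simp: wup_def)
lemma wup_empty [simp]: "wup P {} = {}" by (simp add: wup_def)
lemma wup_insert: "wup P (insert x F) = wup P {x} \<union> wup P F" by (auto simp: wup_def)

lemma scott_open_wup_singleton:
  assumes P: "domain P" shows "scott_open P (wup P {x})"
proof (rule scott_openI)
  note po = domain_poset[OF P]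
  show "wup P {x} \<subseteq> car P" using wb_car[of P] by (auto simp: wup_def)
  show "v \<in> wup P {x}" if "u \<in> wup P {x}" "v \<in> car P" "leq P u v" for u v
  proof -
    have "way_below P x u" using that(1) by (simp add: wup_def)
    moreover then have "x \<in> car P" using wb_car[of P] by blast
    ultimately show ?thesis using wb_mono[OF po _ _ _ that(2,3)] poset_refl[OF po] by (simp add: wup_def)
  qed
  show "\<exists>d\<in>D. d \<in> wup P {x}" if D: "directed P D" "is_lub P D s" "s \<in> wup P {x}" for D s
  proof -
    have s: "way_below P x s" using D(3) by (simp add: wup_def)
    obtain z where z: "way_below P x z" "way_below P z s" using wb_interpolate[OF P s] by blast
    have sc: "s \<in> car P" "x \<in> car P" using wb_car[OF s] by auto
    obtain d where d: "d \<in> D" "leq P z d" using wbD[OF z(2) D(1,2) poset_refl[OF po sc(1)]] by blast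
    then have "d \<in> car P" using D(1) by (auto simp: directed_def)
    then have "way_below P x d" using wb_mono[OF po z(1) sc(2) poset_refl[OF po sc(2)] _ d(2)] by blast
    with d(1) show ?thesis by (auto simp: wup_def)
  qed
qed

lemma scott_open_wup: "domain P \<Longrightarrow> scott_open P (wup P F)"
proof -
  assume P: "domain P"
  have "wup P F = \<Union>((\<lambda>x. wup P {x}) ` F)" by (auto simp: wup_def)
  moreover have "scott_open P (\<Union>((\<lambda>x. wup P {x}) ` F))"
    using scott_open_wup_singleton[OF P] by (intro scott_open_Union) auto
  ultimately show ?thesis by simp
qed

lemma wup_subset_upper: "poset P \<Longrightarrow> wup P F \<subseteq> upper P F"
  using wb_leq[of P] wb_car[of P] unfolding wup_def upper_def by blast

lemma upper_subset_open: "scott_open P U \<Longrightarrow> F \<subseteq> U \<Longrightarrow> upper P F \<subseteq> U"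
  using scott_open_up[of P U] unfolding upper_def by blast

lemma open_wb:
  assumes "domain P" "scott_open P U" "y \<in> U"
  shows "\<exists>x\<in>U. way_below P x y"
proof -
  have "y \<in> car P" using assms scott_open_sub by blast
  from scott_open_dir[OF assms(2) domainD[OF assms(1) this] assms(3)] show ?thesis by blast
qed

text \<open>By continuity the sets \<open>wup P {x}\<close> with \<open>x\<close> in
  \<open>U\<close> cover \<open>U\<close>, hence \<open>K\<close>. A finite subcover supplies a
  finite set interpolating between a compact and an open set.\<close>

lemma compact_finite_wup:
  assumes P: "domain P" and K: "scott_compact P K" and U: "scott_open P U" "K \<subseteq> U"
  shows "\<exists>F\<subseteq>U. finite F \<and> K \<subseteq> wup P F"
proof -
  let ?\<U> = "(\<lambda>x. wup P {x}) ` U"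
  have "K \<subseteq> \<Union>?\<U>"
  proof
    fix y assume "y \<in> K"
    then obtain x where "x \<in> U" "way_below P x y" using open_wb[OF P U(1)] U(2) by blast
    then show "y \<in> \<Union>?\<U>" by (auto simp: wup_def)
  qed
  moreover have "scott_open P V" if "V \<in> ?\<U>" for V using that scott_open_wup[OF P] by auto
  ultimately have "\<exists>\<V>\<subseteq>?\<U>. finite \<V> \<and> K \<subseteq> \<Union>\<V>" by (intro scott_compactD[OF K])
  then obtain \<V> where V: "\<V> \<subseteq> ?\<U>" "finite \<V>" "K \<subseteq> \<Union>\<V>" by blast
  moreover obtain F where "F \<subseteq> U" "finite F" "\<V> = (\<lambda>x. wup P {x}) ` F"
    using finite_subset_image[OF V(2,1)] by blast
  ultimately show ?thesis by (intro exI[of _ F]) (auto simp: wup_def)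
qed

text \<open>Every element way below \<open>y\<close> is dominated by a member of \<open>B\<close>,
  and members of \<open>B\<close> are way below \<open>y\<close>. The two sets are therefore
  cofinal, and directedness and the supremum pass from \<open>B\<close> to the full way-below
  set.\<close>

lemma domain_basisI:
  assumes P: "dcpo P"
    and B: "\<And>y. y \<in> car P \<Longrightarrow> \<exists>B. directed P B \<and> is_lub P B y \<and> (\<forall>b\<in>B. way_below P b y)"
  shows "domain P"
  unfolding domain_def
proof (intro conjI ballI P)
  note po = dcpo_poset[OF P]
  fix y assume y: "y \<in> car P"
  then obtain B where B: "directed P B" "is_lub P B y" and Bw: "\<And>b. b \<in> B \<Longrightarrow> way_below P b y" using assms(2) by blast
  show "directed P {x. way_below P x y}"
    unfolding directed_def
  proof (intro conjI ballI)
    show "{x. way_below P x y} \<subseteq> car P" using wb_car[of P] by blast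
    obtain b where "b \<in> B" using B(1) unfolding directed_def by blast
    with Bw show "{x. way_below P x y} \<noteq> {}" by blast
    fix x1 x2 assume "x1 \<in> {x. way_below P x y}" "x2 \<in> {x. way_below P x y}"
    then have w: "way_below P x1 y" "way_below P x2 y" by auto
    obtain b1 b2 where b: "b1 \<in> B" "b2 \<in> B" "leq P x1 b1" "leq P x2 b2"
      using wbD[OF w(1) B poset_refl[OF po y]] wbD[OF w(2) B poset_refl[OF po y]] by blast
    then obtain c where c: "c \<in> B" "leq P b1 c" "leq P b2 c" using B(1) unfolding directed_def by blast
    have "b1 \<in> car P" "b2 \<in> car P" "c \<in> car P" using b c B(1) unfolding directed_def by blast+
    then have "leq P x1 c" "leq P x2 c"
      using poset_trans[OF po b(3) c(2)] poset_trans[OF po b(4) c(3)] wb_car[OF w(1)] wb_car[OF w(2)] by blast+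
    moreover have "c \<in> {x. way_below P x y}" using Bw[OF c(1)] by simp
    ultimately show "\<exists>z\<in>{x. way_below P x y}. leq P x1 z \<and> leq P x2 z" by blast
  qed
  show "is_lub P {x. way_below P x y} y"
    unfolding is_lub_def
  proof (intro conjI ballI impI y)
    show "leq P d y" if "d \<in> {x. way_below P x y}" for d using that wb_leq[OF po, of d y] by simp
    fix u assume u: "u \<in> car P" "\<forall>d\<in>{x. way_below P x y}. leq P d u"
    then have "\<forall>b\<in>B. leq P b u" using Bw by simp
    then show "leq P y u" using B(2) u(1) by (simp add: is_lub_def)
  qed
qed

section \<open>Products of domains and coherence\<close>

lemma poset_prod: "poset P \<Longrightarrow> poset Q \<Longrightarrow> poset (prod_po P Q)"
proof -
  assume P: "poset P" "poset Q"
  show ?thesis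
    unfolding poset_def car_prod leq_prod
  proof (intro conjI ballI impI)
    show "x = y" if "x \<in> car P \<times> car Q" "y \<in> car P \<times> car Q"
      "(leq P (fst x) (fst y) \<and> leq Q (snd x) (snd y)) \<and> leq P (fst y) (fst x) \<and> leq Q (snd y) (snd x)" for x y
      using that poset_antisym[OF P(1), of "fst x" "fst y"] poset_antisym[OF P(2), of "snd x" "snd y"]
      by (auto simp: prod_eq_iff)
    show "leq P (fst x) (fst z)"
      if "x \<in> car P \<times> car Q" "y \<in> car P \<times> car Q" "z \<in> car P \<times> car Q"
      "(leq P (fst x) (fst y) \<and> leq Q (snd x) (snd y)) \<and> leq P (fst y) (fst z) \<and> leq Q (snd y) (snd z)" for x y z
      using that poset_trans[OF P(1), of "fst x" "fst y" "fst z"] by auto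
    show "leq Q (snd x) (snd z)"
      if "x \<in> car P \<times> car Q" "y \<in> car P \<times> car Q" "z \<in> car P \<times> car Q"
      "(leq P (fst x) (fst y) \<and> leq Q (snd x) (snd y)) \<and> leq P (fst y) (fst z) \<and> leq Q (snd y) (snd z)" for x y z
      using that poset_trans[OF P(2), of "snd x" "snd y" "snd z"] by auto
  qed (use poset_refl[OF P(1)] poset_refl[OF P(2)] in auto)
qed

lemma dcpo_prod: "dcpo P \<Longrightarrow> dcpo Q \<Longrightarrow> dcpo (prod_po P Q)"
  unfolding dcpo_def
proof (intro conjI allI impI)
  fix D assume PQ: "poset P \<and> (\<forall>D. directed P D \<longrightarrow> (\<exists>s. is_lub P D s))"
    "poset Q \<and> (\<forall>D. directed Q D \<longrightarrow> (\<exists>s. is_lub Q D s))" and D: "directed (prod_po P Q) D"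
  obtain a where "is_lub P (fst ` D) a" using PQ(1) directed_prod(1)[OF D] by blast
  moreover obtain b where "is_lub Q (snd ` D) b" using PQ(2) directed_prod(2)[OF D] by blast
  ultimately have "is_lub (prod_po P Q) D (a, b)" by (simp add: is_lub_prod_iff)
  then show "\<exists>s. is_lub (prod_po P Q) D s" ..
qed (simp add: poset_prod)

lemma way_below_prod:
  assumes P: "poset P" and Q: "poset Q" and x: "way_below P x a" and y: "way_below Q y b"
  shows "way_below (prod_po P Q) (x, y) (a, b)"
  unfolding way_below_def
proof (intro conjI allI impI)
  show "(x, y) \<in> car (prod_po P Q)" "(a, b) \<in> car (prod_po P Q)"
    using wb_car[OF x] wb_car[OF y] by (auto simp: car_prod)
  fix D s assume D: "directed (prod_po P Q) D" "is_lub (prod_po P Q) D s" "leq (prod_po P Q) (a, b) s"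
  have l: "is_lub P (fst ` D) (fst s)" "is_lub Q (snd ` D) (snd s)" using D(2) by (auto simp: is_lub_prod_iff)
  have "leq P a (fst s)" "leq Q b (snd s)" using D(3) by (auto simp: leq_prod)
  from wbD[OF x directed_prod(1)[OF D(1)] l(1) this(1)] wbD[OF y directed_prod(2)[OF D(1)] l(2) this(2)]
  obtain p q where pq: "p \<in> D" "q \<in> D" "leq P x (fst p)" "leq Q y (snd q)" by blast
  then obtain r where r: "r \<in> D" "leq (prod_po P Q) p r" "leq (prod_po P Q) q r"
    using D(1) unfolding directed_def by blast
  have c: "p \<in> car (prod_po P Q)" "q \<in> car (prod_po P Q)" "r \<in> car (prod_po P Q)"
    using D(1) pq r unfolding directed_def by blast+
  have "leq P x (fst r)"
    by (rule poset_trans[OF P pq(3)]) (use r c wb_car[OF x] in \<open>auto simp: leq_prod car_prod\<close>)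
  moreover have "leq Q y (snd r)"
    by (rule poset_trans[OF Q pq(4)]) (use r c wb_car[OF y] in \<open>auto simp: leq_prod car_prod\<close>)
  ultimately show "\<exists>d\<in>D. leq (prod_po P Q) (x, y) d" using r(1) by (auto simp: leq_prod)
qed

lemma domain_prod:
  assumes P: "domain P" and Q: "domain Q"
  shows "domain (prod_po P Q)"
proof (rule domain_basisI[OF dcpo_prod[OF domain_dcpo[OF P] domain_dcpo[OF Q]]])
  fix s assume "s \<in> car (prod_po P Q)"
  then obtain a b where s: "s = (a, b)" "a \<in> car P" "b \<in> car Q" by (auto simp: car_prod)
  let ?A = "{x. way_below P x a}" and ?B = "{x. way_below Q x b}"
  note A = domainD[OF P s(2)] and B = domainD[OF Q s(3)]
  have ne: "?A \<noteq> {}" "?B \<noteq> {}" using A B by (auto simp: directed_def)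
  have "directed (prod_po P Q) (?A \<times> ?B)"
    unfolding directed_def
  proof (intro conjI ballI)
    show "?A \<times> ?B \<subseteq> car (prod_po P Q)" "?A \<times> ?B \<noteq> {}" using A(1) B(1) ne by (auto simp: directed_def car_prod)
    fix p q assume "p \<in> ?A \<times> ?B" "q \<in> ?A \<times> ?B"
    then have m: "fst p \<in> ?A" "fst q \<in> ?A" "snd p \<in> ?B" "snd q \<in> ?B" by auto
    obtain x where "x \<in> ?A" "leq P (fst p) x" "leq P (fst q) x" using A(1) m(1,2) unfolding directed_def by blast
    moreover obtain y where "y \<in> ?B" "leq Q (snd p) y" "leq Q (snd q) y" using B(1) m(3,4) unfolding directed_def by blast
    ultimately show "\<exists>z\<in>?A \<times> ?B. leq (prod_po P Q) p z \<and> leq (prod_po P Q) q z"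
      by (intro bexI[of _ "(x, y)"]) (auto simp: leq_prod)
  qed
  moreover have "fst ` (?A \<times> ?B) = ?A" "snd ` (?A \<times> ?B) = ?B"
    unfolding fst_image_times snd_image_times using ne by argo+
  then have "is_lub (prod_po P Q) (?A \<times> ?B) s"
    using A(2) B(2) unfolding is_lub_prod_iff s(1) fst_conv snd_conv by argo
  moreover have "\<forall>p\<in>?A \<times> ?B. way_below (prod_po P Q) p s"
    using way_below_prod[OF domain_poset[OF P] domain_poset[OF Q]] s(1) by auto
  ultimately show "\<exists>B. directed (prod_po P Q) B \<and> is_lub (prod_po P Q) B s \<and> (\<forall>b\<in>B. way_below (prod_po P Q) b s)"
    by blast
qed

text \<open>Every Scott-open set of the product order is open in the product of the two Scott
  topologies; this is where continuity of the factors is used. A rectangle of compact sets is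
  compact for the product topology, hence for the coarser family of Scott-open sets.\<close>

lemma scott_compact_Times:
  assumes P: "domain P" and Q: "domain Q" and A: "scott_compact P A" and B: "scott_compact Q B"
  shows "scott_compact (prod_po P Q) (A \<times> B)"
proof -
  have op: "openin (prod_topology (scott_top P) (scott_top Q)) U" if U: "scott_open (prod_po P Q) U" for U
    unfolding openin_prod_topology_alt
  proof (intro allI impI)
    fix a b assume ab: "(a, b) \<in> U"
    then have c: "a \<in> car P" "b \<in> car Q" using scott_open_sub[OF U] by (auto simp: car_prod)
    let ?B = "{x. way_below P x a} \<times> {x. way_below Q x b}"
    obtain p where p: "p \<in> U" "way_below (prod_po P Q) p (a, b)"
      using open_wb[OF domain_prod[OF P Q] U ab] by blast
    have pc: "p \<in> car (prod_po P Q)" using scott_open_sub[OF U] p by blast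
    \<comment> \<open>A directed set in one factor becomes directed in the product when the other
      coordinate is frozen, here at \<open>b\<close>. So being way below in the product passes to
      each coordinate.\<close>
    have "way_below P (fst p) a"
      unfolding way_below_def
    proof (intro conjI allI impI)
      show "fst p \<in> car P" "a \<in> car P" using pc c by (auto simp: car_prod)
      fix D s assume D: "directed P D" "is_lub P D s" "leq P a s"
      have ne: "D \<noteq> {}" using D(1) by (simp add: directed_def)
      have "directed (prod_po P Q) (D \<times> {b})"
        using D(1) c poset_refl[OF domain_poset[OF Q] c(2)] unfolding directed_def
        by (auto simp: car_prod leq_prod)
      moreover have "is_lub Q {b} b" using c poset_refl[OF domain_poset[OF Q] c(2)] by (auto simp: is_lub_def)
      then have "is_lub (prod_po P Q) (D \<times> {b}) (s, b)"
        using D(2) ne unfolding is_lub_prod_iff by (simp add: fst_image_times snd_image_times)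
      ultimately have "\<exists>d\<in>D \<times> {b}. leq (prod_po P Q) p d"
        by (rule wbD[OF p(2)]) (use D(3) poset_refl[OF domain_poset[OF Q] c(2)] in \<open>simp add: leq_prod\<close>)
      then show "\<exists>d\<in>D. leq P (fst p) d" by (auto simp: leq_prod)
    qed
    moreover have "way_below Q (snd p) b"
      unfolding way_below_def
    proof (intro conjI allI impI)
      show "snd p \<in> car Q" "b \<in> car Q" using pc c by (auto simp: car_prod)
      fix D s assume D: "directed Q D" "is_lub Q D s" "leq Q b s"
      have ne: "D \<noteq> {}" using D(1) by (simp add: directed_def)
      have "directed (prod_po P Q) ({a} \<times> D)"
        using D(1) c poset_refl[OF domain_poset[OF P] c(1)] unfolding directed_def
        by (auto simp: car_prod leq_prod)
      moreover have "is_lub P {a} a" using c poset_refl[OF domain_poset[OF P] c(1)] by (auto simp: is_lub_def)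
      then have "is_lub (prod_po P Q) ({a} \<times> D) (a, s)"
        using D(2) ne unfolding is_lub_prod_iff by (simp add: fst_image_times snd_image_times)
      ultimately have "\<exists>d\<in>{a} \<times> D. leq (prod_po P Q) p d"
        by (rule wbD[OF p(2)]) (use D(3) poset_refl[OF domain_poset[OF P] c(1)] in \<open>simp add: leq_prod\<close>)
      then show "\<exists>d\<in>D. leq Q (snd p) d" by (auto simp: leq_prod)
    qed
    moreover have "wup P {fst p} \<times> wup Q {snd p} \<subseteq> U"
    proof -
      have "upper (prod_po P Q) {p} \<subseteq> U" by (rule upper_subset_open[OF U]) (use p in auto)
      moreover have "wup P {fst p} \<times> wup Q {snd p} \<subseteq> upper (prod_po P Q) {p}"
        using wup_subset_upper[OF domain_poset[OF P], of "{fst p}"] wup_subset_upper[OF domain_poset[OF Q], of "{snd p}"]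
        by (auto simp: upper_def car_prod leq_prod)
      ultimately show ?thesis by blast
    qed
    ultimately show "\<exists>V W. openin (scott_top P) V \<and> openin (scott_top Q) W \<and> a \<in> V \<and> b \<in> W \<and> V \<times> W \<subseteq> U"
      by (intro exI[of _ "wup P {fst p}"] exI[of _ "wup Q {snd p}"]) (simp add: scott_open_wup P Q, simp add: wup_def)
  qed
  have "compactin (prod_topology (scott_top P) (scott_top Q)) (A \<times> B)"
    using A B by (simp add: compactin_Times scott_compact_iff)
  then show ?thesis
    using op A B unfolding scott_compact_iff compactin_def by (auto simp: car_prod)
qed

text \<open>Coherence for principal filters. It passes to products because two principal filters of
  pairs meet in a rectangle, and it extends to finitely generated upper sets by finite
  unions.\<close>

definition meet_compact :: "'a po \<Rightarrow> bool" where
  "meet_compact P \<longleftrightarrow> (\<forall>p\<in>car P. \<forall>q\<in>car P. scott_compact P (upper P {p} \<inter> upper P {q}))"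

lemma scott_compact_upper_finite:
  assumes "poset P" "finite F" "F \<subseteq> car P" shows "scott_compact P (upper P F)"
  by (rule scott_compact_upper[OF assms(1)]) (use assms in \<open>simp add: scott_compact_iff finite_imp_compactin\<close>)

lemma coherent_meet_compact: "poset P \<Longrightarrow> coherent P \<Longrightarrow> meet_compact P"
  unfolding meet_compact_def coherent_def
  using scott_compact_upper_finite[of P "{_}"] saturated_upper[of P "{_}"] by blast

lemma meet_compact_prod:
  assumes "domain P" "domain Q" "meet_compact P" "meet_compact Q"
  shows "meet_compact (prod_po P Q)"
  unfolding meet_compact_def
proof (intro ballI)
  fix p q assume "p \<in> car (prod_po P Q)" "q \<in> car (prod_po P Q)"
  then have c: "fst p \<in> car P" "snd p \<in> car Q" "fst q \<in> car P" "snd q \<in> car Q" by (auto simp: car_prod)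
  have "upper (prod_po P Q) {p} \<inter> upper (prod_po P Q) {q}
     = (upper P {fst p} \<inter> upper P {fst q}) \<times> (upper Q {snd p} \<inter> upper Q {snd q})"
    by (auto simp: upper_def car_prod leq_prod)
  then show "scott_compact (prod_po P Q) (upper (prod_po P Q) {p} \<inter> upper (prod_po P Q) {q})"
    using scott_compact_Times[OF assms(1,2)] assms(3,4) c unfolding meet_compact_def by simp
qed

lemma meet_compact_finite:
  assumes "poset P" "meet_compact P" "finite F" "finite G" "F \<subseteq> car P" "G \<subseteq> car P"
  shows "scott_compact P (upper P F \<inter> upper P G)"
proof -
  have "upper P F \<inter> upper P G = \<Union>((\<lambda>(p, q). upper P {p} \<inter> upper P {q}) ` (F \<times> G))"
    by (auto simp: upper_def)
  moreover have "compactin (scott_top P) (\<Union>((\<lambda>(p, q). upper P {p} \<inter> upper P {q}) ` (F \<times> G)))"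
    by (rule compactin_Union) (use assms in \<open>auto simp: meet_compact_def scott_compact_iff subset_iff\<close>)
  ultimately show ?thesis by (simp add: scott_compact_iff)
qed

section \<open>The Lawson topology and well-filteredness\<close>

lemma topspace_lawson: "topspace (lawson_topology P) = car P"
proof -
  have "scott_open P (car P)" by simp
  then have "car P \<subseteq> \<Union>({U. scott_open P U} \<union> {car P - upper P {x} |x. x \<in> car P})" by blast
  moreover have "\<Union>({U. scott_open P U} \<union> {car P - upper P {x} |x. x \<in> car P}) \<subseteq> car P"
    using scott_open_sub[of P] by blast
  ultimately show ?thesis unfolding lawson_topology_def topology_generated_by_topspace by blast
qed

lemma openin_lawson_scott: "scott_open P U \<Longrightarrow> openin (lawson_topology P) U"
  unfolding lawson_topology_def by (rule topology_generated_by_Basis) simp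

lemma openin_lawson_upper: "x \<in> car P \<Longrightarrow> openin (lawson_topology P) (car P - upper P {x})"
  unfolding lawson_topology_def by (rule topology_generated_by_Basis) blast

lemma closedin_lawson_scott: "scott_closed P C \<Longrightarrow> closedin (lawson_topology P) C"
  unfolding closedin_def topspace_lawson scott_closed_def using openin_lawson_scott[of P] by simp

lemma lawson_compact_scott: "lawson_compact P A \<Longrightarrow> scott_compact P A"
  unfolding lawson_compact_def scott_compact_iff compactin_def topspace_lawson
  using openin_lawson_scott[of P] by simp

text \<open>If \<open>A\<close> misses \<open>\<up>x\<close>, compactness and continuity provide \<open>y \<lless> x\<close> such that \<open>A\<close> misses \<open>\<up>y\<close>.\<close>
lemma lawson_compact_lower_closed:
  assumes P: "domain P" and A: "lawson_compact P A"
  shows "scott_closed P (lower P A)"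
proof -
  note po = domain_poset[OF P]
  have Ac: "A \<subseteq> car P" using A by (simp add: lawson_compact_def)
  have "\<exists>V. scott_open P V \<and> x \<in> V \<and> V \<subseteq> car P - lower P A" if x: "x \<in> car P - lower P A" for x
  proof -
    have xc: "x \<in> car P" using x by blast
    let ?\<U> = "(\<lambda>y. car P - upper P {y}) ` {y. way_below P y x}"
    have "A \<subseteq> \<Union>?\<U>"
    proof
      fix a assume a: "a \<in> A"
      then have "\<not> leq P x a" using x by (auto simp: lower_def)
      then obtain y where y: "way_below P y x" "\<not> leq P y a" using wb_separates[OF P xc, of a] a Ac by blast
      then have "a \<in> car P - upper P {y}" using a Ac by (auto simp: upper_def)
      with y(1) show "a \<in> \<Union>?\<U>" by blast
    qed
    moreover have "openin (lawson_topology P) U" if "U \<in> ?\<U>" for U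
      using that openin_lawson_upper[of _ P] wb_car[of P] by auto
    moreover have "compactin (lawson_topology P) A" using A by (simp add: lawson_compact_def)
    ultimately have "\<exists>\<V>. finite \<V> \<and> \<V> \<subseteq> ?\<U> \<and> A \<subseteq> \<Union>\<V>"
      by (intro compactinD)
    then obtain \<V> where V: "finite \<V>" "\<V> \<subseteq> ?\<U>" "A \<subseteq> \<Union>\<V>" by blast
    have "\<exists>W\<in>?\<U>. \<Union>\<V> \<subseteq> W"
    proof (rule finite_subset_directed_Union[OF V(1,2)])
      show "?\<U> \<noteq> {}" using wb_exists[OF P xc] by blast
      fix U V assume "U \<in> ?\<U>" "V \<in> ?\<U>"
      then obtain u v where uv: "way_below P u x" "way_below P v x" "U = car P - upper P {u}" "V = car P - upper P {v}" by blast
      obtain w where w: "way_below P w x" "leq P u w" "leq P v w" using wb_directed[OF P uv(1,2)] by blast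
      have c: "{u} \<subseteq> car P" "{v} \<subseteq> car P" "{w} \<subseteq> car P"
        using wb_car[OF w(1)] wb_car[OF uv(1)] wb_car[OF uv(2)] by auto
      have "upper P {w} \<subseteq> upper P {u}" "upper P {w} \<subseteq> upper P {v}"
        using w c by (simp_all add: upper_subset_iff[OF po]) (simp_all add: upper_def)
      then have "U \<union> V \<subseteq> car P - upper P {w}" using uv by blast
      then show "\<exists>W\<in>?\<U>. U \<union> V \<subseteq> W" using w(1) by blast
    qed
    then obtain W where W: "W \<in> ?\<U>" "\<Union>\<V> \<subseteq> W" by (rule bexE)
    then obtain y where y: "way_below P y x" "W = car P - upper P {y}" by auto
    have "A \<subseteq> W" using V(3) W(2) by (rule subset_trans)
    then have y2: "A \<inter> upper P {y} = {}" unfolding y(2) by blast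
    have "wup P {y} \<subseteq> car P - lower P A"
    proof
      fix z assume "z \<in> wup P {y}"
      then have z: "way_below P y z" by (simp add: wup_def)
      have "\<not> leq P z a" if a: "a \<in> A" for a
      proof
        assume "leq P z a"
        then have "leq P y a" using poset_trans[OF po wb_leq[OF po z]] wb_car[OF z] a Ac by blast
        then have "a \<in> upper P {y}" using a Ac by (auto simp: upper_def)
        then show False using a y2 by blast
      qed
      then show "z \<in> car P - lower P A" using wb_car[OF z] by (auto simp: lower_def)
    qed
    then show ?thesis using scott_open_wup[OF P, of "{y}"] y(1) by (intro exI[of _ "wup P {y}"]) (simp add: wup_def)
  qed
  then have "\<forall>x\<in>car P - lower P A. \<exists>V. scott_open P V \<and> x \<in> V \<and> V \<subseteq> car P - lower P A" by blast
  then have "scott_open P (car P - lower P A)" by (intro scott_open_local) simp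
  then show ?thesis using lower_sub[of P A] by (simp add: scott_closed_def)
qed

text \<open>A point \<open>x\<close> outside \<open>K\<close> has a principal ideal disjoint from
  \<open>K\<close>. Interpolation gives a finite \<open>F\<close>, with no member below
  \<open>x\<close>, whose upper set contains \<open>K\<close>. Removing the principal filters of the
  members of \<open>F\<close> leaves a Lawson-open neighbourhood of \<open>x\<close> that misses
  \<open>K\<close>.\<close>

lemma scott_compact_saturated_lawson_closed:
  assumes P: "domain P" and K: "scott_compact P K" "saturated P K"
  shows "closedin (lawson_topology P) K"
proof -
  note po = domain_poset[OF P]
  have Kc: "K \<subseteq> car P" using K(2) by (simp add: saturated_def)
  have "\<exists>T. openin (lawson_topology P) T \<and> x \<in> T \<and> T \<subseteq> car P - K" if x: "x \<in> car P - K" for x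
  proof -
    have "\<not> leq P k x" if "k \<in> K" for k
    proof
      assume "leq P k x"
      then have "x \<in> upper P K" using that x unfolding upper_def by blast
      then show False using x K(2) by (simp add: saturated_def)
    qed
    then have sub: "K \<subseteq> car P - lower P {x}" using Kc unfolding lower_def by blast
    have op: "scott_open P (car P - lower P {x})"
      using scott_closed_lower_singleton[OF po, of x] x by (simp add: scott_closed_def)
    obtain F where F: "F \<subseteq> car P - lower P {x}" "finite F" "K \<subseteq> wup P F"
      using compact_finite_wup[OF P K(1) op sub] by blast
    have "openin (lawson_topology P) (car P \<inter> (\<Inter>y\<in>F. car P - upper P {y}))"
    proof (cases "F = {}")
      case True then show ?thesis by (simp add: openin_lawson_scott)
    next
      case False
      then have "openin (lawson_topology P) (\<Inter>y\<in>F. car P - upper P {y})"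
        using F(1,2) openin_lawson_upper[of _ P] by (intro openin_INT2) auto
      then show ?thesis by (rule openin_Int[OF openin_lawson_scott[OF scott_open_car]])
    qed
    moreover have "x \<in> car P \<inter> (\<Inter>y\<in>F. car P - upper P {y})"
      using F(1) x by (auto simp: upper_def lower_def)
    moreover have "car P \<inter> (\<Inter>y\<in>F. car P - upper P {y}) \<subseteq> car P - K"
      using F(3) wup_subset_upper[OF po, of F] unfolding upper_def by blast
    ultimately show ?thesis by blast
  qed
  then have "openin (lawson_topology P) (car P - K)" using openin_subopen[of "lawson_topology P" "car P - K"] by simp
  then show ?thesis using Kc by (simp add: closedin_def topspace_lawson)
qed

text \<open>A maximal open set containing no member of \<open>\<K>\<close> has an irreducible complement, and in a
  domain an irreducible closed set is a principal ideal.\<close>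
lemma domain_well_filtered:
  assumes P: "domain P" and ne: "\<K> \<noteq> {}"
    and K: "\<And>K. K \<in> \<K> \<Longrightarrow> scott_compact P K \<and> saturated P K"
    and filt: "\<And>K L. K \<in> \<K> \<Longrightarrow> L \<in> \<K> \<Longrightarrow> \<exists>M\<in>\<K>. M \<subseteq> K \<inter> L"
    and U: "scott_open P U" and sub: "\<Inter>\<K> \<subseteq> U"
  shows "\<exists>K\<in>\<K>. K \<subseteq> U"
proof (rule ccontr)
  assume neg: "\<not> ?thesis"
  note po = domain_poset[OF P]
  define \<W> where "\<W> = {W. scott_open P W \<and> U \<subseteq> W \<and> (\<forall>K\<in>\<K>. \<not> K \<subseteq> W)}"
  have "\<W> \<noteq> {}" using U neg by (auto simp: \<W>_def)
  moreover have "\<Union>\<C> \<in> \<W>" if C: "\<C> \<noteq> {}" "subset.chain \<W> \<C>" for \<C>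
  proof -
    have CW: "\<C> \<subseteq> \<W>" using C(2) by (simp add: subset.chain_def)
    have op: "\<And>W. W \<in> \<C> \<Longrightarrow> scott_open P W" using CW by (auto simp: \<W>_def)
    have "\<not> K \<subseteq> \<Union>\<C>" if KK: "K \<in> \<K>" for K
    proof
      assume "K \<subseteq> \<Union>\<C>"
      have "\<exists>W\<in>\<C>. K \<subseteq> W"
      proof (rule scott_compact_directed[OF _ C(1) op \<open>K \<subseteq> \<Union>\<C>\<close>])
        show "scott_compact P K" using K[OF KK] by simp
        fix V W assume "V \<in> \<C>" "W \<in> \<C>"
        then have "V \<subseteq> W \<or> W \<subseteq> V" using C(2) unfolding subset.chain_def by blast
        then show "\<exists>T\<in>\<C>. V \<union> W \<subseteq> T" using \<open>V \<in> \<C>\<close> \<open>W \<in> \<C>\<close> by auto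
      qed
      then show False using CW KK by (auto simp: \<W>_def)
    qed
    moreover have "U \<subseteq> \<Union>\<C>" using C(1) CW by (auto simp: \<W>_def)
    ultimately show ?thesis using scott_open_Union[OF op] by (simp add: \<W>_def)
  qed
  ultimately obtain M where M: "M \<in> \<W>" and max: "\<And>W. W \<in> \<W> \<Longrightarrow> M \<subseteq> W \<Longrightarrow> W = M"
    using subset_Zorn_nonempty[of \<W>] by blast
  have Mo: "scott_open P M" and UM: "U \<subseteq> M" and KM: "\<And>K. K \<in> \<K> \<Longrightarrow> \<not> K \<subseteq> M" using M by (auto simp: \<W>_def)
  have big: "\<exists>K\<in>\<K>. K \<subseteq> M \<union> V" if V: "scott_open P V" "\<not> V \<subseteq> M" for V
  proof (rule ccontr)
    assume "\<not> ?thesis"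
    then have "M \<union> V \<in> \<W>" using scott_open_Un[OF Mo V(1)] UM by (auto simp: \<W>_def)
    from max[OF this] V(2) show False by blast
  qed
  have irr: "\<not> V \<inter> W \<subseteq> M" if VW: "scott_open P V" "scott_open P W" "\<not> V \<subseteq> M" "\<not> W \<subseteq> M" for V W
  proof
    assume s: "V \<inter> W \<subseteq> M"
    obtain K L where KL: "K \<in> \<K>" "L \<in> \<K>" "K \<subseteq> M \<union> V" "L \<subseteq> M \<union> W"
      using big[OF VW(1,3)] big[OF VW(2,4)] by blast
    obtain N where "N \<in> \<K>" "N \<subseteq> K \<inter> L" using filt[OF KL(1,2)] by blast
    then show False using KM[of N] KL s by blast
  qed
  define C where "C = car P - M"
  have Cc: "scott_closed P C"
    using Mo scott_open_sub[OF Mo] unfolding C_def scott_closed_def by (simp add: double_diff)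
  \<comment> \<open>The approximants of the points of \<open>C\<close>. Irreducibility of
    \<open>C\<close>, in the form \<open>irr\<close>, makes two sets \<open>wup P {y}\<close> that
    meet \<open>C\<close> meet it in a common point, which gives directedness. The supremum of
    \<open>D\<close> is the generator of \<open>C\<close>.\<close>
  define D where "D = {y. \<exists>c\<in>C. way_below P y c}"
  have Dmeet: "\<not> wup P {y} \<subseteq> M" if "y \<in> D" for y
    using that by (auto simp: D_def C_def wup_def)
  have D: "directed P D"
    unfolding directed_def
  proof (intro conjI ballI)
    show "D \<subseteq> car P" using wb_car[of P] by (auto simp: D_def)
    obtain K0 where "K0 \<in> \<K>" using ne by blast
    then obtain c where "c \<in> C" using KM[of K0] K[of K0] by (auto simp: C_def saturated_def)
    moreover then have "c \<in> car P" by (simp add: C_def)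
    then obtain y where "way_below P y c" using wb_exists[OF P] by blast
    ultimately show "D \<noteq> {}" unfolding D_def by blast
    fix y1 y2 assume "y1 \<in> D" "y2 \<in> D"
    from irr[OF scott_open_wup[OF P] scott_open_wup[OF P] Dmeet[OF this(1)] Dmeet[OF this(2)]]
    obtain c where c: "way_below P y1 c" "way_below P y2 c" "c \<notin> M" by (auto simp: wup_def)
    then have "c \<in> C" using wb_car[OF c(1)] by (simp add: C_def)
    with wb_directed[OF P c(1,2)] show "\<exists>z\<in>D. leq P y1 z \<and> leq P y2 z" by (auto simp: D_def)
  qed
  obtain s where s: "is_lub P D s" using domain_dcpo[OF P] D by (auto simp: dcpo_def)
  have DC: "D \<subseteq> C"
  proof
    fix y assume "y \<in> D"
    then obtain c where "c \<in> C" "way_below P y c" by (auto simp: D_def)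
    moreover then have "y \<in> car P" "leq P y c" using wb_car[of P y c] wb_leq[OF po] by auto
    ultimately show "y \<in> C" using scott_closed_down[OF Cc] by blast
  qed
  have sC: "s \<in> C" by (rule scott_closed_dir[OF Cc D s DC])
  have le: "leq P c s" if "c \<in> C" for c
  proof -
    have "c \<in> car P" using that by (simp add: C_def)
    from domainD(2)[OF P this] s that show ?thesis unfolding is_lub_def D_def by blast
  qed
  \<comment> \<open>No \<open>K\<close> fits into \<open>M\<close>, so each one contains a point of
    \<open>C\<close>; this point is below \<open>s\<close>, and saturation puts \<open>s\<close>
    into \<open>K\<close>. Then \<open>s\<close> lies in \<open>U\<close> and thus in
    \<open>M\<close>, contrary to \<open>s \<in> C\<close>.\<close>
  have "s \<in> K" if KK: "K \<in> \<K>" for K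
  proof -
    obtain c where "c \<in> K" "c \<in> C" using KM[OF KK] K[OF KK] by (auto simp: C_def saturated_def)
    then show ?thesis using le[of c] sC K[OF KK] by (auto simp: C_def saturated_def upper_def)
  qed
  then have "s \<in> M" using sub UM by blast
  then show False using sC by (simp add: C_def)
qed

section \<open>The domain of valuations\<close>


text \<open>The value on \<open>T\<close> of the simple valuation that gives each list entry the
  increment of \<open>m\<close> caused by adding it to the entries on its right. A repeated entry
  gets mass 0. The set \<open>T\<close> need not be open: it also ranges over sets of
  entries.\<close>

fun staircase :: "'a po \<Rightarrow> ('a set \<Rightarrow> real) \<Rightarrow> 'a list \<Rightarrow> 'a set \<Rightarrow> real" where
  "staircase X m [] T = 0"
| "staircase X m (x # xs) T = staircase X m xs T +
     (if x \<in> T then m (wup X (insert x (set xs))) - m (wup X (set xs)) else 0)"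

text \<open>Read from the right, each set meets a member \<open>U\<close> of \<open>\<U>\<close> only in points already covered,
  unless it is contained in \<open>U\<close>.\<close>
fun layered :: "'a set set \<Rightarrow> 'a set list \<Rightarrow> bool" where
  "layered \<U> [] = True"
| "layered \<U> (V # Vs) = (layered \<U> Vs \<and> (\<forall>U\<in>\<U>. V \<subseteq> U \<or> V \<inter> U \<subseteq> \<Union>(set Vs)))"

text \<open>Each layer \<open>V\<close> is preceded, in reading order from the right, by
  \<open>V \<inter> U\<close>. That part is contained in \<open>U\<close>, and afterwards
  \<open>V\<close> meets \<open>U\<close> only where it has just been covered. Conditions for older
  sets pass from \<open>V\<close> to \<open>V \<inter> U\<close>.\<close>

lemma layered_split:
  assumes "layered \<U> Vs"
  shows "layered (insert U \<U>) (concat (map (\<lambda>V. [V, V \<inter> U]) Vs)) \<and>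
    \<Union>(set (concat (map (\<lambda>V. [V, V \<inter> U]) Vs))) = \<Union>(set Vs)"
  using assms by (induction Vs) auto

lemma layered_exists:
  assumes "finite \<U>" "\<And>U. U \<in> \<U> \<Longrightarrow> scott_open P U"
  shows "\<exists>Vs. layered \<U> Vs \<and> (\<forall>V\<in>set Vs. scott_open P V) \<and> \<Union>\<U> \<subseteq> \<Union>(set Vs)"
  using assms
proof (induction \<U>)
  case empty
  show ?case by (intro exI[of _ "[]"]) simp
next
  case (insert U \<U>)
  then obtain Vs where Vs: "layered \<U> Vs" "\<forall>V\<in>set Vs. scott_open P V" "\<Union>\<U> \<subseteq> \<Union>(set Vs)" by auto
  define Ws where "Ws = concat (map (\<lambda>V. [V, V \<inter> U]) Vs)"
  have W: "layered (insert U \<U>) Ws" "\<Union>(set Ws) = \<Union>(set Vs)"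
    using layered_split[OF Vs(1), of U] by (simp_all add: Ws_def)
  \<comment> \<open>The new set comes last in reading order: it is contained in itself, and it meets
    the older sets only inside their union, which \<open>Ws\<close> covers.\<close>
  have "layered (insert U \<U>) (U # Ws)" using W Vs(3) by auto
  moreover have "\<forall>V\<in>set (U # Ws). scott_open P V"
    using Vs(2) insert.prems by (auto simp: Ws_def intro: scott_open_Int)
  moreover have "\<Union>(insert U \<U>) \<subseteq> \<Union>(set (U # Ws))" using W Vs(3) by auto
  ultimately show ?case by blast
qed

text \<open>Real values allow increments to be formed. The continuity of a valuation is present as
  \<open>m_inner\<close>, approximation from inside by finite sets.\<close>

locale bounded_modular =
  fixes X :: "'a po" and m :: "'a set \<Rightarrow> real"
  assumes dom: "domain X"
    and m_empty: "m {} = 0"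
    and m_mono: "scott_open X U \<Longrightarrow> scott_open X V \<Longrightarrow> U \<subseteq> V \<Longrightarrow> m U \<le> m V"
    and m_mod: "scott_open X U \<Longrightarrow> scott_open X V \<Longrightarrow> m U + m V = m (U \<union> V) + m (U \<inter> V)"
    and m_inner: "scott_open X U \<Longrightarrow> \<epsilon> > 0 \<Longrightarrow> \<exists>F. finite F \<and> F \<subseteq> U \<and> m U - \<epsilon> < m (wup X F)"
begin

lemma open_wup [simp]: "scott_open X (wup X F)"
  by (rule scott_open_wup[OF dom])

lemma wup_sub: "scott_open X U \<Longrightarrow> F \<subseteq> U \<Longrightarrow> wup X F \<subseteq> U"
  using wup_subset_upper[OF domain_poset[OF dom], of F] upper_subset_open[of X U F] by blast

text \<open>Diminishing returns: by modularity the gain from adding \<open>A\<close> to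
  \<open>B\<close> is the value of \<open>A\<close> minus that of \<open>A \<inter> B\<close>, which
  decreases as \<open>B\<close> grows.\<close>

lemma submodular_step:
  assumes "scott_open X A" "scott_open X B" "scott_open X C" "C \<subseteq> B"
  shows "m (A \<union> B) - m B \<le> m (A \<union> C) - m C"
proof -
  have "A \<inter> C \<subseteq> A \<inter> B" using assms(4) by blast
  from m_mono[OF scott_open_Int[OF assms(1,3)] scott_open_Int[OF assms(1,2)] this]
  show ?thesis using m_mod[OF assms(1,2)] m_mod[OF assms(1,3)] by linarith
qed

lemma staircase_append_ge: "staircase X m xs T \<le> staircase X m (ys @ xs) T"
proof (induction ys)
  case (Cons y ys)
  have "m (wup X (set (ys @ xs))) \<le> m (wup X (insert y (set (ys @ xs))))"
    by (intro m_mono open_wup wup_mono) auto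
  then have "staircase X m (ys @ xs) T \<le> staircase X m ((y # ys) @ xs) T"
    unfolding append_Cons staircase.simps by (cases "y \<in> T") simp_all
  with Cons.IH show ?case by (rule order_trans)
qed simp

lemma staircase_nonneg: "0 \<le> staircase X m xs T"
  using staircase_append_ge[of "[]" T xs] by simp

text \<open>Dropping the entries outside \<open>T\<close> can only enlarge the increments of the
  others, by \<open>submodular_step\<close>; the enlarged increments telescope to the value on the
  right.\<close>

lemma staircase_le: "staircase X m xs T \<le> m (wup X (set xs \<inter> T))"
proof (induction xs)
  case (Cons x xs)
  show ?case
  proof (cases "x \<in> T")
    case True
    have "m (wup X {x} \<union> wup X (set xs)) - m (wup X (set xs))
       \<le> m (wup X {x} \<union> wup X (set xs \<inter> T)) - m (wup X (set xs \<inter> T))"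
      by (rule submodular_step) (simp_all add: wup_mono)
    then show ?thesis using Cons True
      by (simp add: wup_insert[of X x "set xs"] wup_insert[of X x "set xs \<inter> T"])
  qed (use Cons in simp)
qed (simp add: m_empty)

text \<open>All new entries lie in \<open>T\<close>, so their increments telescope.\<close>

lemma staircase_append_in:
  "set ys \<subseteq> T \<Longrightarrow> staircase X m (ys @ xs) T =
     staircase X m xs T + m (wup X (set ys \<union> set xs)) - m (wup X (set xs))"
  by (induction ys) auto

lemma staircase_cong: "set xs \<inter> T = set xs \<inter> T' \<Longrightarrow> staircase X m xs T = staircase X m xs T'"
proof (induction xs)
  case (Cons x xs)
  then have "x \<in> T \<longleftrightarrow> x \<in> T'" "set xs \<inter> T = set xs \<inter> T'" by auto
  then show ?case using Cons.IH by simp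
qed simp

text \<open>Each layer is approximated by a finite set of new entries. If the layer lies in
  \<open>U\<close>, the staircase on \<open>U\<close> receives the whole new increment; otherwise
  the layer adds nothing to the covered part of \<open>U\<close>, so the old estimate persists. The
  bound on the union is carried along because the first case spends it.\<close>

lemma layered_approx:
  assumes "layered \<U> Vs" "\<forall>V\<in>set Vs. scott_open X V" "\<forall>U\<in>\<U>. scott_open X U" "\<epsilon> > 0"
  shows "\<exists>xs. set xs \<subseteq> \<Union>(set Vs) \<and> m (\<Union>(set Vs)) - m (wup X (set xs)) < \<epsilon> \<and>
     (\<forall>U\<in>\<U>. m (\<Union>(set Vs) \<inter> U) - staircase X m xs U < \<epsilon>)"
  using assms
proof (induction Vs arbitrary: \<epsilon>)
  case Nil
  then show ?case by (intro exI[of _ "[]"]) (simp add: m_empty)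
next
  case (Cons V Vs)
  define W where "W = \<Union>(set Vs)"
  have Wo: "scott_open X W" unfolding W_def using Cons.prems(2) by (intro scott_open_Union) auto
  have Vo: "scott_open X V" using Cons.prems(2) by simp
  \<comment> \<open>Error budget: the old union and the new layer lose \<open>\<epsilon>/4\<close>
    each, so the new union loses less than \<open>\<epsilon>/2\<close>. Together with the old
    staircase error this makes less than three quarters of \<open>\<epsilon>\<close>.\<close>
  have "\<exists>xs. set xs \<subseteq> \<Union>(set Vs) \<and> m (\<Union>(set Vs)) - m (wup X (set xs)) < \<epsilon>/4 \<and>
     (\<forall>U\<in>\<U>. m (\<Union>(set Vs) \<inter> U) - staircase X m xs U < \<epsilon>/4)"
    by (rule Cons.IH) (use Cons.prems in auto)
  then obtain xs where xs: "set xs \<subseteq> W" "m W - m (wup X (set xs)) < \<epsilon>/4"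
     "\<And>U. U \<in> \<U> \<Longrightarrow> m (W \<inter> U) - staircase X m xs U < \<epsilon>/4" unfolding W_def by blast
  have e: "\<epsilon>/4 > 0" using Cons.prems by simp
  from m_inner[OF Vo e] obtain F where F: "finite F" "F \<subseteq> V" "m V - \<epsilon>/4 < m (wup X F)" by blast
  obtain ys where ys: "set ys = F" using finite_list[OF F(1)] by blast
  let ?G = "wup X (set xs)" and ?H = "wup X F"
  have GW: "?G \<subseteq> W" by (rule wup_sub[OF Wo xs(1)])
  have HV: "?H \<subseteq> V" by (rule wup_sub[OF Vo F(2)])
  have G': "wup X (set (ys @ xs)) = ?G \<union> ?H" by (simp add: ys wup_Un Un_commute)
  have modGH: "m ?G + m ?H = m (?G \<union> ?H) + m (?G \<inter> ?H)" by (rule m_mod) simp_all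
  have modWV: "m W + m V = m (W \<union> V) + m (W \<inter> V)" by (rule m_mod[OF Wo Vo])
  have "m (?G \<inter> ?H) \<le> m (W \<inter> V)"
    by (intro m_mono scott_open_Int Wo Vo open_wup) (use GW HV in blast)
  then have loss: "m (W \<union> V) - m (?G \<union> ?H) < \<epsilon>/2" using modGH modWV xs(2) F(3) by linarith
  have mGW: "m ?G \<le> m W" by (rule m_mono[OF open_wup Wo GW])
  have "m ((W \<union> V) \<inter> U) - staircase X m (ys @ xs) U < \<epsilon>" if U: "U \<in> \<U>" for U
  proof -
    have Uo: "scott_open X U" using Cons.prems U by blast
    consider "V \<subseteq> U" | "V \<inter> U \<subseteq> W" using Cons.prems(1) U by (auto simp: W_def)
    then show ?thesis
    proof cases
      case 1
      then have eq: "(W \<union> V) \<inter> U = (W \<inter> U) \<union> V" "(W \<inter> U) \<inter> V = W \<inter> V" by auto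
      have "m (W \<inter> U) + m V = m ((W \<union> V) \<inter> U) + m (W \<inter> V)"
        unfolding eq(1) using m_mod[OF scott_open_Int[OF Wo Uo] Vo] eq(2) by simp
      moreover have "set ys \<subseteq> U" using ys F(2) 1 by blast
      then have "staircase X m (ys @ xs) U = staircase X m xs U + m (?G \<union> ?H) - m ?G"
        using staircase_append_in[of ys U xs] by (simp add: ys wup_Un Un_commute)
      ultimately show ?thesis using modWV loss mGW xs(3)[OF U] e by linarith
    next
      case 2
      then have "(W \<union> V) \<inter> U = W \<inter> U" by auto
      then have "m ((W \<union> V) \<inter> U) = m (W \<inter> U)" by simp
      then show ?thesis using xs(3)[OF U] staircase_append_ge[of xs U ys] e by linarith
    qed
  qed
  moreover have "\<Union>(set (V # Vs)) = W \<union> V" by (auto simp: W_def)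
  moreover have "set (ys @ xs) \<subseteq> W \<union> V" using ys F(2) xs(1) by auto
  moreover have "m (W \<union> V) - m (wup X (set (ys @ xs))) < \<epsilon>" using loss e unfolding G' by linarith
  ultimately show ?case by (intro exI[of _ "ys @ xs"]) simp
qed

lemma staircase_approx:
  assumes fin: "finite \<U>" and op: "\<And>U. U \<in> \<U> \<Longrightarrow> scott_open X U" and e: "\<epsilon> > 0"
  shows "\<exists>xs. \<forall>U\<in>\<U>. m U - staircase X m xs U < \<epsilon>"
proof -
  have "\<exists>Vs. layered \<U> Vs \<and> (\<forall>V\<in>set Vs. scott_open X V) \<and> \<Union>\<U> \<subseteq> \<Union>(set Vs)"
    by (rule layered_exists[OF fin op])
  then obtain Vs where Vs: "layered \<U> Vs" "\<forall>V\<in>set Vs. scott_open X V" "\<Union>\<U> \<subseteq> \<Union>(set Vs)"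
    by (elim exE conjE)
  have o: "\<forall>U\<in>\<U>. scott_open X U" using op by simp
  obtain xs where xs: "\<forall>U\<in>\<U>. m (\<Union>(set Vs) \<inter> U) - staircase X m xs U < \<epsilon>"
    using layered_approx[OF Vs(1,2) o e] by (elim exE conjE)
  have "m U - staircase X m xs U < \<epsilon>" if U: "U \<in> \<U>" for U
  proof -
    have "U \<subseteq> \<Union>(set Vs)" using U Vs(3) by (meson Union_upper subset_trans)
    then have eq: "\<Union>(set Vs) \<inter> U = U" by (rule Int_absorb1)
    from bspec[OF xs U] show ?thesis unfolding eq .
  qed
  then show ?thesis by (intro exI[of _ xs] ballI)
qed

text \<open>Each entry contributes a nonnegative multiple of a Dirac valuation, its increment being
  nonnegative by monotonicity. The factor \<open>c\<close> is chosen below 1 later to make room for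
  strict inequalities.\<close>

lemma is_valuation_staircase:
  assumes "c \<ge> 0"
  shows "is_valuation X (\<lambda>U. if scott_open X U then ennreal (c * staircase X m xs U) else 0)"
proof (induction xs)
  case Nil
  have "(\<lambda>U. if scott_open X U then ennreal (c * staircase X m [] U) else 0) = (\<lambda>U. 0)" by auto
  then show ?case by (simp only: is_valuation_0)
next
  case (Cons x xs)
  let ?d = "m (wup X (insert x (set xs))) - m (wup X (set xs))"
  have d: "?d \<ge> 0" using m_mono[OF open_wup open_wup wup_mono, of "set xs" "insert x (set xs)"] by auto
  have "(if scott_open X U then ennreal (c * staircase X m (x # xs) U) else 0) =
     (if scott_open X U then ennreal (c * staircase X m xs U) else 0) + ennreal (c * ?d) * dirac X x U" for U
  proof -
    have "ennreal (c * staircase X m xs U + c * ?d) = ennreal (c * staircase X m xs U) + ennreal (c * ?d)"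
      using assms d staircase_nonneg[of xs U] by (intro ennreal_plus) simp_all
    then show ?thesis
      by (cases "scott_open X U"; cases "x \<in> U") (simp_all add: dirac_def distrib_left)
  qed
  then show ?case
    by (simp only: is_valuation_add[OF Cons is_valuation_scale[OF is_valuation_dirac]])
qed

end

text \<open>For finite \<open>N\<close> with open first components these conditions describe the
  basic open sets of the weak topology, generated by the strict lower bounds on values at open
  sets.\<close>

definition weak_nbhd :: "('a set \<times> ennreal) set \<Rightarrow> 'a val \<Rightarrow> bool" where
  "weak_nbhd N \<mu> \<longleftrightarrow> (\<forall>p\<in>N. snd p < \<mu> (fst p))"

text \<open>The principal filter of \<open>\<sigma>\<close> is a weak neighbourhood of
  \<open>\<mu>\<close>. The relation implies being way below, and it also compares the Scott
  topology with the weak one.\<close>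

definition weak_below :: "'a po \<Rightarrow> 'a val \<Rightarrow> 'a val \<Rightarrow> bool" where
  "weak_below X \<sigma> \<mu> \<longleftrightarrow> \<sigma> \<in> car (Vpo X) \<and> \<mu> \<in> car (Vpo X) \<and>
     (\<exists>N. finite N \<and> (\<forall>p\<in>N. scott_open X (fst p)) \<and> weak_nbhd N \<mu> \<and>
        (\<forall>\<nu>\<in>car (Vpo X). weak_nbhd N \<nu> \<longrightarrow> leq (Vpo X) \<sigma> \<nu>))"

lemma weak_nbhd_mono:
  assumes "\<forall>p\<in>N. scott_open X (fst p)" "weak_nbhd N \<mu>" "leq (Vpo X) \<mu> \<nu>"
  shows "weak_nbhd N \<nu>"
  using assms unfolding weak_nbhd_def leq_Vpo by (meson less_le_trans)

lemma weak_nbhd_directed: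
  assumes D: "directed (Vpo X) D" and N: "finite N" "\<forall>p\<in>N. scott_open X (fst p)"
    and s: "weak_nbhd N (\<lambda>U. SUP \<mu>\<in>D. \<mu> U)"
  shows "\<exists>\<mu>\<in>D. weak_nbhd N \<mu>"
  using N s
proof (induction N)
  case empty
  then show ?case using D by (auto simp: directed_def weak_nbhd_def)
next
  case (insert p N)
  then obtain \<mu> where m: "\<mu> \<in> D" "weak_nbhd N \<mu>" by (auto simp: weak_nbhd_def)
  from insert.prems(2) have "snd p < (SUP \<mu>\<in>D. \<mu> (fst p))" by (simp add: weak_nbhd_def)
  then obtain \<nu> where n: "\<nu> \<in> D" "snd p < \<nu> (fst p)" by (auto simp: less_SUP_iff)
  obtain \<kappa> where k: "\<kappa> \<in> D" "leq (Vpo X) \<mu> \<kappa>" "leq (Vpo X) \<nu> \<kappa>"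
    using D m(1) n(1) unfolding directed_def by blast
  have "weak_nbhd N \<kappa>" using weak_nbhd_mono[OF _ m(2) k(2)] insert.prems(1) by auto
  moreover have "snd p < \<kappa> (fst p)" using n(2) k(3) insert.prems(1) by (auto simp: leq_Vpo intro: less_le_trans)
  ultimately show ?case using k(1) by (auto simp: weak_nbhd_def)
qed

text \<open>Finitely many strict lower bounds on a directed supremum already hold at one member of
  the directed set.\<close>

lemma weak_below_way_below:
  assumes "weak_below X \<sigma> \<mu>"
  shows "way_below (Vpo X) \<sigma> \<mu>"
  unfolding way_below_def
proof (intro conjI allI impI)
  show "\<sigma> \<in> car (Vpo X)" "\<mu> \<in> car (Vpo X)" using assms by (auto simp: weak_below_def)
  obtain N where N: "finite N" "\<forall>p\<in>N. scott_open X (fst p)" "weak_nbhd N \<mu>"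
    and le: "\<And>\<nu>. \<nu> \<in> car (Vpo X) \<Longrightarrow> weak_nbhd N \<nu> \<Longrightarrow> leq (Vpo X) \<sigma> \<nu>"
    using assms by (auto simp: weak_below_def)
  fix D s assume D: "directed (Vpo X) D" "is_lub (Vpo X) D s" "leq (Vpo X) \<mu> s"
  have "weak_nbhd N s" by (rule weak_nbhd_mono[OF N(2,3) D(3)])
  moreover have "s = (\<lambda>U. SUP \<mu>\<in>D. \<mu> U)" using D by (simp add: is_lub_Vpo_iff)
  ultimately obtain \<nu> where n: "\<nu> \<in> D" "weak_nbhd N \<nu>" using weak_nbhd_directed[OF D(1) N(1,2)] by auto
  moreover have "\<nu> \<in> car (Vpo X)" using n D(1) by (auto simp: directed_def)
  ultimately show "\<exists>d\<in>D. leq (Vpo X) \<sigma> d" using le by blast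
qed

text \<open>\<open>U\<close> is the directed union of these sets, since every point of
  \<open>U\<close> has an element of \<open>U\<close> way below it.\<close>

lemma val_SUP_wup:
  assumes dX: "domain X" and m: "is_valuation X \<mu>" and U: "scott_open X U"
  shows "\<mu> U = (SUP F\<in>{F. finite F \<and> F \<subseteq> U}. \<mu> (wup X F))"
proof -
  let ?\<F> = "wup X ` {F. finite F \<and> F \<subseteq> U}"
  have "\<Union>?\<F> = U"
  proof (intro subset_antisym subsetI)
    fix y assume "y \<in> \<Union>?\<F>"
    then obtain F where F: "F \<subseteq> U" "y \<in> wup X F" by auto
    then show "y \<in> U"
      using upper_subset_open[OF U F(1)] wup_subset_upper[OF domain_poset[OF dX], of F] by blast
  next
    fix y assume "y \<in> U"
    then obtain x where "x \<in> U" "way_below X x y" using open_wb[OF dX U] by blast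
    then have "finite {x} \<and> {x} \<subseteq> U" "y \<in> wup X {x}" by (auto simp: wup_def)
    then show "y \<in> \<Union>?\<F>" by blast
  qed
  moreover have "\<mu> (\<Union>?\<F>) = (SUP V\<in>?\<F>. \<mu> V)"
  proof (rule val_Union[OF m])
    have "{} \<in> {F. finite F \<and> F \<subseteq> U}" by simp
    then show "?\<F> \<noteq> {}" by blast
    show "scott_open X V" if "V \<in> ?\<F>" for V using that scott_open_wup[OF dX] by auto
    fix A B assume "A \<in> ?\<F>" "B \<in> ?\<F>"
    then obtain F G where "finite F" "F \<subseteq> U" "A = wup X F" "finite G" "G \<subseteq> U" "B = wup X G" by auto
    then have "A \<union> B \<subseteq> wup X (F \<union> G)" "F \<union> G \<in> {F. finite F \<and> F \<subseteq> U}" by (simp_all add: wup_Un)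
    then show "\<exists>W\<in>?\<F>. A \<union> B \<subseteq> W" by blast
  qed
  ultimately show ?thesis by (simp add: image_image)
qed

lemma bounded_modular_enn2real:
  assumes dX: "domain X" and m: "is_valuation X \<mu>" and fin: "\<mu> (car X) < \<infinity>"
  shows "bounded_modular X (\<lambda>U. enn2real (\<mu> U))" and "\<And>U. \<mu> U = ennreal (enn2real (\<mu> U))"
proof -
  have "\<mu> U < \<infinity>" for U
  proof (cases "scott_open X U")
    case True
    then have "\<mu> U \<le> \<mu> (car X)" by (intro val_mono[OF m]) (auto dest: scott_open_sub)
    then show ?thesis using fin by simp
  qed (simp add: val_nonopen[OF m])
  then show e: "\<mu> U = ennreal (enn2real (\<mu> U))" for U by (simp add: top.not_eq_extremum)
  show "bounded_modular X (\<lambda>U. enn2real (\<mu> U))"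
  proof
    show "domain X" "enn2real (\<mu> {}) = 0" using dX val_empty[OF m] by auto
    fix U assume U: "scott_open X U"
    show "enn2real (\<mu> U) \<le> enn2real (\<mu> V)" if "scott_open X V" "U \<subseteq> V" for V
      using val_mono[OF m U that] e[of U] e[of V] by (metis enn2real_nonneg ennreal_le_iff)
    show "enn2real (\<mu> U) + enn2real (\<mu> V) = enn2real (\<mu> (U \<union> V)) + enn2real (\<mu> (U \<inter> V))" if "scott_open X V" for V
    proof -
      have "ennreal (enn2real (\<mu> U) + enn2real (\<mu> V)) = ennreal (enn2real (\<mu> (U \<union> V)) + enn2real (\<mu> (U \<inter> V)))"
        using val_mod[OF m U that] by (simp flip: e)
      then show ?thesis by (simp del: ennreal_plus)
    qed
    fix \<epsilon> :: real assume eps: "\<epsilon> > 0"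
    show "\<exists>F. finite F \<and> F \<subseteq> U \<and> enn2real (\<mu> U) - \<epsilon> < enn2real (\<mu> (wup X F))"
    \<comment> \<open>A negative bound would be truncated to 0 by \<open>ennreal\<close> and the
      strict inequality could fail; the empty set settles that case.\<close>
    proof (cases "enn2real (\<mu> U) - \<epsilon> < 0")
      case True
      then show ?thesis using val_empty[OF m] by (intro exI[of _ "{}"]) simp
    next
      case False
      have "ennreal (enn2real (\<mu> U) - \<epsilon>) < ennreal (enn2real (\<mu> U))" using False eps by (intro ennreal_lessI) auto
      also have "\<dots> = \<mu> U" by (rule e[symmetric])
      also have "\<dots> = (SUP F\<in>{F. finite F \<and> F \<subseteq> U}. \<mu> (wup X F))" by (rule val_SUP_wup[OF dX m U])
      finally have "ennreal (enn2real (\<mu> U) - \<epsilon>) < (SUP F\<in>{F. finite F \<and> F \<subseteq> U}. \<mu> (wup X F))" .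
      then obtain F where F: "finite F" "F \<subseteq> U" "ennreal (enn2real (\<mu> U) - \<epsilon>) < \<mu> (wup X F)" by (auto simp: less_SUP_iff)
      then have "ennreal (enn2real (\<mu> U) - \<epsilon>) < ennreal (enn2real (\<mu> (wup X F)))" by (simp flip: e)
      then have "enn2real (\<mu> U) - \<epsilon> < enn2real (\<mu> (wup X F))" using False by (simp add: ennreal_less_iff)
      with F show ?thesis by blast
    qed
  qed
qed

text \<open>The strict inequalities in \<open>N\<close> are used twice: part of the margin pays for
  replacing \<open>m\<close> by a staircase, the rest for scaling by some \<open>c < 1\<close>. The
  scaling makes the values of \<open>\<sigma>\<close> strictly smaller than those of
  \<open>\<mu>\<close> on finitely many sets, which yields the required weak neighbourhood.\<close>

lemma weak_below_approx_bounded: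
  assumes dX: "domain X" and m: "is_valuation X \<mu>" and fin: "\<mu> (car X) < \<infinity>"
    and N: "finite N" "\<forall>p\<in>N. scott_open X (fst p)" "weak_nbhd N \<mu>"
  shows "\<exists>\<sigma>. weak_below X \<sigma> \<mu> \<and> weak_nbhd N \<sigma>"
proof -
  define m where "m = (\<lambda>U. enn2real (\<mu> U))"
  interpret bounded_modular X m unfolding m_def by (rule bounded_modular_enn2real[OF dX m fin])
  have mu: "\<mu> U = ennreal (m U)" for U unfolding m_def by (rule bounded_modular_enn2real(2)[OF dX m fin])
  have m0: "m U \<ge> 0" for U by (simp add: m_def)
  define r where "r p = enn2real (snd p)" for p :: "'a set \<times> ennreal"
  have rp: "snd p = ennreal (r p)" "r p < m (fst p)" "r p \<ge> 0" if "p \<in> N" for p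
  proof -
    have l: "snd p < ennreal (m (fst p))" using N(3) that by (simp add: weak_nbhd_def mu)
    have "snd p < top" by (rule less_le_trans[OF l top_greatest])
    then show 1: "snd p = ennreal (r p)" by (simp add: r_def top.not_eq_extremum)
    show 2: "r p \<ge> 0" by (simp add: r_def)
    show "r p < m (fst p)" using l 2 unfolding 1 by (simp add: ennreal_less_iff)
  qed
  \<comment> \<open>Finitely many strict inequalities have a common positive margin, extracted as an
    eventual property near 0; the factor \<open>c\<close> is found in the same way near 1.\<close>
  have "\<forall>\<^sub>F \<delta> in at_right 0. \<forall>p\<in>N. r p < m (fst p) - \<delta>"
  proof (rule eventually_ball_finite[OF N(1)], rule ballI)
    fix p assume "p \<in> N"
    have "((\<lambda>\<delta>. m (fst p) - \<delta>) \<longlongrightarrow> m (fst p) - 0) (at_right 0)" by (intro tendsto_intros)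
    then show "\<forall>\<^sub>F \<delta> in at_right 0. r p < m (fst p) - \<delta>"
      using rp(2)[OF \<open>p \<in> N\<close>] by (intro order_tendstoD(1)) auto
  qed
  moreover have "\<forall>\<^sub>F \<delta> in at_right (0::real). 0 < \<delta>" by (rule eventually_at_right_less)
  ultimately have "\<exists>\<delta>. (\<forall>p\<in>N. r p < m (fst p) - \<delta>) \<and> 0 < \<delta>"
    by (intro eventually_happens'[OF trivial_limit_at_right_real] eventually_conj)
  then obtain \<delta> where d: "\<delta> > 0" "\<And>p. p \<in> N \<Longrightarrow> r p < m (fst p) - \<delta>" by blast
  have fN: "finite (fst ` N)" "\<And>U. U \<in> fst ` N \<Longrightarrow> scott_open X U" using N by auto
  obtain xs where xs: "\<forall>U\<in>fst ` N. m U - staircase X m xs U < \<delta>" using staircase_approx[OF fN d(1)] by blast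
  then have s: "r p < staircase X m xs (fst p)" if "p \<in> N" for p using d(2)[OF that] that by fastforce
  have "\<forall>\<^sub>F c in at_left 1. \<forall>p\<in>N. r p < c * staircase X m xs (fst p)"
  proof (rule eventually_ball_finite[OF N(1)], rule ballI)
    fix p assume "p \<in> N"
    have "((\<lambda>c. c * staircase X m xs (fst p)) \<longlongrightarrow> 1 * staircase X m xs (fst p)) (at_left 1)" by (intro tendsto_intros)
    then show "\<forall>\<^sub>F c in at_left 1. r p < c * staircase X m xs (fst p)"
      using s[OF \<open>p \<in> N\<close>] by (intro order_tendstoD(1)) auto
  qed
  moreover have "\<forall>\<^sub>F c in at_left 1. c \<in> {0<..<1::real}" by (rule eventually_at_left_real) simp
  ultimately have "\<exists>c. (\<forall>p\<in>N. r p < c * staircase X m xs (fst p)) \<and> c \<in> {0<..<1}"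
    by (intro eventually_happens'[OF trivial_limit_at_left_real] eventually_conj)
  then obtain c where c: "0 < c" "c < 1" "\<And>p. p \<in> N \<Longrightarrow> r p < c * staircase X m xs (fst p)"
    unfolding greaterThanLessThan_iff by blast
  define \<sigma> where "\<sigma> = (\<lambda>U. if scott_open X U then ennreal (c * staircase X m xs U) else 0)"
  have sv: "is_valuation X \<sigma>" unfolding \<sigma>_def using c by (intro is_valuation_staircase) simp
  have "weak_nbhd N \<sigma>"
    unfolding weak_nbhd_def
  proof
    fix p assume p: "p \<in> N"
    show "snd p < \<sigma> (fst p)"
      using rp[OF p] c(3)[OF p] N(2) p by (simp add: \<sigma>_def ennreal_lessI)
  qed
  moreover have "weak_below X \<sigma> \<mu>"
    unfolding weak_below_def
  proof (intro conjI exI ballI impI)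
    show "\<sigma> \<in> car (Vpo X)" "\<mu> \<in> car (Vpo X)" using sv m by (auto simp: car_Vpo)
    \<comment> \<open>\<open>\<sigma> U\<close> depends only on the entries lying in
      \<open>U\<close>, so finitely many conditions suffice: the one for
      \<open>T = set xs \<inter> U\<close> bounds \<open>\<sigma> U\<close> by the value at
      \<open>wup X T\<close>, a subset of \<open>U\<close>. Sets \<open>T\<close> of staircase value
      0 are left out, because the strict inequality could fail there for
      \<open>\<mu>\<close>.\<close>
    let ?M = "(\<lambda>T. (wup X T, ennreal (c * staircase X m xs T))) ` {T. T \<subseteq> set xs \<and> staircase X m xs T > 0}"
    show "finite ?M" by (rule finite_imageI, rule finite_subset[of _ "Pow (set xs)"]) auto
    show "scott_open X (fst p)" if "p \<in> ?M" for p using that by auto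
    show "weak_nbhd ?M \<mu>"
      unfolding weak_nbhd_def
    proof
      fix p assume "p \<in> ?M"
      then obtain T where T: "T \<subseteq> set xs" "staircase X m xs T > 0" "p = (wup X T, ennreal (c * staircase X m xs T))" by auto
      have "set xs \<inter> T = T" using T(1) by (rule Int_absorb1)
      with staircase_le[of xs T] have "staircase X m xs T \<le> m (wup X T)" by (simp only:)
      moreover have "c * staircase X m xs T < staircase X m xs T" using c T by simp
      ultimately have "c * staircase X m xs T < m (wup X T)" by linarith
      moreover have "0 < c * staircase X m xs T" using c T by simp
      ultimately have "ennreal (c * staircase X m xs T) < ennreal (m (wup X T))"
        by (intro ennreal_lessI) linarith+
      then show "snd p < \<mu> (fst p)" by (simp add: T(3) mu)
    qed
    fix \<nu> assume n: "\<nu> \<in> car (Vpo X)" "weak_nbhd ?M \<nu>"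
    then have nv: "is_valuation X \<nu>" by (simp add: car_Vpo)
    show "leq (Vpo X) \<sigma> \<nu>"
      unfolding leq_Vpo
    proof (intro allI impI)
      fix U assume U: "scott_open X U"
      let ?T = "set xs \<inter> U"
      have eq: "staircase X m xs U = staircase X m xs ?T" by (rule staircase_cong) auto
      show "\<sigma> U \<le> \<nu> U"
      proof (cases "staircase X m xs ?T > 0")
        case True
        then have "(wup X ?T, ennreal (c * staircase X m xs ?T)) \<in> ?M" by auto
        with n(2) have "ennreal (c * staircase X m xs ?T) < \<nu> (wup X ?T)" unfolding weak_nbhd_def by fastforce
        also have "\<dots> \<le> \<nu> U" by (intro val_mono[OF nv] open_wup U wup_sub) auto
        finally show ?thesis using U by (simp add: \<sigma>_def eq)
      next
        case False
        then have "staircase X m xs ?T = 0" using staircase_nonneg[of xs ?T] by linarith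
        then show ?thesis using U by (simp add: \<sigma>_def eq)
      qed
    qed
  qed
  ultimately show ?thesis by blast
qed

lemma is_valuation_restrict:
  assumes m: "is_valuation X \<mu>" and W: "scott_open X W"
  shows "is_valuation X (\<lambda>U. if scott_open X U then \<mu> (U \<inter> W) else 0)"
proof (rule is_valuationI)
  fix U V assume UV: "scott_open X U" "scott_open X V"
  show "(if scott_open X U then \<mu> (U \<inter> W) else 0) \<le> (if scott_open X V then \<mu> (V \<inter> W) else 0)" if "U \<subseteq> V"
    using UV that W by (auto intro!: val_mono[OF m] scott_open_Int)
  have "\<mu> (U \<inter> W) + \<mu> (V \<inter> W) = \<mu> ((U \<inter> W) \<union> (V \<inter> W)) + \<mu> ((U \<inter> W) \<inter> (V \<inter> W))"
    by (intro val_mod[OF m] scott_open_Int UV W)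
  moreover have "(U \<inter> W) \<union> (V \<inter> W) = (U \<union> V) \<inter> W" "(U \<inter> W) \<inter> (V \<inter> W) = (U \<inter> V) \<inter> W" by auto
  ultimately show "(if scott_open X U then \<mu> (U \<inter> W) else 0) + (if scott_open X V then \<mu> (V \<inter> W) else 0) =
    (if scott_open X (U \<union> V) then \<mu> ((U \<union> V) \<inter> W) else 0) + (if scott_open X (U \<inter> V) then \<mu> (U \<inter> V \<inter> W) else 0)"
    using UV by (simp add: scott_open_Un scott_open_Int)
next
  fix \<D> assume D: "\<D> \<noteq> {}" "\<And>U. U \<in> \<D> \<Longrightarrow> scott_open X U" "\<And>U V. U \<in> \<D> \<Longrightarrow> V \<in> \<D> \<Longrightarrow> \<exists>W\<in>\<D>. U \<union> V \<subseteq> W"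
  have o: "scott_open X (\<Union>\<D>)" using D(2) by (rule scott_open_Union)
  have "\<Union>\<D> \<inter> W = \<Union>((\<lambda>U. U \<inter> W) ` \<D>)" by auto
  moreover have "\<mu> (\<Union>((\<lambda>U. U \<inter> W) ` \<D>)) = (SUP U\<in>(\<lambda>U. U \<inter> W) ` \<D>. \<mu> U)"
  proof (rule val_Union[OF m])
    show "(\<lambda>U. U \<inter> W) ` \<D> \<noteq> {}" using D(1) by simp
    show "scott_open X U" if "U \<in> (\<lambda>U. U \<inter> W) ` \<D>" for U using that D(2) W by (auto intro: scott_open_Int)
    fix A B assume "A \<in> (\<lambda>U. U \<inter> W) ` \<D>" "B \<in> (\<lambda>U. U \<inter> W) ` \<D>"
    then obtain U V where UV: "U \<in> \<D>" "V \<in> \<D>" "A = U \<inter> W" "B = V \<inter> W" by auto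
    then obtain T where "T \<in> \<D>" "U \<union> V \<subseteq> T" using D(3) by blast
    then show "\<exists>T\<in>(\<lambda>U. U \<inter> W) ` \<D>. A \<union> B \<subseteq> T" using UV by (intro bexI[of _ "T \<inter> W"]) auto
  qed
  ultimately show "(if scott_open X (\<Union>\<D>) then \<mu> (\<Union>\<D> \<inter> W) else 0) \<le> (SUP U\<in>\<D>. if scott_open X U then \<mu> (U \<inter> W) else 0)"
    using o D(2) by (auto simp: image_image intro!: SUP_mono)
qed (simp_all add: val_empty[OF m])

lemma val_finite_Union:
  assumes m: "is_valuation X \<mu>" and "finite \<V>" "\<And>V. V \<in> \<V> \<Longrightarrow> scott_open X V \<and> \<mu> V < \<infinity>"
  shows "\<mu> (\<Union>\<V>) < \<infinity>"
  using assms(2,3)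
proof (induction \<V>)
  case (insert V \<V>)
  have o: "scott_open X V" "scott_open X (\<Union>\<V>)" using insert.prems by (auto intro!: scott_open_Union)
  have "\<mu> (V \<union> \<Union>\<V>) \<le> \<mu> V + \<mu> (\<Union>\<V>)" unfolding val_mod[OF m o] by simp
  also have "\<dots> < \<infinity>" using insert by simp
  finally show ?case by simp
qed (simp add: val_empty[OF m])

text \<open>Let \<open>W\<close> be the union of all open sets of finite measure. On \<open>W\<close> the valuation is a directed
  supremum of bounded restrictions; an open set not contained in \<open>W\<close> has infinite measure, so
  arbitrarily large point masses outside \<open>W\<close> may be added.\<close>
lemma bounded_approx:
  assumes m: "is_valuation X \<mu>" and N: "finite N" "\<forall>p\<in>N. scott_open X (fst p)" "weak_nbhd N \<mu>"
  shows "\<exists>\<mu>'. is_valuation X \<mu>' \<and> \<mu>' (car X) < \<infinity> \<and> leq (Vpo X) \<mu>' \<mu> \<and> weak_nbhd N \<mu>'"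
proof -
  define \<F> where "\<F> = {V. scott_open X V \<and> \<mu> V < \<infinity>}"
  define W where "W = \<Union>\<F>"
  define N1 where "N1 = {p\<in>N. fst p \<subseteq> W}"
  define N2 where "N2 = {p\<in>N. \<not> fst p \<subseteq> W}"
  have "\<exists>V\<in>\<F>. snd p < \<mu> (fst p \<inter> V)" if p: "p \<in> N1" for p
  proof -
    have po: "scott_open X (fst p)" "fst p \<subseteq> W" "snd p < \<mu> (fst p)"
      using p N by (auto simp: N1_def weak_nbhd_def)
    let ?D = "(\<lambda>V. fst p \<inter> V) ` \<F>"
    have "\<Union>?D = fst p" using po(2) by (auto simp: W_def)
    moreover have "\<mu> (\<Union>?D) = (SUP V\<in>?D. \<mu> V)"
    proof (rule val_Union[OF m])
      have "{} \<in> \<F>" by (simp add: \<F>_def val_empty[OF m])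
      then show "?D \<noteq> {}" by blast
      show "scott_open X V" if "V \<in> ?D" for V using that po(1) by (auto simp: \<F>_def intro: scott_open_Int)
      fix A B assume "A \<in> ?D" "B \<in> ?D"
      then obtain U V where UV: "U \<in> \<F>" "V \<in> \<F>" "A = fst p \<inter> U" "B = fst p \<inter> V" by auto
      have "\<mu> (\<Union>{U, V}) < \<infinity>" by (rule val_finite_Union[OF m]) (use UV in \<open>auto simp: \<F>_def\<close>)
      then have "U \<union> V \<in> \<F>" using UV by (simp add: \<F>_def scott_open_Un)
      then show "\<exists>T\<in>?D. A \<union> B \<subseteq> T" using UV by (intro bexI[of _ "fst p \<inter> (U \<union> V)"]) auto
    qed
    ultimately have "snd p < (SUP V\<in>?D. \<mu> V)" using po(3) by simp
    then show ?thesis by (auto simp: less_SUP_iff)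
  qed
  then obtain V where V: "\<And>p. p \<in> N1 \<Longrightarrow> V p \<in> \<F> \<and> snd p < \<mu> (fst p \<inter> V p)" by metis
  have "\<exists>x. x \<in> fst p - W" if "p \<in> N2" for p using that by (auto simp: N2_def)
  then obtain x where x: "\<And>p. p \<in> N2 \<Longrightarrow> x p \<in> fst p - W" by metis
  have fin: "finite N1" "finite N2" using N(1) by (auto simp: N1_def N2_def)
  define O' where "O' = \<Union>(V ` N1)"
  have O': "scott_open X O'" "\<mu> O' < \<infinity>"
  proof -
    have *: "scott_open X U \<and> \<mu> U < \<infinity>" if "U \<in> V ` N1" for U using that V by (auto simp: \<F>_def)
    then show "scott_open X O'" unfolding O'_def by (intro scott_open_Union) blast
    show "\<mu> O' < \<infinity>" unfolding O'_def by (rule val_finite_Union[OF m finite_imageI[OF fin(1)] *])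
  qed
  \<comment> \<open>One weight for all point masses. The thresholds are below values of
    \<open>\<mu>\<close>, hence finite, and the summand 1 puts \<open>t\<close> strictly above each
    of them.\<close>
  define t where "t = 1 + (\<Sum>p\<in>N2. enn2real (snd p))"
  have t: "snd p < ennreal t" if p: "p \<in> N2" for p
  proof -
    have "snd p < \<mu> (fst p)" using p N by (auto simp: N2_def weak_nbhd_def)
    then have "snd p < top" using top_greatest by (rule less_le_trans)
    then have e: "snd p = ennreal (enn2real (snd p))" by simp
    have "enn2real (snd p) \<le> (\<Sum>p\<in>N2. enn2real (snd p))" by (rule member_le_sum) (use p fin in auto)
    then have "enn2real (snd p) < t" by (simp add: t_def)
    then show ?thesis by (subst e) (intro ennreal_lessI, auto simp: t_def add_pos_nonneg sum_nonneg)
  qed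
  define \<mu>' where "\<mu>' = (\<lambda>U. (if scott_open X U then \<mu> (U \<inter> O') else 0) + (\<Sum>p\<in>N2. ennreal t * dirac X (x p) U))"
  have "is_valuation X \<mu>'"
    unfolding \<mu>'_def
    by (intro is_valuation_add is_valuation_restrict m O' is_valuation_sum is_valuation_scale is_valuation_dirac)
  moreover have "\<mu>' (car X) < \<infinity>"
  proof -
    have "car X \<inter> O' = O'" using scott_open_sub[OF O'(1)] by blast
    then have "\<mu> (car X \<inter> O') < \<infinity>" using O'(2) by simp
    moreover have "(\<Sum>p\<in>N2. ennreal t * dirac X (x p) (car X)) < \<infinity>"
      using fin by (auto simp: dirac_def ennreal_mult_less_top)
    ultimately show ?thesis by (simp add: \<mu>'_def)
  qed
  moreover have "leq (Vpo X) \<mu>' \<mu>"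
    unfolding leq_Vpo
  proof (intro allI impI)
    fix U assume U: "scott_open X U"
    show "\<mu>' U \<le> \<mu> U"
    proof (cases "\<exists>p\<in>N2. x p \<in> U")
      case True
      then have "U \<notin> \<F>" using x by (auto simp: W_def)
      then have "\<mu> U = \<infinity>" using U by (simp add: \<F>_def flip: top.not_eq_extremum)
      then show ?thesis by simp
    next
      case False
      then have "(\<Sum>p\<in>N2. ennreal t * dirac X (x p) U) = 0" by (intro sum.neutral) (auto simp: dirac_def)
      moreover have "\<mu> (U \<inter> O') \<le> \<mu> U" by (intro val_mono[OF m] scott_open_Int U O') auto
      ultimately show ?thesis using U by (simp add: \<mu>'_def)
    qed
  qed
  moreover have "weak_nbhd N \<mu>'"
    unfolding weak_nbhd_def
  proof
    fix p assume p: "p \<in> N"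
    have po: "scott_open X (fst p)" using N p by blast
    show "snd p < \<mu>' (fst p)"
    proof (cases "p \<in> N1")
      case True
      have "snd p < \<mu> (fst p \<inter> V p)" using V True by blast
      also have "\<dots> \<le> \<mu> (fst p \<inter> O')"
        using True V[OF True] po O'(1) by (intro val_mono[OF m] scott_open_Int) (auto simp: O'_def \<F>_def)
      also have "\<dots> \<le> \<mu>' (fst p)" using po by (simp add: \<mu>'_def)
      finally show ?thesis .
    next
      case False
      then have p2: "p \<in> N2" using p by (simp add: N1_def N2_def)
      have "snd p < ennreal t" by (rule t[OF p2])
      also have "\<dots> = ennreal t * dirac X (x p) (fst p)" using x[OF p2] po by (simp add: dirac_def)
      also have "\<dots> \<le> (\<Sum>p'\<in>N2. ennreal t * dirac X (x p') (fst p))" using fin p2 by (intro member_le_sum) auto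
      also have "\<dots> \<le> \<mu>' (fst p)" by (simp add: \<mu>'_def)
      finally show ?thesis .
    qed
  qed
  ultimately show ?thesis by blast
qed

lemma weak_below_approx:
  assumes dX: "domain X" and m: "\<mu> \<in> car (Vpo X)"
    and N: "finite N" "\<forall>p\<in>N. scott_open X (fst p)" "weak_nbhd N \<mu>"
  shows "\<exists>\<sigma>. weak_below X \<sigma> \<mu> \<and> weak_nbhd N \<sigma>"
proof -
  have "is_valuation X \<mu>" using m by (simp add: car_Vpo)
  from bounded_approx[OF this N] obtain \<mu>' where m': "is_valuation X \<mu>'" "\<mu>' (car X) < \<infinity>"
    "leq (Vpo X) \<mu>' \<mu>" "weak_nbhd N \<mu>'" by blast
  obtain \<sigma> where s: "weak_below X \<sigma> \<mu>'" "weak_nbhd N \<sigma>"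
    using weak_below_approx_bounded[OF dX m'(1,2) N(1,2) m'(4)] by blast
  from s(1) obtain M where "finite M" "\<forall>p\<in>M. scott_open X (fst p)" "weak_nbhd M \<mu>'" "\<sigma> \<in> car (Vpo X)"
        "\<forall>\<nu>\<in>car (Vpo X). weak_nbhd M \<nu> \<longrightarrow> leq (Vpo X) \<sigma> \<nu>" by (auto simp: weak_below_def)
  moreover then have "weak_nbhd M \<mu>" using weak_nbhd_mono[OF _ _ m'(3)] by blast
  ultimately have "weak_below X \<sigma> \<mu>" using m unfolding weak_below_def by blast
  with s(2) show ?thesis by blast
qed

text \<open>Two simple valuations are dominated jointly by approximating \<open>\<mu>\<close> inside
  the union of their witnessing conditions. For the supremum, one condition \<open>(U, r)\<close>
  with \<open>r < \<mu> U\<close> at a time is enough.\<close>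

lemma weak_below_basis:
  assumes dX: "domain X" and m: "\<mu> \<in> car (Vpo X)"
  shows "directed (Vpo X) {\<sigma>. weak_below X \<sigma> \<mu>}" "is_lub (Vpo X) {\<sigma>. weak_below X \<sigma> \<mu>} \<mu>"
proof -
  let ?B = "{\<sigma>. weak_below X \<sigma> \<mu>}"
  show D: "directed (Vpo X) ?B"
    unfolding directed_def
  proof (intro conjI ballI)
    show "?B \<subseteq> car (Vpo X)" by (auto simp: weak_below_def)
    have "weak_nbhd {} \<mu>" by (simp add: weak_nbhd_def)
    from weak_below_approx[OF dX m _ _ this] show "?B \<noteq> {}" by auto
    fix \<sigma> \<tau> assume "\<sigma> \<in> ?B" "\<tau> \<in> ?B"
    then obtain M N where M: "finite M" "\<forall>p\<in>M. scott_open X (fst p)" "weak_nbhd M \<mu>"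
        "\<And>\<nu>. \<nu> \<in> car (Vpo X) \<Longrightarrow> weak_nbhd M \<nu> \<Longrightarrow> leq (Vpo X) \<sigma> \<nu>"
      and N: "finite N" "\<forall>p\<in>N. scott_open X (fst p)" "weak_nbhd N \<mu>"
        "\<And>\<nu>. \<nu> \<in> car (Vpo X) \<Longrightarrow> weak_nbhd N \<nu> \<Longrightarrow> leq (Vpo X) \<tau> \<nu>"
      by (auto simp: weak_below_def)
    have MN: "finite (M \<union> N)" "\<forall>p\<in>M \<union> N. scott_open X (fst p)" "weak_nbhd (M \<union> N) \<mu>"
      using M(1-3) N(1-3) unfolding weak_nbhd_def by blast+
    obtain \<kappa> where k: "weak_below X \<kappa> \<mu>" "weak_nbhd (M \<union> N) \<kappa>"
      using weak_below_approx[OF dX m MN] by blast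
    then have "\<kappa> \<in> car (Vpo X)" "weak_nbhd M \<kappa>" "weak_nbhd N \<kappa>" by (auto simp: weak_below_def weak_nbhd_def)
    then show "\<exists>z\<in>?B. leq (Vpo X) \<sigma> z \<and> leq (Vpo X) \<tau> z" using M(4) N(4) k(1) by blast
  qed
  have le: "leq (Vpo X) \<sigma> \<mu>" if "\<sigma> \<in> ?B" for \<sigma>
    using wb_leq[OF poset_Vpo weak_below_way_below] that by blast
  show "is_lub (Vpo X) ?B \<mu>"
    unfolding is_lub_def
  proof (intro conjI ballI impI m le)
    fix u assume u: "u \<in> car (Vpo X)" "\<forall>\<sigma>\<in>?B. leq (Vpo X) \<sigma> u"
    show "leq (Vpo X) \<mu> u"
      unfolding leq_Vpo
    proof (intro allI impI, rule dense_le)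
      fix U r assume U: "scott_open X U" and r: "r < \<mu> U"
      have "\<exists>\<sigma>. weak_below X \<sigma> \<mu> \<and> weak_nbhd {(U, r)} \<sigma>"
        by (rule weak_below_approx[OF dX m]) (use U r in \<open>auto simp: weak_nbhd_def\<close>)
      then obtain \<sigma> where s: "weak_below X \<sigma> \<mu>" "r < \<sigma> U" by (auto simp: weak_nbhd_def)
      then have "\<sigma> U \<le> u U" using u(2) U by (auto simp: leq_Vpo)
      then show "r \<le> u U" using s(2) by simp
    qed
  qed
qed

lemma domain_Vpo:
  assumes dX: "domain X" shows "domain (Vpo X)"
proof (rule domain_basisI[OF dcpo_Vpo])
  fix \<mu> assume "\<mu> \<in> car (Vpo X)"
  from weak_below_basis[OF dX this] weak_below_way_below[of X]
  show "\<exists>B. directed (Vpo X) B \<and> is_lub (Vpo X) B \<mu> \<and> (\<forall>b\<in>B. way_below (Vpo X) b \<mu>)" by auto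
qed

text \<open>Scott-open sets of valuations are weakly open: an approximant of \<open>\<mu>\<close>
  already lies in \<open>W\<close>, and its principal filter is a weak neighbourhood. Openness can
  then be tested on finitely many values.\<close>

lemma scott_open_Vpo_weak:
  assumes dX: "domain X" and W: "scott_open (Vpo X) W" and m: "\<mu> \<in> W"
  shows "\<exists>N. finite N \<and> (\<forall>p\<in>N. scott_open X (fst p)) \<and> weak_nbhd N \<mu> \<and>
     (\<forall>\<nu>\<in>car (Vpo X). weak_nbhd N \<nu> \<longrightarrow> \<nu> \<in> W)"
proof -
  have mc: "\<mu> \<in> car (Vpo X)" using scott_open_sub[OF W] m by blast
  from scott_open_dir[OF W weak_below_basis[OF dX mc] m]
  obtain \<sigma> where s: "weak_below X \<sigma> \<mu>" "\<sigma> \<in> W" by blast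
  then obtain N where "finite N" "\<forall>p\<in>N. scott_open X (fst p)" "weak_nbhd N \<mu>"
     "\<forall>\<nu>\<in>car (Vpo X). weak_nbhd N \<nu> \<longrightarrow> leq (Vpo X) \<sigma> \<nu>" by (auto simp: weak_below_def)
  then show ?thesis using scott_open_up[OF W s(2)] by blast
qed

section \<open>Lawson compactness of the domain of valuations\<close>


text \<open>Plays the role of a way-below relation between open sets. A finitely generated upper set
  between \<open>V\<close> and \<open>U\<close> makes it stable under unions and, given
  \<open>meet_compact\<close>, under intersections.\<close>

definition fin_inside :: "'a po \<Rightarrow> 'a set \<Rightarrow> 'a set \<Rightarrow> bool" where
  "fin_inside X V U \<longleftrightarrow> scott_open X V \<and> (\<exists>F. finite F \<and> F \<subseteq> U \<and> V \<subseteq> upper X F)"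

text \<open>Collects the conditions on a valuation that are closed under pointwise limits, so
  continuity is dropped. Values on other nonempty sets are left free, which keeps this a closed
  subset of a full product.\<close>

definition premodular :: "'a po \<Rightarrow> 'a val set" where
  "premodular X = {l. l {} = 0 \<and> (\<forall>U V. scott_open X U \<and> scott_open X V \<and> U \<subseteq> V \<longrightarrow> l U \<le> l V) \<and>
     (\<forall>U V. scott_open X U \<and> scott_open X V \<longrightarrow> l U + l V = l (U \<union> V) + l (U \<inter> V))}"

text \<open>Restores continuity from below and resets the values on non-open sets to 0.\<close>

definition regularize :: "'a po \<Rightarrow> 'a val \<Rightarrow> 'a val" where
  "regularize X l = (\<lambda>U. if scott_open X U then SUP V\<in>{V. fin_inside X V U}. l V else 0)"

lemma fin_inside_open: "fin_inside X V U \<Longrightarrow> scott_open X V"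
  by (simp add: fin_inside_def)

lemma fin_inside_sub: "scott_open X U \<Longrightarrow> fin_inside X V U \<Longrightarrow> V \<subseteq> U"
  using upper_subset_open[of X U] unfolding fin_inside_def by (elim conjE exE) (meson subset_trans)

lemma fin_inside_mono: "fin_inside X V U \<Longrightarrow> scott_open X V' \<Longrightarrow> V' \<subseteq> V \<Longrightarrow> U \<subseteq> U' \<Longrightarrow> fin_inside X V' U'"
  unfolding fin_inside_def by (meson subset_trans)

lemma fin_inside_empty: "fin_inside X {} U"
  unfolding fin_inside_def by (intro conjI exI[of _ "{}"]) simp_all

lemma upper_Un: "upper X (F \<union> G) = upper X F \<union> upper X G"
  by (auto simp: upper_def)

lemma fin_inside_Un:
  assumes "fin_inside X V U" "fin_inside X V' U'"
  shows "fin_inside X (V \<union> V') (U \<union> U')"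
proof -
  obtain F G where "finite F" "F \<subseteq> U" "V \<subseteq> upper X F" "finite G" "G \<subseteq> U'" "V' \<subseteq> upper X G"
    using assms by (auto simp: fin_inside_def)
  then have "finite (F \<union> G) \<and> F \<union> G \<subseteq> U \<union> U' \<and> V \<union> V' \<subseteq> upper X (F \<union> G)"
    by (auto simp: upper_Un)
  then show ?thesis using assms scott_open_Un[of X V V'] unfolding fin_inside_def by blast
qed

lemma fin_inside_wup: "domain X \<Longrightarrow> finite F \<Longrightarrow> F \<subseteq> U \<Longrightarrow> fin_inside X (wup X F) U"
  unfolding fin_inside_def using scott_open_wup[of X F] wup_subset_upper[OF domain_poset[of X], of F] by blast

text \<open>Two finitely generated upper sets may meet in a set that is not finitely generated. By
  \<open>meet_compact\<close> the intersection is compact, and a finite set can be interpolated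
  between it and the open set \<open>U \<inter> U'\<close>.\<close>

lemma fin_inside_Int:
  assumes X: "domain X" "meet_compact X" and U: "scott_open X U" "scott_open X U'"
    and V: "fin_inside X V U" "fin_inside X V' U'"
  shows "fin_inside X (V \<inter> V') (U \<inter> U')"
proof -
  obtain F G where F: "finite F" "F \<subseteq> U" "V \<subseteq> upper X F" and G: "finite G" "G \<subseteq> U'" "V' \<subseteq> upper X G"
    using V by (auto simp: fin_inside_def)
  have c: "F \<subseteq> car X" "G \<subseteq> car X"
    using F(2) G(2) scott_open_sub[OF U(1)] scott_open_sub[OF U(2)] by auto
  have K: "scott_compact X (upper X F \<inter> upper X G)"
    by (rule meet_compact_finite[OF domain_poset[OF X(1)] X(2) F(1) G(1) c])
  have "upper X F \<inter> upper X G \<subseteq> U \<inter> U'"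
    using upper_subset_open[OF U(1) F(2)] upper_subset_open[OF U(2) G(2)] by blast
  from compact_finite_wup[OF X(1) K scott_open_Int[OF U] this]
  obtain H where H: "H \<subseteq> U \<inter> U'" "finite H" "upper X F \<inter> upper X G \<subseteq> wup X H" by blast
  show ?thesis
    by (rule fin_inside_mono[OF fin_inside_wup[OF X(1) H(2,1)]])
      (use F(3) G(3) H(3) V in \<open>auto intro!: scott_open_Int dest: fin_inside_open\<close>)
qed

lemma finite_set_compact: "finite F \<Longrightarrow> F \<subseteq> car P \<Longrightarrow> scott_compact P F"
  by (simp add: scott_compact_iff finite_imp_compactin)

text \<open>The finite generating set is compact, so it already lies in one member of the directed
  family.\<close>

lemma fin_inside_Union:
  assumes V: "fin_inside X V (\<Union>\<D>)" and D: "\<D> \<noteq> {}" "\<And>U. U \<in> \<D> \<Longrightarrow> scott_open X U"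
    "\<And>U V. U \<in> \<D> \<Longrightarrow> V \<in> \<D> \<Longrightarrow> \<exists>W\<in>\<D>. U \<union> V \<subseteq> W"
  shows "\<exists>U\<in>\<D>. fin_inside X V U"
proof -
  obtain F where F: "finite F" "F \<subseteq> \<Union>\<D>" "V \<subseteq> upper X F" using V by (auto simp: fin_inside_def)
  have "\<Union>\<D> \<subseteq> car X" using D(2) by (meson Sup_least scott_open_sub)
  then have "F \<subseteq> car X" using F(2) by (rule subset_trans[rotated])
  from scott_compact_directed[OF finite_set_compact[OF F(1) this] D(1,2) F(2) D(3)]
  obtain U where "U \<in> \<D>" "F \<subseteq> U" by (rule bexE)
  then show ?thesis using F V unfolding fin_inside_def by blast
qed

lemma fin_inside_interpolate:
  assumes X: "domain X" and U: "scott_open X U" and F: "finite F" "F \<subseteq> U"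
  shows "\<exists>V. fin_inside X V U \<and> upper X F \<subseteq> V"
proof -
  have "F \<subseteq> car X" using F(2) scott_open_sub[OF U] by blast
  from compact_finite_wup[OF X finite_set_compact[OF F(1) this] U F(2)]
  obtain G where G: "G \<subseteq> U" "finite G" "F \<subseteq> wup X G" by blast
  have "upper X F \<subseteq> wup X G" by (rule upper_subset_open[OF scott_open_wup[OF X] G(3)])
  then show ?thesis using fin_inside_wup[OF X G(2,1)] by blast
qed

text \<open>The generators are sorted according to the open set containing them, and interpolation
  thickens each of the two groups to an open set.\<close>

lemma fin_inside_Un_split:
  assumes X: "domain X" and U: "scott_open X U" "scott_open X U'" and W: "fin_inside X W (U \<union> U')"
  shows "\<exists>V V'. fin_inside X V U \<and> fin_inside X V' U' \<and> W \<subseteq> V \<union> V'"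
proof -
  obtain F where F: "finite F" "F \<subseteq> U \<union> U'" "W \<subseteq> upper X F" using W by (auto simp: fin_inside_def)
  obtain V where V: "fin_inside X V U" "upper X (F \<inter> U) \<subseteq> V"
    using fin_inside_interpolate[OF X U(1), of "F \<inter> U"] F(1) by auto
  obtain V' where V': "fin_inside X V' U'" "upper X (F \<inter> U') \<subseteq> V'"
    using fin_inside_interpolate[OF X U(2), of "F \<inter> U'"] F(1) by auto
  have "F = (F \<inter> U) \<union> (F \<inter> U')" using F(2) by blast
  then have "upper X F = upper X (F \<inter> U) \<union> upper X (F \<inter> U')" using upper_Un[of X "F \<inter> U" "F \<inter> U'"] by simp
  then have "W \<subseteq> V \<union> V'" using F(3) V(2) V'(2) by blast
  then show ?thesis using V(1) V'(1) by blast
qed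

lemma premodularD:
  assumes "l \<in> premodular X"
  shows "l {} = 0" "scott_open X U \<Longrightarrow> scott_open X V \<Longrightarrow> U \<subseteq> V \<Longrightarrow> l U \<le> l V"
    "scott_open X U \<Longrightarrow> scott_open X V \<Longrightarrow> l U + l V = l (U \<union> V) + l (U \<inter> V)"
  using assms by (auto simp: premodular_def)

lemma regularize_ge: "scott_open X U \<Longrightarrow> fin_inside X V U \<Longrightarrow> l V \<le> regularize X l U"
  unfolding regularize_def by (auto intro: SUP_upper)

lemma regularize_le: "l \<in> premodular X \<Longrightarrow> scott_open X U \<Longrightarrow> regularize X l U \<le> l U"
  unfolding regularize_def
  by (auto intro!: SUP_least premodularD(2) dest: fin_inside_open fin_inside_sub)

lemma SUP_add_SUP_le:
  fixes f g :: "_ \<Rightarrow> ennreal"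
  assumes "A \<noteq> {}" "B \<noteq> {}" "\<And>x y. x \<in> A \<Longrightarrow> y \<in> B \<Longrightarrow> f x + g y \<le> c"
  shows "(SUP x\<in>A. f x) + (SUP y\<in>B. g y) \<le> c"
proof -
  have "(SUP x\<in>A. f x) + (SUP y\<in>B. g y) = (SUP x\<in>A. f x + (SUP y\<in>B. g y))"
    by (rule ennreal_SUP_add_left[OF assms(1), symmetric])
  also have "\<dots> \<le> c"
  proof (rule SUP_least)
    fix x assume "x \<in> A"
    have "f x + (SUP y\<in>B. g y) = (SUP y\<in>B. f x + g y)" by (rule ennreal_SUP_add_right[OF assms(2)])
    also have "\<dots> \<le> c" by (rule SUP_least) (rule assms(3)[OF \<open>x \<in> A\<close>])
    finally show "f x + (SUP y\<in>B. g y) \<le> c" .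
  qed
  finally show ?thesis .
qed

text \<open>The two inequalities of modularity have different sources: one combines inner sets by
  union and intersection, needing \<open>fin_inside_Int\<close>; the other splits an inner set of
  the union. Continuity is \<open>fin_inside_Union\<close>.\<close>

lemma is_valuation_regularize:
  assumes X: "domain X" "meet_compact X" and l: "l \<in> premodular X"
  shows "is_valuation X (regularize X l)"
proof (rule is_valuationI)
  let ?I = "\<lambda>U. {V. fin_inside X V U}"
  have ne: "?I U \<noteq> {}" for U using fin_inside_empty[of X U] by blast
  have reg: "regularize X l U = (SUP V\<in>?I U. l V)" if "scott_open X U" for U using that by (simp add: regularize_def)
  show "regularize X l U = 0" if "\<not> scott_open X U" for U using that by (simp add: regularize_def)
  have "regularize X l {} \<le> l {}" by (rule regularize_le[OF l]) simp
  then show "regularize X l {} = 0" by (simp add: premodularD(1)[OF l])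
  show "regularize X l U \<le> regularize X l V" if UV: "scott_open X U" "scott_open X V" "U \<subseteq> V" for U V
    unfolding reg[OF UV(1)]
  proof (rule SUP_least)
    fix W assume "W \<in> ?I U"
    then have "fin_inside X W V" using fin_inside_mono[of X W U W V] UV(3) fin_inside_open[of X W U] by simp
    then show "l W \<le> regularize X l V" by (rule regularize_ge[OF UV(2)])
  qed
  show "regularize X l U + regularize X l U' = regularize X l (U \<union> U') + regularize X l (U \<inter> U')"
    if U: "scott_open X U" "scott_open X U'" for U U'
  proof (rule antisym)
    note o = scott_open_Un[OF U] scott_open_Int[OF U]
    show "regularize X l U + regularize X l U' \<le> regularize X l (U \<union> U') + regularize X l (U \<inter> U')"
      unfolding reg[OF U(1)] reg[OF U(2)]
    proof (rule SUP_add_SUP_le[OF ne ne])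
      fix V V' assume "V \<in> ?I U" "V' \<in> ?I U'"
      then have V: "fin_inside X V U" "fin_inside X V' U'" by auto
      have "l V + l V' = l (V \<union> V') + l (V \<inter> V')"
        by (rule premodularD(3)[OF l fin_inside_open[OF V(1)] fin_inside_open[OF V(2)]])
      also have "\<dots> \<le> regularize X l (U \<union> U') + regularize X l (U \<inter> U')"
        by (intro add_mono regularize_ge o fin_inside_Un fin_inside_Int X U V)
      finally show "l V + l V' \<le> regularize X l (U \<union> U') + regularize X l (U \<inter> U')" .
    qed
    show "regularize X l (U \<union> U') + regularize X l (U \<inter> U') \<le> regularize X l U + regularize X l U'"
      unfolding reg[OF o(1)] reg[OF o(2)]
    proof (rule SUP_add_SUP_le[OF ne ne])
      fix W Z assume "W \<in> ?I (U \<union> U')" "Z \<in> ?I (U \<inter> U')"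
      then have W: "fin_inside X W (U \<union> U')" and Z: "fin_inside X Z (U \<inter> U')" by auto
      obtain V V' where V: "fin_inside X V U" "fin_inside X V' U'" "W \<subseteq> V \<union> V'"
        using fin_inside_Un_split[OF X(1) U W] by blast
      have Zo: "scott_open X Z" by (rule fin_inside_open[OF Z])
      have "fin_inside X Z U" "fin_inside X Z U'"
        using fin_inside_mono[OF Z Zo order_refl] by blast+
      \<comment> \<open>Adding \<open>Z\<close> to both pieces puts it into their intersection while
        their union still covers \<open>W\<close>, so modularity of \<open>l\<close> applies to the
        enlarged pieces.\<close>
      then have VZ: "fin_inside X (V \<union> Z) U" "fin_inside X (V' \<union> Z) U'"
        using fin_inside_Un[OF V(1), of Z U] fin_inside_Un[OF V(2), of Z U'] by simp_all
      note oo = fin_inside_open[OF VZ(1)] fin_inside_open[OF VZ(2)]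
      have "l W + l Z \<le> l ((V \<union> Z) \<union> (V' \<union> Z)) + l ((V \<union> Z) \<inter> (V' \<union> Z))"
        by (intro add_mono premodularD(2)[OF l] fin_inside_open[OF W] Zo scott_open_Un[OF oo] scott_open_Int[OF oo])
          (use V(3) in auto)
      also have "\<dots> = l (V \<union> Z) + l (V' \<union> Z)" by (rule premodularD(3)[OF l oo, symmetric])
      also have "\<dots> \<le> regularize X l U + regularize X l U'"
        by (intro add_mono regularize_ge U VZ)
      finally show "l W + l Z \<le> regularize X l U + regularize X l U'" .
    qed
  qed
  show "regularize X l (\<Union>\<D>) \<le> (SUP U\<in>\<D>. regularize X l U)"
    if D: "\<D> \<noteq> {}" "\<And>U. U \<in> \<D> \<Longrightarrow> scott_open X U" "\<And>U V. U \<in> \<D> \<Longrightarrow> V \<in> \<D> \<Longrightarrow> \<exists>W\<in>\<D>. U \<union> V \<subseteq> W" for \<D>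
  proof -
    have "scott_open X (\<Union>\<D>)" using D(2) by (rule scott_open_Union)
    then have "regularize X l (\<Union>\<D>) = (SUP V\<in>?I (\<Union>\<D>). l V)" by (rule reg)
    also have "\<dots> \<le> (SUP U\<in>\<D>. regularize X l U)"
    proof (rule SUP_least)
      fix V assume "V \<in> ?I (\<Union>\<D>)"
      then have "fin_inside X V (\<Union>\<D>)" by simp
      from fin_inside_Union[OF this D] obtain U where U: "U \<in> \<D>" "fin_inside X V U" by (rule bexE)
      have "l V \<le> regularize X l U" by (rule regularize_ge[OF D(2)[OF U(1)] U(2)])
      also have "\<dots> \<le> (SUP U\<in>\<D>. regularize X l U)" by (rule SUP_upper[OF U(1)])
      finally show "l V \<le> (SUP U\<in>\<D>. regularize X l U)" .
    qed
    finally show ?thesis .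
  qed
qed

lemma val_premodular: "is_valuation X \<mu> \<Longrightarrow> \<mu> \<in> premodular X"
  unfolding premodular_def using val_empty[of X \<mu>] val_mono[of X \<mu>] val_mod[of X \<mu>] by simp

lemma regularize_val:
  assumes X: "domain X" and m: "is_valuation X \<mu>"
  shows "regularize X \<mu> = \<mu>"
proof
  fix U
  show "regularize X \<mu> U = \<mu> U"
  proof (cases "scott_open X U")
    case True
    have "\<mu> U \<le> regularize X \<mu> U"
      unfolding val_SUP_wup[OF X m True]
      by (rule SUP_least) (use regularize_ge[OF True] fin_inside_wup[OF X] in auto)
    then show ?thesis using regularize_le[OF val_premodular[OF m] True] by (rule antisym[rotated])
  qed (simp add: regularize_def val_nonopen[OF m])
qed

text \<open>Tychonoff for a power of the compact space \<open>ennreal\<close>. The defining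
  conditions are closed since coordinates are continuous and addition on \<open>ennreal\<close> is
  continuous also at infinity.\<close>

lemma compact_premodular: "compact (premodular X)"
proof -
  have c: "continuous_on UNIV (\<lambda>l. l U)" for U and l :: "'a set \<Rightarrow> ennreal" by simp
  have "closed {l :: 'a val. l U \<le> l V}" for U V
    by (intro closed_Collect_le) simp_all
  moreover have "closed {l :: 'a val. l U + l V = l (U \<union> V) + l (U \<inter> V)}" for U V
    by (intro closed_Collect_eq continuous_on_add_ennreal) simp_all
  moreover have "closed {l :: 'a val. l {} = 0}" by (intro closed_Collect_eq) simp_all
  ultimately have cl: "closed (premodular X)"
    unfolding premodular_def by (intro closed_Collect_conj closed_Collect_all closed_Collect_imp) simp_all
  have "compact_space (product_topology (\<lambda>i. euclidean :: ennreal topology) (UNIV :: 'a set set))"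
    unfolding compact_space_product_topology
    using compact_UNIV[where 'a=ennreal] by (simp add: compact_space_def)
  then have "compact (UNIV :: 'a val set)"
    unfolding euclidean_product_topology compact_space_def by simp
  from compact_Int_closed[OF this cl] show ?thesis by simp
qed

text \<open>A strict lower bound on \<open>regularize X l U\<close> is witnessed by a single inner
  set \<open>V\<close>, hence by an open condition on one coordinate of \<open>l\<close>; a
  Scott-open set requires finitely many such bounds.\<close>

lemma openin_regularize_preimage:
  assumes X: "domain X" "meet_compact X" and W: "scott_open (Vpo X) W"
  shows "openin (top_of_set (premodular X)) {l \<in> premodular X. regularize X l \<in> W}"
proof (subst openin_subopen, intro ballI)
  fix l assume l: "l \<in> {l \<in> premodular X. regularize X l \<in> W}"
  from scott_open_Vpo_weak[OF X(1) W, of "regularize X l"] l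
  obtain N where N: "finite N" "\<forall>p\<in>N. scott_open X (fst p)" "weak_nbhd N (regularize X l)"
    and NW: "\<And>\<nu>. \<nu> \<in> car (Vpo X) \<Longrightarrow> weak_nbhd N \<nu> \<Longrightarrow> \<nu> \<in> W" by auto
  have "\<exists>V. fin_inside X V (fst p) \<and> snd p < l V" if p: "p \<in> N" for p
  proof -
    have "snd p < regularize X l (fst p)" using N(3) p by (simp add: weak_nbhd_def)
    then show ?thesis using N(2) p by (auto simp: regularize_def less_SUP_iff)
  qed
  then obtain V where V: "\<And>p. p \<in> N \<Longrightarrow> fin_inside X (V p) (fst p) \<and> snd p < l (V p)" by metis
  let ?T = "\<Inter>p\<in>N. {l' :: 'a val. snd p < l' (V p)}"
  have "open ?T" using N(1) by (intro open_INT ballI open_Collect_less) simp_all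
  then have "openin (top_of_set (premodular X)) (premodular X \<inter> ?T)" by (rule openin_open_Int)
  moreover have "l \<in> premodular X \<inter> ?T" using l V by auto
  moreover have "premodular X \<inter> ?T \<subseteq> {l \<in> premodular X. regularize X l \<in> W}"
  proof
    fix k assume k: "k \<in> premodular X \<inter> ?T"
    have "weak_nbhd N (regularize X k)"
      unfolding weak_nbhd_def
    proof
      fix p assume p: "p \<in> N"
      have "snd p < k (V p)" using k p by simp
      also have "\<dots> \<le> regularize X k (fst p)" using V[OF p] N(2) p by (intro regularize_ge) auto
      finally show "snd p < regularize X k (fst p)" .
    qed
    moreover have "regularize X k \<in> car (Vpo X)"
      using is_valuation_regularize[OF X, of k] k by (simp add: car_Vpo)
    ultimately show "k \<in> {l \<in> premodular X. regularize X l \<in> W}" using NW k by simp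
  qed
  ultimately show "\<exists>T. openin (top_of_set (premodular X)) T \<and> l \<in> T \<and> T \<subseteq> {l \<in> premodular X. regularize X l \<in> W}"
    by (intro exI[of _ "premodular X \<inter> ?T"] conjI)
qed

text \<open>Turns failure of domination into an existential, hence open, condition on
  \<open>l\<close> itself, as required for the remaining Lawson subbasis sets. If
  \<open>\<nu> U\<close> exceeds the regularized value, so does \<open>\<nu> (wup X F)\<close> for
  some finite \<open>F \<subseteq> U\<close>, and this set lies inside \<open>U\<close>.\<close>

lemma regularize_upper_iff:
  assumes X: "domain X" "meet_compact X" and l: "l \<in> premodular X" and n: "\<nu> \<in> car (Vpo X)"
  shows "regularize X l \<notin> upper (Vpo X) {\<nu>} \<longleftrightarrow> (\<exists>V. scott_open X V \<and> l V < \<nu> V)"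
proof -
  have nv: "is_valuation X \<nu>" using n by (simp add: car_Vpo)
  have rc: "regularize X l \<in> car (Vpo X)" using is_valuation_regularize[OF X l] by (simp add: car_Vpo)
  have "regularize X l \<notin> upper (Vpo X) {\<nu>} \<longleftrightarrow> (\<exists>U. scott_open X U \<and> regularize X l U < \<nu> U)"
    using rc by (auto simp: upper_def leq_Vpo not_le)
  also have "\<dots> \<longleftrightarrow> (\<exists>V. scott_open X V \<and> l V < \<nu> V)"
  proof
    assume "\<exists>U. scott_open X U \<and> regularize X l U < \<nu> U"
    then obtain U where U: "scott_open X U" "regularize X l U < \<nu> U" by blast
    then obtain F where F: "finite F" "F \<subseteq> U" "regularize X l U < \<nu> (wup X F)"
      unfolding val_SUP_wup[OF X(1) nv U(1)] by (auto simp: less_SUP_iff)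
    have "l (wup X F) \<le> regularize X l U" by (rule regularize_ge[OF U(1) fin_inside_wup[OF X(1) F(1,2)]])
    then show "\<exists>V. scott_open X V \<and> l V < \<nu> V" using F(3) scott_open_wup[OF X(1), of F] le_less_trans by blast
  next
    assume "\<exists>V. scott_open X V \<and> l V < \<nu> V"
    then obtain V where "scott_open X V" "l V < \<nu> V" by blast
    then show "\<exists>U. scott_open X U \<and> regularize X l U < \<nu> U"
      using regularize_le[OF l, of V] by (intro exI[of _ V]) (auto intro: le_less_trans)
  qed
  finally show ?thesis .
qed

text \<open>\<open>regularize\<close> is a retraction of a compact space of set functions onto the valuations,
  and it is continuous for the Lawson topology.\<close>
lemma lawson_compact_Vpo:
  assumes X: "domain X" "meet_compact X"
  shows "lawson_compact (Vpo X) (car (Vpo X))"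
proof -
  let ?V = "Vpo X" and ?L = "top_of_set (premodular X)"
  have car: "regularize X l \<in> car ?V" if "l \<in> premodular X" for l
    using is_valuation_regularize[OF X that] by (simp add: car_Vpo)
  have "continuous_map ?L (lawson_topology ?V) (regularize X)"
    unfolding lawson_topology_def
  proof (rule continuous_on_generated_topo)
    have h: "car ?V \<in> {U. scott_open ?V U}" by simp
    show "regularize X ` topspace ?L \<subseteq> \<Union>({U. scott_open ?V U} \<union> {car ?V - upper ?V {x} |x. x \<in> car ?V})"
      using car by (intro image_subsetI UnionI[OF UnI1[OF h]]) simp
    fix W assume "W \<in> {U. scott_open ?V U} \<union> {car ?V - upper ?V {x} |x. x \<in> car ?V}"
    then consider "scott_open ?V W" | \<nu> where "\<nu> \<in> car ?V" "W = car ?V - upper ?V {\<nu>}" by blast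
    then show "openin ?L (regularize X -` W \<inter> topspace ?L)"
    proof cases
      case 1
      have "regularize X -` W \<inter> topspace ?L = {l \<in> premodular X. regularize X l \<in> W}" by auto
      then show ?thesis using openin_regularize_preimage[OF X 1] by simp
    next
      case 2
      have "regularize X -` W \<inter> topspace ?L = premodular X \<inter> (\<Union>V\<in>{V. scott_open X V}. {l. l V < \<nu> V})"
        using regularize_upper_iff[OF X _ 2(1)] car by (auto simp: 2(2))
      moreover have "open (\<Union>V\<in>{V. scott_open X V}. {l :: 'a val. l V < \<nu> V})"
        by (intro open_UN ballI open_Collect_less) simp_all
      ultimately show ?thesis by (simp add: openin_open_Int)
    qed
  qed
  moreover have "compactin ?L (premodular X)"
    using compact_premodular[of X] by (simp add: compactin_subtopology)
  ultimately have "compactin (lawson_topology ?V) (regularize X ` premodular X)" by (rule image_compactin[rotated])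
  moreover have "regularize X ` premodular X = car ?V"
  proof (intro subset_antisym subsetI)
    fix \<mu> assume "\<mu> \<in> car ?V"
    then have "is_valuation X \<mu>" by (simp add: car_Vpo)
    then have "\<mu> = regularize X \<mu>" "\<mu> \<in> premodular X" using regularize_val[OF X(1)] val_premodular[of X] by auto
    then show "\<mu> \<in> regularize X ` premodular X" by (rule image_eqI)
  qed (use car in auto)
  ultimately show ?thesis by (simp add: lawson_compact_def)
qed

section \<open>Continuity of the strength\<close>


text \<open>The upper half of continuity, shared by \<open>PU\<close> and \<open>PB\<close>. By
  contradiction: let \<open>U b\<close> consist of the valuations whose slice at \<open>b\<close> is
  not below \<open>\<nu>\<close>. Well-filteredness puts one \<open>upper ?V (snd p0)\<close> inside
  \<open>U a\<close>. As \<open>U a\<close> is covered by the directed family of sets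
  \<open>U (fst p)\<close>, compactness puts the same upper set inside one
  \<open>U (fst p1)\<close>. At an index above \<open>p0\<close> and \<open>p1\<close> this
  contradicts \<open>le\<close>.\<close>

lemma slice_upper_directed:
  assumes X: "poset X" and Y: "domain Y" and ne: "D \<noteq> {}"
    and D1: "\<And>p. p \<in> D \<Longrightarrow> fst p \<in> car X \<and> snd p \<subseteq> car (Vpo Y) \<and> scott_compact (Vpo Y) (snd p)"
    and D2: "\<And>p q. p \<in> D \<Longrightarrow> q \<in> D \<Longrightarrow> \<exists>r\<in>D. leq X (fst p) (fst r) \<and> leq X (fst q) (fst r) \<and>
        snd r \<subseteq> upper (Vpo Y) (snd p) \<and> snd r \<subseteq> upper (Vpo Y) (snd q)"
    and a: "is_lub X (fst ` D) a" and n: "\<nu> \<in> car (Vpo (prod_po X Y))"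
    and le: "\<And>p. p \<in> D \<Longrightarrow> \<exists>\<mu>\<in>snd p. leq (Vpo (prod_po X Y)) (slice X Y (fst p) \<mu>) \<nu>"
  shows "\<exists>\<mu>\<in>car (Vpo Y). (\<forall>p\<in>D. \<mu> \<in> upper (Vpo Y) (snd p)) \<and> leq (Vpo (prod_po X Y)) (slice X Y a \<mu>) \<nu>"
proof (rule ccontr)
  assume neg: "\<not> ?thesis"
  let ?V = "Vpo Y" and ?W = "Vpo (prod_po X Y)"
  note po = poset_Vpo[of Y] and poW = poset_Vpo[of "prod_po X Y"] and poY = domain_poset[OF Y]
  have ac: "a \<in> car X" using a by (simp add: is_lub_def)
  define U where "U b = {\<mu> \<in> car ?V. \<not> leq ?W (slice X Y b \<mu>) \<nu>}" for b
  have sc: "slice X Y b \<mu> \<in> car ?W" if "b \<in> car X" "\<mu> \<in> car ?V" for b \<mu>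
    by (rule scott_continuous_car[OF scott_continuous_slice_Vpo[OF X that(1)] that(2)])
  have Uo: "scott_open ?V (U b)" if b: "b \<in> car X" for b
  proof -
    have "scott_open ?W (car ?W - lower ?W {\<nu>})"
      using scott_closed_lower_singleton[OF poW n] by (simp add: scott_closed_def)
    from scott_open_preimage[OF scott_continuous_slice_Vpo[OF X b] this]
    have "scott_open ?V {\<mu> \<in> car ?V. slice X Y b \<mu> \<in> car ?W - lower ?W {\<nu>}}" .
    moreover have "{\<mu> \<in> car ?V. slice X Y b \<mu> \<in> car ?W - lower ?W {\<nu>}} = U b"
      unfolding U_def lower_def using sc[OF b] by blast
    ultimately show ?thesis by simp
  qed
  have Umono: "U b \<subseteq> U c" if bc: "b \<in> car X" "c \<in> car X" "leq X b c" for b c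
  proof
    fix \<mu> assume m: "\<mu> \<in> U b"
    then have mc: "\<mu> \<in> car ?V" by (simp add: U_def)
    have "leq ?W (slice X Y b \<mu>) (slice X Y c \<mu>)"
      by (rule slice_mono[OF X poY bc mc mc poset_refl[OF po mc]])
    then have "leq ?W (slice X Y c \<mu>) \<nu> \<Longrightarrow> leq ?W (slice X Y b \<mu>) \<nu>"
      using poset_trans[OF poW] sc bc mc n by blast
    then show "\<mu> \<in> U c" using m mc by (auto simp: U_def)
  qed
  let ?K = "(\<lambda>p. upper ?V (snd p)) ` D"
  have "\<exists>K\<in>?K. K \<subseteq> U a"
  proof (rule domain_well_filtered[OF domain_Vpo[OF Y]])
    show "?K \<noteq> {}" using ne by simp
    show "scott_compact ?V K \<and> saturated ?V K" if K: "K \<in> ?K" for K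
    proof -
      obtain p where p: "p \<in> D" "K = upper ?V (snd p)" using K by blast
      show ?thesis
        using scott_compact_upper[OF po, of "snd p"] saturated_upper[OF po, of "snd p"] D1[OF p(1)] p(2) by simp
    qed
    fix K L assume "K \<in> ?K" "L \<in> ?K"
    then obtain p q where pq: "p \<in> D" "q \<in> D" "K = upper ?V (snd p)" "L = upper ?V (snd q)" by blast
    obtain r where r: "r \<in> D" "snd r \<subseteq> upper ?V (snd p)" "snd r \<subseteq> upper ?V (snd q)" using D2[OF pq(1,2)] by blast
    then have "upper ?V (snd r) \<subseteq> K \<inter> L"
      using D1[OF r(1)] D1[OF pq(1)] D1[OF pq(2)] unfolding pq(3,4) by (simp add: upper_subset_iff[OF po])
    then show "\<exists>M\<in>?K. M \<subseteq> K \<inter> L" using r(1) by blast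
  next
    show "scott_open ?V (U a)" by (rule Uo[OF ac])
    show "\<Inter>?K \<subseteq> U a"
    proof
      fix \<mu> assume m: "\<mu> \<in> \<Inter>?K"
      then have all: "\<forall>p\<in>D. \<mu> \<in> upper ?V (snd p)" by simp
      moreover obtain p where "p \<in> D" using ne by blast
      ultimately have "\<mu> \<in> car ?V" using upper_sub[of ?V "snd p"] by blast
      then show "\<mu> \<in> U a" using neg all unfolding U_def by blast
    qed
  qed
  then obtain p0 where p0: "p0 \<in> D" "upper ?V (snd p0) \<subseteq> U a" by blast
  have cover: "U a \<subseteq> \<Union>((\<lambda>p. U (fst p)) ` D)"
  proof
    fix \<mu> assume m: "\<mu> \<in> U a"
    then have mc: "\<mu> \<in> car ?V" and na: "\<not> leq ?W (slice X Y a \<mu>) \<nu>" by (simp_all add: U_def)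
    note sp = scott_continuous_slice_param[OF X poY mc]
    have dX: "directed X (fst ` D)"
      unfolding directed_def
    proof (intro conjI ballI)
      show "fst ` D \<subseteq> car X" "fst ` D \<noteq> {}" using D1 ne by auto
      fix x y assume "x \<in> fst ` D" "y \<in> fst ` D"
      then obtain p q where pq: "p \<in> D" "q \<in> D" "x = fst p" "y = fst q" by blast
      then show "\<exists>z\<in>fst ` D. leq X x z \<and> leq X y z" using D2[OF pq(1,2)] by blast
    qed
    have "is_lub ?W ((\<lambda>b. slice X Y b \<mu>) ` fst ` D) (slice X Y a \<mu>)"
      by (rule scott_continuous_lub[OF sp dX a])
    then have "\<exists>d\<in>(\<lambda>b. slice X Y b \<mu>) ` fst ` D. \<not> leq ?W d \<nu>" using na n unfolding is_lub_def by blast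
    then show "\<mu> \<in> \<Union>((\<lambda>p. U (fst p)) ` D)" using mc by (auto simp: U_def)
  qed
  have "\<exists>V\<in>(\<lambda>p. U (fst p)) ` D. upper ?V (snd p0) \<subseteq> V"
  proof (rule scott_compact_directed)
    show "scott_compact ?V (upper ?V (snd p0))" using scott_compact_upper[OF po] D1[OF p0(1)] by blast
    show "(\<lambda>p. U (fst p)) ` D \<noteq> {}" using ne by simp
    show "scott_open ?V V" if "V \<in> (\<lambda>p. U (fst p)) ` D" for V using that Uo D1 by auto
    show "upper ?V (snd p0) \<subseteq> \<Union>((\<lambda>p. U (fst p)) ` D)" using p0(2) cover by (rule subset_trans)
    fix A B assume "A \<in> (\<lambda>p. U (fst p)) ` D" "B \<in> (\<lambda>p. U (fst p)) ` D"
    then obtain p q where pq: "p \<in> D" "q \<in> D" "A = U (fst p)" "B = U (fst q)" by blast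
    obtain r where r: "r \<in> D" "leq X (fst p) (fst r)" "leq X (fst q) (fst r)" using D2[OF pq(1,2)] by blast
    have "U (fst p) \<subseteq> U (fst r)" "U (fst q) \<subseteq> U (fst r)"
      using Umono r D1[OF pq(1)] D1[OF pq(2)] D1[OF r(1)] by simp_all
    then show "\<exists>T\<in>(\<lambda>p. U (fst p)) ` D. A \<union> B \<subseteq> T" using r(1) unfolding pq(3,4) by blast
  qed
  then obtain p1 where p1: "p1 \<in> D" "upper ?V (snd p0) \<subseteq> U (fst p1)" by blast
  obtain r where r: "r \<in> D" "leq X (fst p1) (fst r)" "snd r \<subseteq> upper ?V (snd p0)" using D2[OF p0(1) p1(1)] by blast
  obtain \<mu> where m: "\<mu> \<in> snd r" "leq ?W (slice X Y (fst r) \<mu>) \<nu>" using le[OF r(1)] by blast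
  have "\<mu> \<in> U (fst p1)" using m(1) r(3) p1(2) by blast
  then have "\<mu> \<in> U (fst r)" using Umono[of "fst p1" "fst r"] D1[OF p1(1)] D1[OF r(1)] r(2) by blast
  then show False using m(2) by (simp add: U_def)
qed

lemma PVstr_continuous_PU:
  assumes X: "poset X" and Y: "domain Y"
  shows "scott_continuous (prod_po X (PV PU Y)) (PV PU (prod_po X Y)) (PVstr PU X Y)"
proof -
  let ?W = "Vpo (prod_po X Y)"
  note poY = domain_poset[OF Y] and poW = poset_Vpo[of "prod_po X Y"]
  have up: "upper (Vpo Z) A = A" if "A \<in> PV_car PU Z" for A and Z :: "'z po"
    using that by (simp add: PV_car_def saturated_def)
  have le: "leq (PV PU Z) A B \<longleftrightarrow> B \<subseteq> A" if "A \<in> PV_car PU Z" "B \<in> PV_car PU Z" for A B and Z :: "'z po"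
    using that by (simp add: leq_PV PV_le_def up)
  have car: "PVstr PU X Y (a, A) \<in> PV_car PU (prod_po X Y)" if "a \<in> car X" "A \<in> PV_car PU Y" for a A
    unfolding PVstr_eq by (rule PVmap_car_PU[OF scott_continuous_slice[OF X that(1)] that(2)])
  have str: "PVstr PU X Y (a, A) = upper ?W (slice X Y a ` A)" for a A by (simp add: PVstr_slice xhull_def)
  have mono: "PVstr PU X Y (b, B) \<subseteq> PVstr PU X Y (a, A)"
    if ab: "a \<in> car X" "A \<in> PV_car PU Y" "b \<in> car X" "B \<in> PV_car PU Y" "leq X a b" "B \<subseteq> A" for a b A B
  proof -
    note s = slice_image_sub[OF X ab(1) PV_car_sub[OF ab(2)]] slice_image_sub[OF X ab(3) PV_car_sub[OF ab(4)]]
    have "slice X Y b ` B \<subseteq> upper ?W (slice X Y a ` A)"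
    proof (rule image_subsetI)
      fix \<mu> assume m: "\<mu> \<in> B"
      then have mc: "\<mu> \<in> car (Vpo Y)" using PV_car_sub[OF ab(4)] by blast
      have "leq ?W (slice X Y a \<mu>) (slice X Y b \<mu>)"
        by (rule slice_mono[OF X poY ab(1,3,5) mc mc poset_refl[OF poset_Vpo mc]])
      moreover have "slice X Y b \<mu> \<in> car ?W" using s(2) m by blast
      ultimately show "slice X Y b \<mu> \<in> upper ?W (slice X Y a ` A)" using m ab(6) unfolding upper_def by blast
    qed
    then show ?thesis unfolding str using upper_subset_iff[OF poW s(2,1)] by blast
  qed
  show ?thesis
  proof (rule PVstr_continuousI[OF car])
    show "leq (PV PU (prod_po X Y)) (PVstr PU X Y (a, A)) (PVstr PU X Y (b, B))"
      if "a \<in> car X" "A \<in> PV_car PU Y" "b \<in> car X" "B \<in> PV_car PU Y" "leq X a b" "leq (PV PU Y) A B" for a A b B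
      using mono[OF that(1-5)] le[OF that(2,4)] le[OF car[OF that(1,2)] car[OF that(3,4)]] that(6) by simp
    fix D a A u
    assume Dne: "D \<noteq> {}" and D1: "\<And>p. p \<in> D \<Longrightarrow> fst p \<in> car X \<and> snd p \<in> PV_car PU Y"
      and dir: "\<And>p q. p \<in> D \<Longrightarrow> q \<in> D \<Longrightarrow> \<exists>r\<in>D. leq X (fst p) (fst r) \<and> leq X (fst q) (fst r) \<and>
          leq (PV PU Y) (snd p) (snd r) \<and> leq (PV PU Y) (snd q) (snd r)"
      and la: "is_lub X (fst ` D) a" and lA: "is_lub (PV PU Y) (snd ` D) A"
      and u: "u \<in> PV_car PU (prod_po X Y)"
      and ule: "\<And>p. p \<in> D \<Longrightarrow> leq (PV PU (prod_po X Y)) (PVstr PU X Y (fst p, snd p)) u"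
    have ac: "a \<in> car X" "A \<in> PV_car PU Y" using la lA by (simp_all add: is_lub_def car_PV)
    have Dc: "fst p \<in> car X" "snd p \<in> PV_car PU Y" if "p \<in> D" for p using D1[OF that] by simp_all
    have D2: "\<exists>r\<in>D. leq X (fst p) (fst r) \<and> leq X (fst q) (fst r) \<and> snd r \<subseteq> snd p \<and> snd r \<subseteq> snd q"
      if pq: "p \<in> D" "q \<in> D" for p q
      using dir[OF pq] le[OF Dc(2)[OF pq(1)] Dc(2)] le[OF Dc(2)[OF pq(2)] Dc(2)] by blast
    have "u \<subseteq> PVstr PU X Y (a, A)"
    proof
      fix \<nu> assume n: "\<nu> \<in> u"
      then have nc: "\<nu> \<in> car ?W" using PV_car_sub[OF u] by blast
      have "\<exists>\<mu>\<in>car (Vpo Y). (\<forall>p\<in>D. \<mu> \<in> upper (Vpo Y) (snd p)) \<and> leq ?W (slice X Y a \<mu>) \<nu>"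
      proof (rule slice_upper_directed[OF X Y Dne _ _ la nc])
        fix p assume p: "p \<in> D"
        show "fst p \<in> car X \<and> snd p \<subseteq> car (Vpo Y) \<and> scott_compact (Vpo Y) (snd p)"
          using Dc[OF p] PV_car_sub[OF Dc(2)[OF p]] by (simp add: PV_car_def)
        have "u \<subseteq> PVstr PU X Y (fst p, snd p)" using ule[OF p] le[OF car[OF Dc[OF p]] u] by simp
        then show "\<exists>\<mu>\<in>snd p. leq ?W (slice X Y (fst p) \<mu>) \<nu>" using n unfolding str upper_def by blast
        fix q assume q: "q \<in> D"
        show "\<exists>r\<in>D. leq X (fst p) (fst r) \<and> leq X (fst q) (fst r) \<and>
           snd r \<subseteq> upper (Vpo Y) (snd p) \<and> snd r \<subseteq> upper (Vpo Y) (snd q)"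
          using D2[OF p q] up[OF Dc(2)[OF p]] up[OF Dc(2)[OF q]] by simp
      qed
      then obtain \<mu> where m: "\<mu> \<in> car (Vpo Y)" "\<forall>p\<in>D. \<mu> \<in> upper (Vpo Y) (snd p)" "leq ?W (slice X Y a \<mu>) \<nu>" by blast
      \<comment> \<open>The principal filter of \<open>\<mu>\<close> is a member of the powerdomain
        and lies in every \<open>snd p\<close>, so it is an upper bound in the reverse-inclusion
        order. Leastness of \<open>A\<close> forces \<open>\<mu> \<in> A\<close>.\<close>
      let ?M = "upper (Vpo Y) {\<mu>}"
      have mm: "{\<mu>} \<subseteq> car (Vpo Y)" using m by simp
      have M: "?M \<in> PV_car PU Y"
        using scott_compact_upper[OF poset_Vpo scott_compact_singleton[OF m(1)]] saturated_upper[OF poset_Vpo mm]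
          vconvex_upper[OF mm vconvex_singleton] upper_extensive[OF poset_Vpo mm] by (auto simp: PV_car_def)
      have "leq (PV PU Y) B ?M" if "B \<in> snd ` D" for B
      proof -
        obtain p where p: "p \<in> D" "B = snd p" using \<open>B \<in> snd ` D\<close> by blast
        have "?M \<subseteq> B"
          using upper_subset_iff[OF poset_Vpo mm PV_car_sub[OF Dc(2)[OF p(1)]]] m(2) p up[OF Dc(2)[OF p(1)]] by auto
        then show ?thesis using le[OF _ M, of B] Dc(2)[OF p(1)] p(2) by simp
      qed
      then have "leq (PV PU Y) A ?M" using lA M unfolding is_lub_def car_PV by blast
      then have "\<mu> \<in> A" using le[OF ac(2) M] upper_extensive[OF poset_Vpo mm] by blast
      then show "\<nu> \<in> PVstr PU X Y (a, A)" using m(3) nc unfolding str upper_def by blast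
    qed
    then show "leq (PV PU (prod_po X Y)) (PVstr PU X Y (a, A)) u" using le[OF car[OF ac] u] by simp
  qed
qed

section \<open>Lenses and the convex powerdomain\<close>

lemma PB_carD:
  assumes "A \<in> PV_car PB X"
  shows "lawson_compact (Vpo X) A" "order_convex (Vpo X) A" "scott_compact (Vpo X) A"
  using assms lawson_compact_scott[of "Vpo X" A] by (simp_all add: PV_car_def)

lemma lawson_closed_compact:
  assumes "lawson_compact P (car P)" "closedin (lawson_topology P) C"
  shows "lawson_compact P C"
proof -
  have "C \<subseteq> car P" using closedin_subset[OF assms(2)] by (simp add: topspace_lawson)
  then show ?thesis using assms closed_compactin[of "lawson_topology P" "car P" C] by (simp add: lawson_compact_def)
qed

lemma PVmap_car_PB:
  assumes f: "scott_continuous X Y f" and Y: "domain Y" "meet_compact Y" and A: "A \<in> PV_car PB X"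
  shows "PVmap PB X Y f A \<in> PV_car PB Y"
proof -
  let ?V = "Vpo Y" and ?B = "Vmap X Y f ` A"
  note s = Vmap_image_sub[OF f PV_car_sub[OF A]]
  have K: "scott_compact ?V (upper ?V ?B)"
    by (rule scott_compact_upper[OF poset_Vpo scott_compact_image[OF scott_continuous_Vmap[OF f] PB_carD(3)[OF A]]])
  have C: "scott_closed ?V (scott_closure ?V ?B)" by (rule scott_closed_scott_closure[OF s])
  have sat: "saturated ?V (upper ?V ?B)" by (rule saturated_upper[OF poset_Vpo s])
  have eq: "PVmap PB X Y f A = scott_closure ?V ?B \<inter> upper ?V ?B" by (simp add: PVmap_def)
  have "closedin (lawson_topology ?V) (scott_closure ?V ?B \<inter> upper ?V ?B)"
    by (rule closedin_Int[OF closedin_lawson_scott[OF C]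
          scott_compact_saturated_lawson_closed[OF domain_Vpo[OF Y(1)] K sat]])
  then have "lawson_compact ?V (PVmap PB X Y f A)"
    unfolding eq by (rule lawson_closed_compact[OF lawson_compact_Vpo[OF Y]])
  moreover have "order_convex ?V (PVmap PB X Y f A)"
    unfolding eq order_convex_def
  proof (intro ballI impI IntI)
    fix x z y assume x: "x \<in> scott_closure ?V ?B \<inter> upper ?V ?B" and z: "z \<in> scott_closure ?V ?B \<inter> upper ?V ?B"
      and y: "y \<in> car ?V" "leq ?V x y \<and> leq ?V y z"
    show "y \<in> scott_closure ?V ?B" using scott_closed_down[OF C, of z y] z y by simp
    have "y \<in> upper ?V (upper ?V ?B)" using x y by (auto simp: upper_def)
    then show "y \<in> upper ?V ?B" by (simp add: upper_upper[OF poset_Vpo s])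
  qed
  ultimately show ?thesis using PVmap_convex[OF f A] by (simp add: PV_car_def[of PB Y])
qed

text \<open>The lower set of a Lawson-compact set is already Scott closed, so the hull is contained
  in the intersection of the lower and the upper set of \<open>A\<close>, which order convexity puts
  back into \<open>A\<close>.\<close>

lemma PB_hull:
  assumes X: "domain X" and A: "A \<in> PV_car PB X"
  shows "xhull PB (Vpo X) A = A"
proof -
  let ?V = "Vpo X"
  have s: "A \<subseteq> car ?V" by (rule PV_car_sub[OF A])
  have "scott_closure ?V A \<subseteq> lower ?V A"
    by (rule scott_closure_least[OF lawson_compact_lower_closed[OF domain_Vpo[OF X] PB_carD(1)[OF A]]
          lower_extensive[OF poset_Vpo s]])
  moreover have "lower ?V A \<inter> upper ?V A \<subseteq> A"
  proof
    fix y assume "y \<in> lower ?V A \<inter> upper ?V A"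
    then obtain x z where "x \<in> A" "z \<in> A" "leq ?V x y" "leq ?V y z" "y \<in> car ?V" by (auto simp: lower_def upper_def)
    then show "y \<in> A" using PB_carD(2)[OF A] unfolding order_convex_def by blast
  qed
  ultimately have "xhull PB ?V A \<subseteq> A" unfolding xhull_def pkind.case by blast
  then show ?thesis using xhull_extensive[OF poset_Vpo s, of PB] by (rule antisym)
qed

lemma finite_subset_filtered_Inter:
  assumes "finite \<V>" "\<V> \<subseteq> \<U>" "\<U> \<noteq> {}"
    and "\<And>U V. U \<in> \<U> \<Longrightarrow> V \<in> \<U> \<Longrightarrow> \<exists>W\<in>\<U>. W \<subseteq> U \<inter> V"
  shows "\<exists>W\<in>\<U>. W \<subseteq> \<Inter>\<V>"
  using assms(1,2)
proof (induction)
  case empty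
  then show ?case using assms(3) by auto
next
  case (insert V \<V>)
  then obtain W where W: "W \<in> \<U>" "W \<subseteq> \<Inter>\<V>" by auto
  then obtain W' where W': "W' \<in> \<U>" "W' \<subseteq> V \<inter> W" using assms(4)[of V W] insert.prems by blast
  then have "W' \<subseteq> \<Inter>(insert V \<V>)" using W(2) by blast
  with W' show ?case by blast
qed

lemma lawson_filtered_nonempty:
  assumes K: "lawson_compact P (car P)" and ne: "\<G> \<noteq> {}"
    and G: "\<And>G. G \<in> \<G> \<Longrightarrow> closedin (lawson_topology P) G \<and> G \<noteq> {}"
    and filt: "\<And>G H. G \<in> \<G> \<Longrightarrow> H \<in> \<G> \<Longrightarrow> \<exists>M\<in>\<G>. M \<subseteq> G \<inter> H"
  shows "\<Inter>\<G> \<noteq> {}"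
proof -
  have cs: "compactin (lawson_topology P) (car P)" using K by (simp add: lawson_compact_def)
  have "car P \<inter> \<Inter>\<F> \<noteq> {}" if F: "finite \<F>" "\<F> \<subseteq> \<G>" for \<F>
  proof -
    obtain M where M: "M \<in> \<G>" "M \<subseteq> \<Inter>\<F>" using finite_subset_filtered_Inter[OF F ne filt] by (rule bexE)
    have "M \<subseteq> car P" "M \<noteq> {}" using G[OF M(1)] closedin_subset[of "lawson_topology P" M] by (simp_all add: topspace_lawson)
    then show ?thesis using M(2) by blast
  qed
  then have "car P \<inter> \<Inter>\<G> \<noteq> {}" using cs G unfolding compactin_fip by simp
  then show ?thesis by blast
qed

lemma PVstr_continuous_PB:
  assumes X: "domain X" "meet_compact X" and Y: "domain Y" "meet_compact Y"
  shows "scott_continuous (prod_po X (PV PB Y)) (PV PB (prod_po X Y)) (PVstr PB X Y)"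
proof -
  let ?V = "Vpo Y" and ?W = "Vpo (prod_po X Y)"
  note poX = domain_poset[OF X(1)] and poY = domain_poset[OF Y(1)]
  note poV = poset_Vpo[of Y] and poW = poset_Vpo[of "prod_po X Y"]
  note dXY = domain_prod[OF X(1) Y(1)] and mXY = meet_compact_prod[OF X(1) Y(1) X(2) Y(2)]
  have le: "leq (PV PB Z) A B \<longleftrightarrow> lower (Vpo Z) A \<subseteq> lower (Vpo Z) B \<and> upper (Vpo Z) B \<subseteq> upper (Vpo Z) A"
    for A B and Z :: "'z po"
    by (simp add: leq_PV PV_le_def)
  have car: "PVstr PB X Y (a, A) \<in> PV_car PB (prod_po X Y)" if "a \<in> car X" "A \<in> PV_car PB Y" for a A
    unfolding PVstr_eq by (rule PVmap_car_PB[OF scott_continuous_slice[OF poX that(1)] dXY mXY that(2)])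
  have str: "PVstr PB X Y (a, A) = scott_closure ?W (slice X Y a ` A) \<inter> upper ?W (slice X Y a ` A)" for a A
    by (simp add: PVstr_slice xhull_def)
  \<comment> \<open>The order on lenses compares lower and upper sets, so both halves of the hull
    must be recovered from their intersection. The lower half again uses that lower sets of lenses
    are closed.\<close>
  have up: "upper ?W (PVstr PB X Y (a, A)) = upper ?W (slice X Y a ` A)"
    and lo: "lower ?W (PVstr PB X Y (a, A)) = scott_closure ?W (slice X Y a ` A)"
    if aA: "a \<in> car X" "A \<in> PV_car PB Y" for a A
  proof -
    note s = slice_image_sub[OF poX aA(1) PV_car_sub[OF aA(2)]]
    have sub: "slice X Y a ` A \<subseteq> PVstr PB X Y (a, A)"
      unfolding str using scott_closure_extensive[of "slice X Y a ` A" ?W] upper_extensive[OF poW s] by simp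
    show "upper ?W (PVstr PB X Y (a, A)) = upper ?W (slice X Y a ` A)"
      by (rule upper_eq[OF poW s sub]) (simp add: str)
    have cl: "scott_closed ?W (lower ?W (PVstr PB X Y (a, A)))"
      by (rule lawson_compact_lower_closed[OF domain_Vpo[OF dXY] PB_carD(1)[OF car[OF aA]]])
    show "lower ?W (PVstr PB X Y (a, A)) = scott_closure ?W (slice X Y a ` A)"
    proof (rule antisym)
      show "lower ?W (PVstr PB X Y (a, A)) \<subseteq> scott_closure ?W (slice X Y a ` A)"
        by (rule lower_subset_closed[OF scott_closed_scott_closure[OF s]]) (simp add: str)
      have "PVstr PB X Y (a, A) \<subseteq> lower ?W (PVstr PB X Y (a, A))"
        by (rule lower_extensive[OF poW PV_car_sub[OF car[OF aA]]])
      then show "scott_closure ?W (slice X Y a ` A) \<subseteq> lower ?W (PVstr PB X Y (a, A))"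
        using sub by (intro scott_closure_least[OF cl]) (rule subset_trans)
    qed
  qed
  have mono: "leq (PV PB (prod_po X Y)) (PVstr PB X Y (a, A)) (PVstr PB X Y (b, B))"
    if a: "a \<in> car X" "A \<in> PV_car PB Y" and b: "b \<in> car X" "B \<in> PV_car PB Y"
      and ab: "leq X a b" "leq (PV PB Y) A B" for a b A B
  proof -
    note Ac = PV_car_sub[OF a(2)] and Bc = PV_car_sub[OF b(2)]
    note sA = slice_image_sub[OF poX a(1) Ac] and sB = slice_image_sub[OF poX b(1) Bc]
    have AB: "A \<subseteq> lower ?V B" "B \<subseteq> upper ?V A"
      using ab(2) unfolding le lower_subset_iff[OF poV Ac Bc] upper_subset_iff[OF poV Bc Ac] by blast+
    note cB = scott_closed_scott_closure[OF sB]
    have "slice X Y a ` A \<subseteq> scott_closure ?W (slice X Y b ` B)"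
    proof (rule image_subsetI)
      fix \<mu> assume m: "\<mu> \<in> A"
      then obtain \<mu>' where m': "\<mu>' \<in> B" "leq ?V \<mu> \<mu>'" using AB(1) unfolding lower_def by blast
      have c: "\<mu> \<in> car ?V" "\<mu>' \<in> car ?V" using m m' Ac Bc by blast+
      have "slice X Y b \<mu>' \<in> scott_closure ?W (slice X Y b ` B)"
        using scott_closure_extensive[of "slice X Y b ` B" ?W] m'(1) by blast
      moreover have "slice X Y a \<mu> \<in> car ?W" using sA m by blast
      ultimately show "slice X Y a \<mu> \<in> scott_closure ?W (slice X Y b ` B)"
        by (rule scott_closed_down[OF cB]) (rule slice_mono[OF poX poY a(1) b(1) ab(1) c m'(2)])
    qed
    then have 1: "scott_closure ?W (slice X Y a ` A) \<subseteq> scott_closure ?W (slice X Y b ` B)"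
      by (rule scott_closure_least[OF cB])
    have "slice X Y b ` B \<subseteq> upper ?W (slice X Y a ` A)"
    proof (rule image_subsetI)
      fix \<mu> assume m: "\<mu> \<in> B"
      then obtain \<mu>' where m': "\<mu>' \<in> A" "leq ?V \<mu>' \<mu>" using AB(2) unfolding upper_def by blast
      have c: "\<mu>' \<in> car ?V" "\<mu> \<in> car ?V" using m m' Ac Bc by blast+
      have "leq ?W (slice X Y a \<mu>') (slice X Y b \<mu>)" by (rule slice_mono[OF poX poY a(1) b(1) ab(1) c m'(2)])
      moreover have "slice X Y b \<mu> \<in> car ?W" using sB m by blast
      ultimately show "slice X Y b \<mu> \<in> upper ?W (slice X Y a ` A)" using m'(1) unfolding upper_def by blast
    qed
    then have 2: "upper ?W (slice X Y b ` B) \<subseteq> upper ?W (slice X Y a ` A)"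
      using upper_subset_iff[OF poW sB sA] by blast
    show ?thesis unfolding le up[OF a] up[OF b] lo[OF a] lo[OF b] using 1 2 by blast
  qed
  show ?thesis
  proof (rule PVstr_continuousI[OF car])
    show "leq (PV PB (prod_po X Y)) (PVstr PB X Y (a, A)) (PVstr PB X Y (b, B))"
      if "a \<in> car X" "A \<in> PV_car PB Y" "b \<in> car X" "B \<in> PV_car PB Y" "leq X a b" "leq (PV PB Y) A B" for a A b B
      by (rule mono[OF that])
    fix D a A u
    assume Dne: "D \<noteq> {}" and D1: "\<And>p. p \<in> D \<Longrightarrow> fst p \<in> car X \<and> snd p \<in> PV_car PB Y"
      and dir: "\<And>p q. p \<in> D \<Longrightarrow> q \<in> D \<Longrightarrow> \<exists>r\<in>D. leq X (fst p) (fst r) \<and> leq X (fst q) (fst r) \<and>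
          leq (PV PB Y) (snd p) (snd r) \<and> leq (PV PB Y) (snd q) (snd r)"
      and la: "is_lub X (fst ` D) a" and lA: "is_lub (PV PB Y) (snd ` D) A"
      and u: "u \<in> PV_car PB (prod_po X Y)"
      and ule: "\<And>p. p \<in> D \<Longrightarrow> leq (PV PB (prod_po X Y)) (PVstr PB X Y (fst p, snd p)) u"
    have ac: "a \<in> car X" "A \<in> PV_car PB Y" using la lA by (simp_all add: is_lub_def car_PV)
    have Dc: "fst p \<in> car X" "snd p \<in> PV_car PB Y" if "p \<in> D" for p using D1[OF that] by simp_all
    have Dv: "snd p \<subseteq> car ?V" if "p \<in> D" for p by (rule PV_car_sub[OF Dc(2)[OF that]])
    have D2: "\<exists>r\<in>D. (leq X (fst p) (fst r) \<and> leq X (fst q) (fst r)) \<and>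
        (snd p \<subseteq> lower ?V (snd r) \<and> snd q \<subseteq> lower ?V (snd r)) \<and>
        (snd r \<subseteq> upper ?V (snd p) \<and> snd r \<subseteq> upper ?V (snd q))"
      if pq: "p \<in> D" "q \<in> D" for p q
    proof -
      obtain r where r: "r \<in> D" "leq (PV PB Y) (snd p) (snd r)" "leq (PV PB Y) (snd q) (snd r)"
        "leq X (fst p) (fst r)" "leq X (fst q) (fst r)" using dir[OF pq] by blast
      then show ?thesis
        unfolding le lower_subset_iff[OF poV Dv[OF pq(1)] Dv[OF r(1)]] lower_subset_iff[OF poV Dv[OF pq(2)] Dv[OF r(1)]]
          upper_subset_iff[OF poV Dv[OF r(1)] Dv[OF pq(1)]] upper_subset_iff[OF poV Dv[OF r(1)] Dv[OF pq(2)]]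
        using r(1) by blast
    qed
    \<comment> \<open>\<open>C\<close> absorbs the lower information of the family and the
      intersection of upper sets the upper information. Cofinality has to be proved in both
      directions: \<open>c1\<close> says that a common member of all upper sets is above a point of
      \<open>M\<close>, \<open>c2\<close> that every point of a \<open>snd p\<close> is below a
      point of \<open>M\<close>.\<close>
    define C where "C = scott_closure ?V (\<Union>(snd ` D))"
    define M where "M = C \<inter> (\<Inter>p\<in>D. upper ?V (snd p))"
    have sub: "\<Union>(snd ` D) \<subseteq> car ?V" using Dv by blast
    have Cc: "scott_closed ?V C" unfolding C_def by (rule scott_closed_scott_closure[OF sub])
    have inC: "snd p \<subseteq> C" if "p \<in> D" for p
      unfolding C_def using scott_closure_extensive[of "\<Union>(snd ` D)" ?V] that by blast
    note clC = closedin_lawson_scott[OF Cc]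
    have clU: "closedin (lawson_topology ?V) (upper ?V (snd p))" if p: "p \<in> D" for p
      by (rule scott_compact_saturated_lawson_closed[OF domain_Vpo[OF Y(1)]
          scott_compact_upper[OF poV PB_carD(3)[OF Dc(2)[OF p]]] saturated_upper[OF poV Dv[OF p]]])
    have upup: "upper ?V (snd r) \<subseteq> upper ?V (snd p)" if "r \<in> D" "p \<in> D" "snd r \<subseteq> upper ?V (snd p)" for r p
      using upper_subset_iff[OF poV Dv[OF that(1)] Dv[OF that(2)]] that(3) by blast
    \<comment> \<open>\<open>M\<close> meets every Lawson-closed set that meets all \<open>C \<inter> \<up>(snd p)\<close>.\<close>
    have meets: "\<exists>k\<in>M. k \<in> E"
      if E: "closedin (lawson_topology ?V) E" "\<And>p. p \<in> D \<Longrightarrow> C \<inter> upper ?V (snd p) \<inter> E \<noteq> {}" for E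
    proof -
      let ?G = "(\<lambda>p. C \<inter> upper ?V (snd p) \<inter> E) ` D"
      have "\<Inter>?G \<noteq> {}"
      proof (rule lawson_filtered_nonempty[OF lawson_compact_Vpo[OF Y]])
        show "?G \<noteq> {}" using Dne by simp
        show "closedin (lawson_topology ?V) G \<and> G \<noteq> {}" if G: "G \<in> ?G" for G
        proof -
          obtain p where p: "p \<in> D" "G = C \<inter> upper ?V (snd p) \<inter> E" using G by blast
          show ?thesis unfolding p(2) using closedin_Int[OF closedin_Int[OF clC clU[OF p(1)]] E(1)] E(2)[OF p(1)] by blast
        qed
        fix G H assume "G \<in> ?G" "H \<in> ?G"
        then obtain p q where pq: "p \<in> D" "q \<in> D" "G = C \<inter> upper ?V (snd p) \<inter> E" "H = C \<inter> upper ?V (snd q) \<inter> E" by blast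
        obtain r where r: "r \<in> D" "snd r \<subseteq> upper ?V (snd p)" "snd r \<subseteq> upper ?V (snd q)" using D2[OF pq(1,2)] by blast
        have "C \<inter> upper ?V (snd r) \<inter> E \<subseteq> G \<inter> H"
          using upup[OF r(1) pq(1) r(2)] upup[OF r(1) pq(2) r(3)] unfolding pq(3,4) by blast
        then show "\<exists>M\<in>?G. M \<subseteq> G \<inter> H" using r(1) by blast
      qed
      then obtain k where k: "\<And>p. p \<in> D \<Longrightarrow> k \<in> C \<inter> upper ?V (snd p) \<inter> E" by blast
      obtain p0 where "p0 \<in> D" using Dne by blast
      from k[OF this] k show ?thesis unfolding M_def by blast
    qed
    have c1: "m \<in> upper ?V M" if m: "\<And>p. p \<in> D \<Longrightarrow> m \<in> upper ?V (snd p)" for m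
    proof -
      obtain p0 where "p0 \<in> D" using Dne by blast
      then have mc: "m \<in> car ?V" using m upper_sub[of ?V "snd p0"] by blast
      \<comment> \<open>The test set is the principal ideal of \<open>m\<close>: a point of
        \<open>snd p\<close> below \<open>m\<close> lies in all three sets.\<close>
      have "\<exists>k\<in>M. k \<in> lower ?V {m}"
      proof (rule meets[OF closedin_lawson_scott[OF scott_closed_lower_singleton[OF poV mc]]])
        fix p assume p: "p \<in> D"
        then obtain k where k: "k \<in> snd p" "leq ?V k m" using m[OF p] unfolding upper_def by blast
        then have "k \<in> upper ?V (snd p)" "k \<in> C" "k \<in> lower ?V {m}"
          using upper_extensive[OF poV Dv[OF p]] inC[OF p] Dv[OF p] by (auto simp: lower_def)
        then show "C \<inter> upper ?V (snd p) \<inter> lower ?V {m} \<noteq> {}" by blast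
      qed
      then show ?thesis using mc unfolding lower_def upper_def by blast
    qed
    have c2: "m \<in> lower ?V M" if p: "p \<in> D" and m: "m \<in> snd p" for p m
    proof -
      have mc: "m \<in> car ?V" using Dv[OF p] m by blast
      have "closedin (lawson_topology ?V) (upper ?V {m})"
        using openin_lawson_upper[OF mc] upper_sub[of ?V "{m}"] by (simp add: closedin_def topspace_lawson)
      \<comment> \<open>The test set is the principal filter of \<open>m\<close>. For an index
        \<open>q\<close>, a member of \<open>snd r\<close> above \<open>m\<close>, with
        \<open>r\<close> above both indices, lies in all three sets.\<close>
      then have "\<exists>k\<in>M. k \<in> upper ?V {m}"
      proof (rule meets)
        fix q assume q: "q \<in> D"
        obtain r where r: "r \<in> D" "snd p \<subseteq> lower ?V (snd r)" "snd r \<subseteq> upper ?V (snd q)" using D2[OF p q] by blast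
        then obtain k where k: "k \<in> snd r" "leq ?V m k" using m unfolding lower_def by blast
        then have "k \<in> upper ?V (snd q)" "k \<in> C" "k \<in> upper ?V {m}"
          using r inC[OF r(1)] Dv[OF r(1)] by (auto simp: upper_def)
        then show "C \<inter> upper ?V (snd q) \<inter> upper ?V {m} \<noteq> {}" by blast
      qed
      then show ?thesis using mc unfolding lower_def upper_def by blast
    qed
    have Mne: "M \<noteq> {}"
    proof -
      obtain p where p: "p \<in> D" using Dne by blast
      then obtain m where "m \<in> snd p" using PV_car_ne[OF Dc(2)[OF p]] by blast
      then show ?thesis using c2[OF p] unfolding lower_def by blast
    qed
    have convC: "vconvex C"
    proof -
      \<comment> \<open>Inclusion makes the lower sets directed, though possibly not the sets
        \<open>snd p\<close> themselves; passing to lower sets leaves the closure unchanged.\<close>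
      let ?L = "\<Union>p\<in>D. lower ?V (snd p)"
      have L: "vconvex ?L"
      proof (rule vconvex_directed_UN)
        show "vconvex (lower ?V (snd p))" if "p \<in> D" for p
          by (rule vconvex_lower[OF Dv[OF that] PV_car_vconvex[OF Dc(2)[OF that]]])
        show "\<exists>r\<in>D. lower ?V (snd p) \<subseteq> lower ?V (snd r) \<and> lower ?V (snd q) \<subseteq> lower ?V (snd r)"
          if pq: "p \<in> D" "q \<in> D" for p q
        proof -
          obtain r where r: "r \<in> D" "snd p \<subseteq> lower ?V (snd r)" "snd q \<subseteq> lower ?V (snd r)" using D2[OF pq] by blast
          then show ?thesis
            using lower_subset_iff[OF poV Dv[OF pq(1)] Dv[OF r(1)]] lower_subset_iff[OF poV Dv[OF pq(2)] Dv[OF r(1)]] by blast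
        qed
      qed
      have Lc: "?L \<subseteq> car ?V" using lower_sub[of ?V] by blast
      have "scott_closure ?V ?L = C"
        unfolding C_def
      proof (rule scott_closure_eq[OF _ _ sub])
        show "\<Union>(snd ` D) \<subseteq> ?L" using lower_extensive[OF poV Dv] by blast
        have "lower ?V (snd p) \<subseteq> C" if "p \<in> D" for p by (rule lower_subset_closed[OF Cc inC[OF that]])
        then show "?L \<subseteq> scott_closure ?V (\<Union>(snd ` D))" unfolding C_def by blast
      qed
      with vconvex_scott_closure[OF Lc L] show ?thesis by simp
    qed
    have Mcl: "closedin (lawson_topology ?V) M"
      unfolding M_def using clU Dne by (intro closedin_Int[OF clC] closedin_INT) auto
    have "vconvex M"
      unfolding M_def
      by (intro vconvex_Int[OF convC] vconvex_INT vconvex_upper Dv PV_car_vconvex[OF Dc(2)])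
    moreover have "order_convex ?V M"
      unfolding order_convex_def
    proof (intro ballI impI)
      fix x z y assume x: "x \<in> M" and z: "z \<in> M" and y: "y \<in> car ?V" "leq ?V x y \<and> leq ?V y z"
      have "y \<in> C" using scott_closed_down[OF Cc, of z y] z y by (simp add: M_def)
      moreover have "y \<in> upper ?V (snd p)" if p: "p \<in> D" for p
      proof -
        have "x \<in> upper ?V (snd p)" using x p by (simp add: M_def)
        then have "y \<in> upper ?V (upper ?V (snd p))" using y unfolding upper_def by blast
        then show ?thesis by (simp add: upper_upper[OF poV Dv[OF p]])
      qed
      ultimately show "y \<in> M" by (simp add: M_def)
    qed
    ultimately have M: "M \<in> PV_car PB Y"
      using Mne lawson_closed_compact[OF lawson_compact_Vpo[OF Y] Mcl] by (simp add: PV_car_def)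
    note Mv = PV_car_sub[OF M] and Av = PV_car_sub[OF ac(2)]
    have "leq (PV PB Y) B M" if B: "B \<in> snd ` D" for B
    proof -
      obtain p where p: "p \<in> D" "B = snd p" using B by blast
      have "snd p \<subseteq> lower ?V M" using c2[OF p(1)] by blast
      moreover have "M \<subseteq> upper ?V (snd p)" using p(1) by (auto simp: M_def)
      ultimately show ?thesis
        unfolding p(2) le lower_subset_iff[OF poV Dv[OF p(1)] Mv] upper_subset_iff[OF poV Mv Dv[OF p(1)]] by blast
    qed
    then have "leq (PV PB Y) A M" using lA M unfolding is_lub_def car_PV by blast
    then have AM: "lower ?V A \<subseteq> lower ?V M" "upper ?V M \<subseteq> upper ?V A" unfolding le by blast+
    have "lower ?V M \<subseteq> C" by (rule lower_subset_closed[OF Cc]) (simp add: M_def)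
    then have AC: "A \<subseteq> C" using lower_extensive[OF poV Av] AM(1) by blast
    have up_le: "scott_closure ?W (slice X Y (fst p) ` snd p) \<subseteq> lower ?W u"
      "upper ?W u \<subseteq> upper ?W (slice X Y (fst p) ` snd p)" if p: "p \<in> D" for p
    proof -
      note ule[OF p]
      then show "scott_closure ?W (slice X Y (fst p) ` snd p) \<subseteq> lower ?W u"
        "upper ?W u \<subseteq> upper ?W (slice X Y (fst p) ` snd p)"
        unfolding le up[OF Dc[OF p]] lo[OF Dc[OF p]] by blast+
    qed
    have ucl: "scott_closed ?W (lower ?W u)"
      by (rule lawson_compact_lower_closed[OF domain_Vpo[OF dXY] PB_carD(1)[OF u]])
    have "slice X Y a ` C \<subseteq> lower ?W u"
      unfolding C_def
    proof (rule slice_closure_directed_subset[OF poX poY Dne _ _ la ucl])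
      fix p assume p: "p \<in> D"
      show "fst p \<in> car X \<and> snd p \<subseteq> car ?V" using Dc(1)[OF p] Dv[OF p] by blast
      show "slice X Y (fst p) ` snd p \<subseteq> lower ?W u"
        using scott_closure_extensive up_le(1)[OF p] by (rule subset_trans)
      fix q assume q: "q \<in> D"
      show "\<exists>r\<in>D. leq X (fst p) (fst r) \<and> leq X (fst q) (fst r) \<and> snd p \<subseteq> lower ?V (snd r) \<and> snd q \<subseteq> lower ?V (snd r)"
        using D2[OF p q] by blast
    qed
    then have "slice X Y a ` A \<subseteq> lower ?W u" using AC by blast
    then have 1: "scott_closure ?W (slice X Y a ` A) \<subseteq> lower ?W u" by (rule scott_closure_least[OF ucl])
    have "u \<subseteq> upper ?W (slice X Y a ` A)"
    proof
      fix \<nu> assume n: "\<nu> \<in> u"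
      then have nc: "\<nu> \<in> car ?W" using PV_car_sub[OF u] by blast
      have nu: "\<nu> \<in> upper ?W u" using upper_extensive[OF poW PV_car_sub[OF u]] n by blast
      have "\<exists>\<mu>\<in>car ?V. (\<forall>p\<in>D. \<mu> \<in> upper ?V (snd p)) \<and> leq ?W (slice X Y a \<mu>) \<nu>"
      proof (rule slice_upper_directed[OF poX Y(1) Dne _ _ la nc])
        fix p assume p: "p \<in> D"
        show "fst p \<in> car X \<and> snd p \<subseteq> car ?V \<and> scott_compact ?V (snd p)"
          using Dc(1)[OF p] Dv[OF p] PB_carD(3)[OF Dc(2)[OF p]] by blast
        show "\<exists>\<mu>\<in>snd p. leq ?W (slice X Y (fst p) \<mu>) \<nu>" using up_le(2)[OF p] nu unfolding upper_def by blast
        fix q assume q: "q \<in> D"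
        show "\<exists>r\<in>D. leq X (fst p) (fst r) \<and> leq X (fst q) (fst r) \<and> snd r \<subseteq> upper ?V (snd p) \<and> snd r \<subseteq> upper ?V (snd q)"
          using D2[OF p q] by blast
      qed
      then obtain \<mu> where m: "\<mu> \<in> car ?V" "\<And>p. p \<in> D \<Longrightarrow> \<mu> \<in> upper ?V (snd p)" "leq ?W (slice X Y a \<mu>) \<nu>" by blast
      \<comment> \<open>\<open>\<mu>\<close> is above a point of \<open>M\<close> by
        \<open>c1\<close>. Since \<open>A\<close> is below \<open>M\<close> in the powerdomain, that
        point is above one of \<open>A\<close>.\<close>
      have "\<mu> \<in> upper ?V A" using c1[OF m(2)] AM(2) by blast
      then obtain \<kappa> where k: "\<kappa> \<in> A" "leq ?V \<kappa> \<mu>" unfolding upper_def by blast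
      have kc: "\<kappa> \<in> car ?V" using k(1) Av by blast
      have sc: "slice X Y a \<kappa> \<in> car ?W" "slice X Y a \<mu> \<in> car ?W"
        using scott_continuous_car[OF scott_continuous_slice_Vpo[OF poX ac(1)]] kc m(1) by blast+
      have "leq ?W (slice X Y a \<kappa>) (slice X Y a \<mu>)"
        by (rule slice_mono[OF poX poY ac(1) ac(1) poset_refl[OF poX ac(1)] kc m(1) k(2)])
      then have "leq ?W (slice X Y a \<kappa>) \<nu>" by (rule poset_trans[OF poW _ m(3) sc nc])
      then show "\<nu> \<in> upper ?W (slice X Y a ` A)" using k(1) nc unfolding upper_def by blast
    qed
    then have 2: "upper ?W u \<subseteq> upper ?W (slice X Y a ` A)"
      using upper_subset_iff[OF poW PV_car_sub[OF u] slice_image_sub[OF poX ac(1) Av]] by blast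
    show "leq (PV PB (prod_po X Y)) (PVstr PB X Y (a, A)) u"
      unfolding le up[OF ac] lo[OF ac] using 1 2 by blast
  qed
qed

lemma PVstr_continuous:
  assumes "admissible x X" "admissible x Y"
  shows "scott_continuous (prod_po X (PV x Y)) (PV x (prod_po X Y)) (PVstr x X Y)"
proof -
  have d: "domain X" "domain Y" using assms by (simp_all add: admissible_def)
  note p = domain_poset[OF d(1)] domain_poset[OF d(2)]
  show ?thesis
  proof (cases x)
    case PL then show ?thesis using PVstr_continuous_PL[OF p] by simp
  next
    case PU then show ?thesis using PVstr_continuous_PU[OF p(1) d(2)] by simp
  next
    case PB
    then have "coherent X" "coherent Y" using assms by (simp_all add: admissible_def)
    then have "meet_compact X" "meet_compact Y" using coherent_meet_compact p by blast+
    then show ?thesis using PVstr_continuous_PB d PB by simp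
  qed
qed

lemma xhull_PV_car:
  assumes "domain Y" "A \<in> PV_car x Y" shows "xhull x (Vpo Y) A = A"
proof (cases x)
  case PL then show ?thesis using assms(2) scott_closure_closed[of "Vpo Y" A] by (simp add: xhull_def PV_car_def)
next
  case PU then show ?thesis using assms(2) by (simp add: xhull_def PV_car_def saturated_def)
next
  case PB then show ?thesis using assms PB_hull by simp
qed


theorem mainTheorem1:
  fixes x :: pkind
    and X :: "'a po" and Y :: "'b po" and X' :: "'c po" and Y' :: "'d po" and Z :: "'e po"
  assumes "admissible x X" and "admissible x Y" and "admissible x X'"
    and "admissible x Y'" and "admissible x Z"
  shows
    \<comment> \<open>str is a Scott-continuous map X \<times> P_xV(Y) \<rightarrow> P_xV(X \<times> Y)\<close>
    "scott_continuous (prod_po X (PV x Y)) (PV x (prod_po X Y)) (PVstr x X Y)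
     \<comment> \<open>values on basic elements\<close>
     \<and> (\<forall>a\<in>car X. \<forall>(J::nat set) (I::nat \<Rightarrow> nat set) c y.
          finite J \<and> J \<noteq> {} \<and> (\<forall>j\<in>J. finite (I j) \<and> (\<forall>i\<in>I j. c j i \<ge> 0 \<and> y j i \<in> car Y))
          \<longrightarrow> PVstr x X Y (a, xgen x Y ((\<lambda>j. vsum (I j) (\<lambda>i. vscale (c j i) (dirac Y (y j i)))) ` J))
              = xgen x (prod_po X Y)
                  ((\<lambda>j. vsum (I j) (\<lambda>i. vscale (c j i) (dirac (prod_po X Y) (a, y j i)))) ` J))
     \<comment> \<open>naturality in X and Y\<close>
     \<and> (\<forall>f g. scott_continuous X X' f \<and> scott_continuous Y Y' g \<longrightarrow>
          (\<forall>a\<in>car X. \<forall>A\<in>PV_car x Y.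
             PVmap x (prod_po X Y) (prod_po X' Y') (\<lambda>(p, q). (f p, g q)) (PVstr x X Y (a, A))
             = PVstr x X' Y' (f a, PVmap x Y Y' g A)))
     \<comment> \<open>unit axiom\<close>
     \<and> (\<forall>A\<in>PV_car x Y. PVmap x (prod_po unit_po Y) Y snd (PVstr x unit_po Y ((), A)) = A)
     \<comment> \<open>associativity axiom\<close>
     \<and> (\<forall>a\<in>car X. \<forall>b\<in>car Y. \<forall>A\<in>PV_car x Z.
          PVmap x (prod_po (prod_po X Y) Z) (prod_po X (prod_po Y Z)) (\<lambda>((p, q), r). (p, (q, r)))
            (PVstr x (prod_po X Y) Z ((a, b), A))
          = PVstr x X (prod_po Y Z) (a, PVstr x Y Z (b, A)))"
proof -
  have d: "domain X" "domain Y" "domain X'" "domain Y'" "domain Z"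
    using assms by (simp_all add: admissible_def)
  note pX = domain_poset[OF d(1)] and pY = domain_poset[OF d(2)] and pX' = domain_poset[OF d(3)]
  show ?thesis
  proof (intro conjI allI ballI impI)
    show "scott_continuous (prod_po X (PV x Y)) (PV x (prod_po X Y)) (PVstr x X Y)"
      by (rule PVstr_continuous[OF assms(1,2)])
  next
    fix a J I c y
    assume a: "a \<in> car X"
      and J: "finite (J :: nat set) \<and> J \<noteq> {} \<and> (\<forall>j\<in>J. finite (I j :: nat set) \<and> (\<forall>i\<in>I j. (0::real) \<le> c j i \<and> y j i \<in> car Y))"
    show "PVstr x X Y (a, xgen x Y ((\<lambda>j. vsum (I j) (\<lambda>i. vscale (c j i) (dirac Y (y j i)))) ` J))
        = xgen x (prod_po X Y) ((\<lambda>j. vsum (I j) (\<lambda>i. vscale (c j i) (dirac (prod_po X Y) (a, y j i)))) ` J)"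
      by (rule PVstr_basic[OF pX a]) (use J in blast)
  next
    fix f g a A assume "scott_continuous X X' f \<and> scott_continuous Y Y' g" "a \<in> car X" "A \<in> PV_car x Y"
    then show "PVmap x (prod_po X Y) (prod_po X' Y') (\<lambda>(p, q). (f p, g q)) (PVstr x X Y (a, A))
        = PVstr x X' Y' (f a, PVmap x Y Y' g A)"
      by (intro PVstr_natural[OF pX pX'] PV_car_sub) auto
  next
    fix A assume A: "A \<in> PV_car x Y"
    show "PVmap x (prod_po unit_po Y) Y snd (PVstr x unit_po Y ((), A)) = A"
      by (rule PVstr_unit[OF pY A xhull_PV_car[OF d(2) A]])
  next
    fix a b A assume "a \<in> car X" "b \<in> car Y" "A \<in> PV_car x Z"
    then show "PVmap x (prod_po (prod_po X Y) Z) (prod_po X (prod_po Y Z)) (\<lambda>((p, q), r). (p, (q, r)))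
        (PVstr x (prod_po X Y) Z ((a, b), A)) = PVstr x X (prod_po Y Z) (a, PVstr x Y Z (b, A))"
      by (intro PVstr_assoc[OF pX pY] PV_car_sub)
  qed
qed

end
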